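(* Let $(\Sigma,\sigma)$ be a topologically mixing countable state Markov shift and let $\mathcal{F}=\{\log f_n\}_{n=1}^{\infty}$ be an almost-additive Bowen sequence on $\Sigma$ with $\sup f_1<\infty$. Then $$P(\mathcal{F})=\sup\left\{h(\mu)+\lim_{n\to\infty}\frac1n\int\log f_n\,d\mu \;:\; \mu\in\mathcal{M}\text{ and }\lim_{n\to\infty}\frac1n\int\log f_n\,d\mu\neq-\infty\right\}$$ $$=\sup\left\{h(\mu)+\int\lim_{n\to\infty}\frac1n\log f_n\,d\mu \;:\; \mu\in\mathcal{M}\text{ and }\int\lim_{n\to\infty}\frac1n\log f_n\,d\mu\neq-\infty\right\}.$$
   Context: Let $S$ be a countable alphabet and $(t_{ij})_{S\times S}$ a matrix of zeros and ones with no row and no column made entirely of zeros. The (one-sided) countable Markov shift is $\Sigma=\{x=(x_0,x_1,\dots)\in S^{\mathbb{N}_0}: t_{x_ix_{i+1}}=1\text{ for all } i\ge 0\}$ with the shift map $(\sigma x)_n=x_{n+1}$, with the topology generated by cylinders $C_{i_0\dots i_{n-1}}=\{x\in\Sigma: x_j=i_j,\ 0\le j\le n-1\}$. It is topologically mixing if for all $a,b\in S$ there is $N_{ab}\in\mathbb{N}$ with $C_a\cap\sigma^{-n}C_b\ne\emptyset$ for all $n>N_{ab}$. $\mathcal{M}$ is the set of $\sigma$-invariant Borel probability measures on $\Sigma$ and $h(\mu)$ is the measure-theoretic entropy of $\mu$ with respect to $\sigma$. Let $f_n:\Sigma\to(0,\infty)$, $n\in\mathbb{N}$, be continuous. The sequence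 $\mathcal{F}=\{\log f_n\}_{n=1}^\infty$ is almost-additive if there is a constant $C\ge 0$ such that for all $n,m\in\mathbb{N}$, $x\in\Sigma$: $f_n(x)f_m(\sigma^nx)e^{-C}\le f_{n+m}(x)\le f_n(x)f_m(\sigma^nx)e^{C}$. It is a Bowen sequence if there is $M>0$ with $\sup_n A_n\le M$, where $A_n=\sup\{f_n(x)/f_n(y): x,y\in\Sigma,\ x_i=y_i\text{ for }0\le i\le n-1\}$. For an almost-additive Bowen sequence on a topologically mixing countable Markov shift, and $a\in S$, put $Z_n(\mathcal{F},a)=\sum_{\sigma^nx=x}f_n(x)\chi_{C_a}(x)$, where $\chi_{C_a}$ is the characteristic function of $C_a$. The almost-additive Gurevich pressure is $P(\mathcal{F})=\lim_{n\to\infty}\frac1n\log Z_n(\mathcal{F},a)\in(-\infty,\infty]$; this limit exists and does not depend on $a$. *)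

theory Defs
  imports "HOL-Probability.Probability"
begin

section \<open>Countable Markov shifts\<close>

definition transition_matrix :: "'a set \<Rightarrow> ('a \<Rightarrow> 'a \<Rightarrow> nat) \<Rightarrow> bool" where
  "transition_matrix S t \<longleftrightarrow>
     (\<forall>i\<in>S. \<forall>j\<in>S. t i j \<in> {0, 1}) \<and>
     (\<forall>i\<in>S. \<exists>j\<in>S. t i j \<noteq> 0) \<and>
     (\<forall>j\<in>S. \<exists>i\<in>S. t i j \<noteq> 0)"

definition markov_shift :: "'a set \<Rightarrow> ('a \<Rightarrow> 'a \<Rightarrow> nat) \<Rightarrow> (nat \<Rightarrow> 'a) set" where
  "markov_shift S t = {x. (\<forall>i. x i \<in> S) \<and> (\<forall>i. t (x i) (x (Suc i)) = 1)}"

definition shift_map :: "(nat \<Rightarrow> 'a) \<Rightarrow> nat \<Rightarrow> 'a" where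
  "shift_map x = (\<lambda>n. x (Suc n))"

definition cylinder :: "'a set \<Rightarrow> ('a \<Rightarrow> 'a \<Rightarrow> nat) \<Rightarrow> 'a list \<Rightarrow> (nat \<Rightarrow> 'a) set" where
  "cylinder S t w = {x \<in> markov_shift S t. \<forall>j<length w. x j = w ! j}"

definition shift_topology :: "'a set \<Rightarrow> ('a \<Rightarrow> 'a \<Rightarrow> nat) \<Rightarrow> (nat \<Rightarrow> 'a) topology" where
  "shift_topology S t = topology_generated_by {cylinder S t w |w. w \<in> lists S \<and> w \<noteq> []}"

definition shift_borel :: "'a set \<Rightarrow> ('a \<Rightarrow> 'a \<Rightarrow> nat) \<Rightarrow> (nat \<Rightarrow> 'a) measure" where
  "shift_borel S t = sigma (markov_shift S t) {U. openin (shift_topology S t) U}"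

definition topologically_mixing :: "'a set \<Rightarrow> ('a \<Rightarrow> 'a \<Rightarrow> nat) \<Rightarrow> bool" where
  "topologically_mixing S t \<longleftrightarrow>
     (\<forall>a\<in>S. \<forall>b\<in>S. \<exists>N. \<forall>n>N. cylinder S t [a] \<inter> (shift_map ^^ n) -` cylinder S t [b] \<noteq> {})"

definition invariant_measures ::
    "'a set \<Rightarrow> ('a \<Rightarrow> 'a \<Rightarrow> nat) \<Rightarrow> (nat \<Rightarrow> 'a) measure set" where
  "invariant_measures S t =
     {\<mu>. sets \<mu> = sets (shift_borel S t) \<and> prob_space \<mu> \<and>
         (\<forall>A\<in>sets \<mu>. emeasure \<mu> (shift_map -` A \<inter> space \<mu>) = emeasure \<mu> A)}"

section \<open>Measure-theoretic entropy\<close>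

text \<open>The convention \<open>0 log 0 = 0\<close> holds because \<open>0 * ln 0 = 0\<close>.\<close>

definition partition_entropy :: "'x measure \<Rightarrow> 'x set set \<Rightarrow> real" where
  "partition_entropy M P = - (\<Sum>A\<in>P. measure M A * ln (measure M A))"

definition iterated_partition :: "'x measure \<Rightarrow> ('x \<Rightarrow> 'x) \<Rightarrow> 'x set set \<Rightarrow> nat \<Rightarrow> 'x set set" where
  "iterated_partition M T P n =
     common_refinement ((\<lambda>i. (\<lambda>A. (T ^^ i) -` A \<inter> space M) ` P) ` {..<n})"

definition entropy_wrt :: "'x measure \<Rightarrow> ('x \<Rightarrow> 'x) \<Rightarrow> 'x set set \<Rightarrow> real" where
  "entropy_wrt M T P = lim (\<lambda>n. partition_entropy M (iterated_partition M T P n) / real n)"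

definition measure_entropy :: "'x measure \<Rightarrow> ('x \<Rightarrow> 'x) \<Rightarrow> ereal" where
  "measure_entropy M T =
     Sup {ereal (entropy_wrt M T P) |P. finite P \<and> P \<subseteq> sets M \<and> partition_on (space M) P}"

section \<open>Sequences of functions\<close>

text \<open>A sequence \<open>\<F> = {log f\<^sub>n}\<close>, \<open>n \<ge> 1\<close>, is represented by the functions \<open>f\<^sub>n\<close>; the value
  \<open>f 0\<close> is unconstrained and never used.\<close>

definition positive_continuous_sequence ::
    "'a set \<Rightarrow> ('a \<Rightarrow> 'a \<Rightarrow> nat) \<Rightarrow> (nat \<Rightarrow> (nat \<Rightarrow> 'a) \<Rightarrow> real) \<Rightarrow> bool" where
  "positive_continuous_sequence S t f \<longleftrightarrow>
     (\<forall>n\<ge>1. continuous_map (shift_topology S t) euclideanreal (f n) \<and>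
             (\<forall>x\<in>markov_shift S t. f n x > 0))"

definition almost_additive ::
    "'a set \<Rightarrow> ('a \<Rightarrow> 'a \<Rightarrow> nat) \<Rightarrow> (nat \<Rightarrow> (nat \<Rightarrow> 'a) \<Rightarrow> real) \<Rightarrow> bool" where
  "almost_additive S t f \<longleftrightarrow>
     (\<exists>C\<ge>0. \<forall>n\<ge>1. \<forall>m\<ge>1. \<forall>x\<in>markov_shift S t.
        f n x * f m ((shift_map ^^ n) x) * exp (- C) \<le> f (n + m) x \<and>
        f (n + m) x \<le> f n x * f m ((shift_map ^^ n) x) * exp C)"

definition variation ::
    "'a set \<Rightarrow> ('a \<Rightarrow> 'a \<Rightarrow> nat) \<Rightarrow> (nat \<Rightarrow> (nat \<Rightarrow> 'a) \<Rightarrow> real) \<Rightarrow> nat \<Rightarrow> ereal" where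
  "variation S t f n =
     Sup {ereal (f n x / f n y) |x y.
            x \<in> markov_shift S t \<and> y \<in> markov_shift S t \<and> (\<forall>i<n. x i = y i)}"

definition bowen_sequence ::
    "'a set \<Rightarrow> ('a \<Rightarrow> 'a \<Rightarrow> nat) \<Rightarrow> (nat \<Rightarrow> (nat \<Rightarrow> 'a) \<Rightarrow> real) \<Rightarrow> bool" where
  "bowen_sequence S t f \<longleftrightarrow> (\<exists>M>0. (SUP n\<in>{1..}. variation S t f n) \<le> ereal M)"

section \<open>Gurevich pressure\<close>

definition ln_ennreal :: "ennreal \<Rightarrow> ereal" where
  "ln_ennreal z = (if z = \<infinity> then \<infinity> else if z = 0 then - \<infinity> else ereal (ln (enn2real z)))"

text \<open>There may be infinitely many points of period \<open>n\<close> in a cylinder, so the partition function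
  takes values in \<open>[0, \<infinity>]\<close>.\<close>

definition partition_function ::
    "'a set \<Rightarrow> ('a \<Rightarrow> 'a \<Rightarrow> nat) \<Rightarrow> (nat \<Rightarrow> (nat \<Rightarrow> 'a) \<Rightarrow> real) \<Rightarrow> 'a \<Rightarrow> nat \<Rightarrow> ennreal" where
  "partition_function S t f a n =
     (\<Sum>\<^sub>\<infinity>x\<in>{x \<in> markov_shift S t. (shift_map ^^ n) x = x}.
        ennreal (f n x) * indicator (cylinder S t [a]) x)"

text \<open>The pressure is the common value, over all letters \<open>a\<close>, of the limits.\<close>

definition gurevich_pressure ::
    "'a set \<Rightarrow> ('a \<Rightarrow> 'a \<Rightarrow> nat) \<Rightarrow> (nat \<Rightarrow> (nat \<Rightarrow> 'a) \<Rightarrow> real) \<Rightarrow> ereal" where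
  "gurevich_pressure S t f =
     (THE P. \<forall>a\<in>S. (\<lambda>n. ln_ennreal (partition_function S t f a n) / ereal (real n)) \<longlonglongrightarrow> P)"

section \<open>Extended integrals\<close>

text \<open>The integral of a function with values in \<open>[-\<infinity>, \<infinity>]\<close> as the integral of the positive part
  minus that of the negative part (\<open>e2ennreal\<close> truncates negative values to \<open>0\<close>). It is meaningful
  when one of the two is finite; the Bochner integral would be \<open>0\<close> rather than \<open>-\<infinity>\<close> for
  non-integrable functions that are bounded above.\<close>

definition extended_integral :: "'x measure \<Rightarrow> ('x \<Rightarrow> ereal) \<Rightarrow> ereal" where
  "extended_integral M g =
     enn2ereal (\<integral>\<^sup>+x. e2ennreal (g x) \<partial>M) - enn2ereal (\<integral>\<^sup>+x. e2ennreal (- g x) \<partial>M)"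

definition limit_of_integrals ::
    "(nat \<Rightarrow> (nat \<Rightarrow> 'a) \<Rightarrow> real) \<Rightarrow> (nat \<Rightarrow> 'a) measure \<Rightarrow> ereal" where
  "limit_of_integrals f \<mu> =
     lim (\<lambda>n. extended_integral \<mu> (\<lambda>x. ereal (ln (f n x))) / ereal (real n))"

text \<open>The pointwise limit only exists almost everywhere; on the null set where it does not, \<open>lim\<close>
  is some constant that does not affect the integral.\<close>

definition integral_of_limit ::
    "(nat \<Rightarrow> (nat \<Rightarrow> 'a) \<Rightarrow> real) \<Rightarrow> (nat \<Rightarrow> 'a) measure \<Rightarrow> ereal" where
  "integral_of_limit f \<mu> =
     extended_integral \<mu> (\<lambda>x. lim (\<lambda>n. ereal (ln (f n x) / real n)))"

end

theory Submission
  imports Defs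
begin

text \<open>Upper bound: let \<open>\<mu>\<close> be invariant with finite energy and \<open>P\<close> a finite partition, approximated by
  a partition into sets that depend on finitely many coordinates. Up to a small set, the orbit segments
  of length \<open>n\<close> start and end in a finite set of letters, and by mixing they extend to points of period
  \<open>n + 2k\<close> in the cylinder of \<open>a\<close> at the cost of a bounded factor. Comparing the distribution of the
  \<open>P\<close>-names with the weights \<open>f (n + 2k) y\<close> of these periodic points, Gibbs' inequality bounds
  entropy plus energy by the lower growth rate of the partition functions.

  Lower bound: for finitely many points of period \<open>n\<close> in the cylinder of \<open>a\<close>, concatenate the
  corresponding words independently, with probabilities proportional to \<open>f n\<close>. Averaged over the phase
  this is an invariant measure whose entropy plus energy is at least \<open>1/n\<close> times the logarithm of the
  sum of the weights, up to \<open>O(1/n)\<close>. Hence the upper growth rate is at most the supremum. Together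
  the two bounds also show that the limit defining the pressure exists and does not depend on \<open>a\<close>.

  The two energies agree by an almost additive version of Kingman's theorem, and both are \<open>-\<infinity>\<close> when
  \<open>ln (f 1)\<close> is not integrable.\<close>

section \<open>Subadditive sequences\<close>

text \<open>The alphabet may be infinite, so the space need not be compact, the partition by first
  letters may have infinite entropy, \<open>per a n\<close> may be infinite and
  \<open>ln (f 1)\<close> is bounded above only. This decides three things. Entropy is handled
  through finite partitions; these know nothing of the cylinders on which \<open>f n\<close> is
  nearly constant, so entropy and energy are tied together by weights on names and not by a common
  partition. In the upper bound, finite sets of letters are imposed only at the two ends of an orbit
  segment, where mixing has to give one connecting length for all pairs; the middle may visit any
  letter. The measures of the lower bound come from finite families of periodic words by an explicit
  product and not as weak limits. As to errors, \<open>C\<close> is paid at every cut of a word and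
  \<open>V\<close> at every comparison of two points that agree on a word; both are constants per
  block and vanish after division by the block length. The two energies are compared for every
  invariant measure, ergodic or not; the pointwise limit may be \<open>-\<infinity>\<close> on a set
  of positive measure.\<close>

lemma fekete:
  fixes u :: "nat \<Rightarrow> real"
  assumes sub: "\<And>n m. 1 \<le> n \<Longrightarrow> 1 \<le> m \<Longrightarrow> u (n + m) \<le> u n + u m"
    and low: "\<And>n. 1 \<le> n \<Longrightarrow> K * real n \<le> u n"
  shows "convergent (\<lambda>n. u n / real n)"
proof -
  define l where "l = (INF n\<in>{1..}. u n / real n)"
  have bdd: "bdd_below ((\<lambda>n. u n / real n) ` {1..})"
    using low by (intro bdd_belowI2[of _ K]) (simp add: field_simps)
  have ge: "l \<le> u n / real n" if "1 \<le> n" for n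
    unfolding l_def using that by (intro cINF_lower bdd) auto
  have mult: "u (q * m + r) \<le> real q * u m + u r" if "1 \<le> m" "1 \<le> r" for q m r
  proof (induction q)
    case (Suc q)
    have "u (Suc q * m + r) = u (m + (q * m + r))" by (simp add: algebra_simps)
    also have "\<dots> \<le> u m + u (q * m + r)" using that by (intro sub) auto
    finally show ?case using Suc by (simp add: algebra_simps)
  qed simp
  have "(\<lambda>n. u n / real n) \<longlonglongrightarrow> l"
  proof (rule LIMSEQ_I)
    fix e :: real assume e: "0 < e"
    have "\<exists>m\<in>{1..}. u m / real m < l + e / 2"
      using e bdd unfolding l_def by (subst cINF_less_iff[symmetric]) auto
    then obtain m where m: "1 \<le> m" "u m / real m < l + e / 2" by auto
    define c where "c = Max ((\<lambda>r. \<bar>u r\<bar> + real r * \<bar>u m / real m\<bar>) ` {1..m})"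
    have c: "\<bar>u r\<bar> + real r * \<bar>u m / real m\<bar> \<le> c" if "r \<in> {1..m}" for r
      unfolding c_def using that by (intro Max_ge) auto
    have c0: "0 \<le> c" using c[of 1] m by (smt (verit) abs_ge_zero atLeastAtMost_iff mult_nonneg_nonneg of_nat_0_le_iff order_refl)
    obtain N0 :: nat where N0: "2 * c / e < real N0" using reals_Archimedean2 by blast
    define N where "N = max 1 N0"
    have N: "1 \<le> N" "2 * c / e < real N" using N0 unfolding N_def by auto
    have "norm (u n / real n - l) < e" if "N \<le> n" for n
    proof -
      have n: "1 \<le> n" using that N by simp
      \<comment> \<open>Division with remainder in \<open>{1..m}\<close>: subadditivity is assumed
        for positive indices only and says nothing about \<open>u 0\<close>.\<close>
      define q where "q = (n - 1) div m"
      define r where "r = (n - 1) mod m + 1"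
      have nqr: "n = q * m + r" using n unfolding q_def r_def by simp
      have r: "r \<in> {1..m}" unfolding r_def using m by (simp add: Suc_le_eq)
      have "u n \<le> real q * u m + u r" unfolding nqr using m r by (intro mult) auto
      also have "real q * u m = real n * (u m / real m) - real r * (u m / real m)"
        using m by (simp add: nqr field_simps)
      also have "\<dots> + u r \<le> real n * (u m / real m) + c"
      proof -
        have "- (real r * (u m / real m)) \<le> real r * \<bar>u m / real m\<bar>"
          by (metis abs_ge_minus_self abs_mult abs_of_nat)
        then have "- (real r * (u m / real m)) + u r \<le> c"
          using c[OF r] abs_ge_self[of "u r"] by (smt (verit))
        then show ?thesis by argo
      qed
      finally have "u n / real n \<le> u m / real m + c / real n" using n by (simp add: field_simps)
      also have "c / real n \<le> e / 2"
      proof -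
        have "2 * c / e < real n" using N that by (meson of_nat_le_iff order_less_le_trans)
        then show ?thesis using e n by (simp add: field_simps)
      qed
      finally show ?thesis using m ge[OF n] by (auto simp: abs_if)
    qed
    then show "\<exists>N. \<forall>n\<ge>N. norm (u n / real n - l) < e" by blast
  qed
  then show ?thesis by (auto simp: convergent_def)
qed

section \<open>Entropy of measure preserving transformations\<close>

locale measure_preserving = prob_space +
  fixes T :: "'a \<Rightarrow> 'a"
  assumes T_measurable[measurable]: "T \<in> measurable M M"
    and T_preserves: "\<And>A. A \<in> sets M \<Longrightarrow> emeasure M (T -` A \<inter> space M) = emeasure M A"
begin

lemma pow_measurable[measurable]: "T ^^ n \<in> measurable M M"
  by (induction n) (auto intro: measurable_comp[OF _ T_measurable] simp: id_def)

lemma pow_space: "x \<in> space M \<Longrightarrow> (T ^^ n) x \<in> space M"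
  using measurable_space[OF pow_measurable] .

lemma distr_pow: "distr M M (T ^^ n) = M"
proof (induction n)
  case (Suc n)
  have "distr M M T = M"
    by (rule measure_eqI) (auto simp: emeasure_distr T_preserves)
  moreover have "distr M M (T ^^ Suc n) = distr (distr M M (T ^^ n)) M T"
    by (subst distr_distr) auto
  ultimately show ?case using Suc by metis
qed (simp add: id_def distr_id)

lemma measure_pow_vimage:
  "A \<in> sets M \<Longrightarrow> measure M ((T ^^ n) -` A \<inter> space M) = measure M A"
  using measure_distr[of "T ^^ n" M M A] by (simp add: distr_pow)

lemma integral_pow:
  fixes u :: "'a \<Rightarrow> real"
  assumes "u \<in> borel_measurable M"
  shows "(\<integral>x. u ((T ^^ n) x) \<partial>M) = (\<integral>x. u x \<partial>M)"
  using integral_distr[of "T ^^ n" M M u] assms by (simp add: distr_pow)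

lemma integrable_pow:
  fixes u :: "'a \<Rightarrow> real"
  assumes "integrable M u"
  shows "integrable M (\<lambda>x. u ((T ^^ n) x))"
  using integrable_distr[of "T ^^ n" M M u] assms by (simp add: distr_pow)

end

text \<open>The cells of the iterated partition, indexed by itineraries. The index set
  \<open>names P n\<close> is a full product, over which sums of products factor; the price is that
  some names have an empty atom.\<close>

definition atom :: "'x measure \<Rightarrow> ('x \<Rightarrow> 'x) \<Rightarrow> nat \<Rightarrow> (nat \<Rightarrow> 'x set) \<Rightarrow> 'x set" where
  "atom M T n \<theta> = {x \<in> space M. \<forall>j<n. (T ^^ j) x \<in> \<theta> j}"

abbreviation names :: "'x set set \<Rightarrow> nat \<Rightarrow> (nat \<Rightarrow> 'x set) set" where
  "names P n \<equiv> {..<n} \<rightarrow>\<^sub>E P"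

lemma partition_onD_eq:
  "partition_on A P \<Longrightarrow> X \<in> P \<Longrightarrow> Y \<in> P \<Longrightarrow> x \<in> X \<Longrightarrow> x \<in> Y \<Longrightarrow> X = Y"
  unfolding partition_on_def disjoint_def by blast

lemma atom_inj:
  assumes P: "partition_on (space M) P" and "\<theta> \<in> names P n" "\<theta>' \<in> names P n"
    and "x \<in> atom M T n \<theta>" "x \<in> atom M T n \<theta>'"
  shows "\<theta> = \<theta>'"
proof (rule PiE_ext[OF assms(2,3)])
  fix j assume "j \<in> {..<n}"
  then show "\<theta> j = \<theta>' j"
    using assms(2-) by (intro partition_onD_eq[OF P, of _ _ "(T ^^ j) x"]) (auto simp: atom_def PiE_iff)
qed

text \<open>The delicate point is that \<open>common_refinement\<close> takes a set of partitions:
  pullbacks at different times may coincide as sets of sets, and a choice function then picks one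
  member for all those times. A point of a nonempty atom shows that the name has to make the same
  choice at these times.\<close>

lemma iterated_partition_eq:
  assumes P: "partition_on (space M) P" and n: "1 \<le> n"
  shows "iterated_partition M T P n = atom M T n ` names P n - {{}}"
proof -
  define Q where "Q i = (\<lambda>A. (T ^^ i) -` A \<inter> space M) ` P" for i
  have Q_mem: "(T ^^ i) -` A \<inter> space M \<in> Q i" if "A \<in> P" for A i using that by (auto simp: Q_def)
  have it: "iterated_partition M T P n = (\<Union>f \<in> (\<Pi> q\<in>Q ` {..<n}. q). {\<Inter> (f ` Q ` {..<n})}) - {{}}"
    unfolding iterated_partition_def common_refinement Q_def ..
  show ?thesis
  proof (intro equalityI subsetI)
    fix X assume "X \<in> iterated_partition M T P n"
    then obtain f where f: "\<And>i. i < n \<Longrightarrow> f (Q i) \<in> Q i" "X = (\<Inter>i<n. f (Q i))" "X \<noteq> {}"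
      unfolding it by (auto simp: image_image Pi_iff)
    have "\<exists>A\<in>P. f (Q i) = (T ^^ i) -` A \<inter> space M" if "i < n" for i
      using f(1)[OF that] by (auto simp: Q_def)
    then obtain A where A: "\<And>i. i < n \<Longrightarrow> A i \<in> P \<and> f (Q i) = (T ^^ i) -` A i \<inter> space M" by metis
    have "X = atom M T n (restrict A {..<n})"
      unfolding f(2) atom_def using n A by (auto simp: Suc_le_eq)
    moreover have "restrict A {..<n} \<in> names P n" using A by auto
    ultimately show "X \<in> atom M T n ` names P n - {{}}" using f(3) by auto
  next
    fix X assume "X \<in> atom M T n ` names P n - {{}}"
    then obtain \<theta> x where \<theta>: "\<theta> \<in> names P n" "X = atom M T n \<theta>" "x \<in> X" by blast
    \<comment> \<open>\<open>k q\<close> is one of the times whose pulled-back partition is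
      \<open>q\<close>; the member chosen from \<open>q\<close> is read off the name at that
      time.\<close>
    define k where "k q = (SOME j. j < n \<and> Q j = q)" for q
    define f where "f q = (T ^^ k q) -` \<theta> (k q) \<inter> space M" for q
    have k: "k (Q i) < n" "Q (k (Q i)) = Q i" if "i < n" for i
      using someI[of "\<lambda>j. j < n \<and> Q j = Q i" i] that unfolding k_def by auto
    have xx: "x \<in> space M" "\<And>j. j < n \<Longrightarrow> (T ^^ j) x \<in> \<theta> j" using \<theta> by (auto simp: atom_def)
    have th: "\<And>j. j < n \<Longrightarrow> \<theta> j \<in> P" using \<theta> by auto
    have fQ: "f (Q i) = (T ^^ i) -` \<theta> i \<inter> space M" if i: "i < n" for i
    proof -
      have "f (Q i) \<in> Q (k (Q i))" unfolding f_def using k[OF i] th by (intro Q_mem) auto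
      then have "f (Q i) \<in> Q i" using k[OF i] by simp
      then obtain A where A: "A \<in> P" "f (Q i) = (T ^^ i) -` A \<inter> space M" by (auto simp: Q_def)
      have "x \<in> f (Q i)" unfolding f_def using k[OF i] xx by auto
      then have "A = \<theta> i"
        using A xx th i by (intro partition_onD_eq[OF P, of _ _ "(T ^^ i) x"]) auto
      then show ?thesis using A by simp
    qed
    have "f \<in> (\<Pi> q\<in>Q ` {..<n}. q)" using fQ th by (auto simp: Pi_iff) (auto simp: Q_def)
    moreover have "X = \<Inter> (f ` Q ` {..<n})"
      unfolding \<theta>(2) atom_def image_image using fQ n by (auto simp: Suc_le_eq)
    ultimately show "X \<in> iterated_partition M T P n" unfolding it using \<theta>(3) by blast
  qed
qed

text \<open>Names with an empty atom contribute 0, and on the other names \<open>atom\<close> is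
  injective, so the sum over cells may run over all names.\<close>

lemma partition_entropy_iterated:
  assumes P: "partition_on (space M) P" "finite P" and n: "1 \<le> n"
  shows "partition_entropy M (iterated_partition M T P n) =
    - (\<Sum>\<theta>\<in>names P n. measure M (atom M T n \<theta>) * ln (measure M (atom M T n \<theta>)))"
proof -
  let ?g = "\<lambda>A. measure M A * ln (measure M A)"
  let ?N = "{\<theta> \<in> names P n. atom M T n \<theta> \<noteq> {}}"
  have eq: "iterated_partition M T P n = atom M T n ` ?N"
    unfolding iterated_partition_eq[OF P(1) n] by auto
  have inj: "inj_on (atom M T n) ?N"
  proof (rule inj_onI)
    fix \<theta> \<theta>' assume a: "\<theta> \<in> ?N" "\<theta>' \<in> ?N" "atom M T n \<theta> = atom M T n \<theta>'"
    then obtain x where "x \<in> atom M T n \<theta>" by auto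
    with a show "\<theta> = \<theta>'" using atom_inj[OF P(1), of \<theta> n \<theta>' x T] by auto
  qed
  have "(\<Sum>A\<in>iterated_partition M T P n. ?g A) = (\<Sum>\<theta>\<in>?N. ?g (atom M T n \<theta>))"
    unfolding eq by (subst sum.reindex[OF inj]) simp
  also have "\<dots> = (\<Sum>\<theta>\<in>names P n. ?g (atom M T n \<theta>))"
    by (rule sum.mono_neutral_left) (auto intro: finite_PiE P)
  finally show ?thesis unfolding partition_entropy_def by simp
qed

text \<open>The lower bound \<open>\<psi>\<close> of the log-weights need not be constant on the atoms. This is what allows
  the entropy of a finite partition to be compared with a potential on infinitely many cylinders
  without any countable partition of possibly infinite entropy.\<close>

lemma (in prob_space) gibbs_le:
  fixes \<psi> :: "'a \<Rightarrow> real" and p :: "'i \<Rightarrow> real"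
  assumes I: "finite I" and A: "\<And>i. i \<in> I \<Longrightarrow> A i \<in> events"
    and disj: "disjoint_family_on A I" and cov: "(\<Union>i\<in>I. A i) = space M"
    and int: "integrable M \<psi>"
    and p: "(\<Sum>i\<in>I. p i) \<le> 1" "\<And>i. i \<in> I \<Longrightarrow> 0 \<le> p i"
    and le: "\<And>i x. i \<in> I \<Longrightarrow> 0 < prob (A i) \<Longrightarrow> x \<in> A i \<Longrightarrow> exp (\<psi> x) \<le> p i"
  shows "- (\<Sum>i\<in>I. prob (A i) * ln (prob (A i))) \<le> - (\<integral>x. \<psi> x \<partial>M)"
proof -
  have psi: "(\<integral>x. \<psi> x \<partial>M) = (\<Sum>i\<in>I. \<integral>x. \<psi> x * indicator (A i) x \<partial>M)"
  proof -
    have "(\<integral>x. \<psi> x \<partial>M) = (\<integral>x. (\<Sum>i\<in>I. \<psi> x * indicator (A i) x) \<partial>M)"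
    proof (rule Bochner_Integration.integral_cong[OF refl])
      fix x assume "x \<in> space M"
      then obtain i where i: "i \<in> I" "x \<in> A i" using cov by auto
      have "(\<Sum>j\<in>I. \<psi> x * indicator (A j) x) = (\<Sum>j\<in>{i}. \<psi> x * indicator (A j) x)"
        using i disj I by (intro sum.mono_neutral_right) (auto simp: disjoint_family_on_def indicator_def)
      then show "\<psi> x = (\<Sum>j\<in>I. \<psi> x * indicator (A j) x)" using i by simp
    qed
    also have "\<dots> = (\<Sum>i\<in>I. \<integral>x. \<psi> x * indicator (A i) x \<partial>M)"
      using A int by (intro Bochner_Integration.integral_sum integrable_real_mult_indicator) auto
    finally show ?thesis .
  qed
  \<comment> \<open>Gibbs' inequality termwise, from \<open>ln x \<le> x - 1\<close>. The surpluses
    \<open>p i - prob (A i)\<close> add up to at most 0.\<close>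
  have "(\<integral>x. \<psi> x * indicator (A i) x \<partial>M) \<le> prob (A i) * ln (prob (A i)) + (p i - prob (A i))"
    if i: "i \<in> I" for i
  proof (cases "prob (A i) = 0")
    case True
    have "A i \<in> null_sets M" using A[OF i] True by (simp add: null_setsI emeasure_eq_measure)
    then have "AE x in M. x \<notin> A i" by (rule AE_not_in)
    then have "(\<integral>x. \<psi> x * indicator (A i) x \<partial>M) = 0"
      by (intro integral_eq_zero_AE) (auto elim!: eventually_mono)
    then show ?thesis using True p(2)[OF i] by simp
  next
    case False
    then have pos: "0 < prob (A i)" by (simp add: zero_less_measure_iff)
    obtain x0 where x0: "x0 \<in> A i" using pos by (metis all_not_in_conv less_irrefl measure_empty)
    have pi: "0 < p i" using le[OF i pos x0] exp_gt_zero[of "\<psi> x0"] by linarith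
    have "(\<integral>x. \<psi> x * indicator (A i) x \<partial>M) \<le> (\<integral>x. ln (p i) * indicator (A i) x \<partial>M)"
    proof (rule integral_mono)
      show "integrable M (\<lambda>x. \<psi> x * indicator (A i) x)"
        using A[OF i] int by (intro integrable_real_mult_indicator) auto
      show "integrable M (\<lambda>x. ln (p i) * indicator (A i) x)"
        using A[OF i] by (intro integrable_real_mult_indicator) auto
      show "\<psi> x * indicator (A i) x \<le> ln (p i) * indicator (A i) x" for x
        using le[OF i pos, of x] pi by (auto simp: indicator_def ln_ge_iff)
    qed
    also have "\<dots> = prob (A i) * ln (p i)" using A[OF i] by simp
    also have "\<dots> = prob (A i) * ln (prob (A i)) + prob (A i) * ln (p i / prob (A i))"
      using pos pi by (simp add: ln_div algebra_simps)
    also have "prob (A i) * ln (p i / prob (A i)) \<le> prob (A i) * (p i / prob (A i) - 1)"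
      using pos pi by (intro mult_left_mono ln_le_minus_one) auto
    also have "\<dots> = p i - prob (A i)" using pos by (simp add: field_simps)
    finally show ?thesis by simp
  qed
  then have "(\<integral>x. \<psi> x \<partial>M) \<le> (\<Sum>i\<in>I. prob (A i) * ln (prob (A i)) + (p i - prob (A i)))"
    unfolding psi by (rule sum_mono)
  also have "\<dots> = (\<Sum>i\<in>I. prob (A i) * ln (prob (A i))) + ((\<Sum>i\<in>I. p i) - (\<Sum>i\<in>I. prob (A i)))"
    by (simp add: sum.distrib sum_subtractf)
  also have "(\<Sum>i\<in>I. prob (A i)) = prob (\<Union>i\<in>I. A i)"
    using I A disj by (intro finite_measure_finite_Union[symmetric]) auto
  also have "\<dots> = 1" using cov prob_space by simp
  finally show ?thesis using p by simp
qed

lemma sum_times_prod: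
  fixes f :: "'b \<Rightarrow> real" and g :: "'c \<Rightarrow> real"
  shows "(\<Sum>z\<in>A \<times> B. f (fst z) * g (snd z)) = sum f A * sum g B"
proof -
  have "sum f A * sum g B = (\<Sum>(x, y)\<in>A \<times> B. f x * g y)"
    unfolding sum_product by (rule sum.cartesian_product)
  also have "\<dots> = (\<Sum>z\<in>A \<times> B. f (fst z) * g (snd z))"
    by (rule sum.cong[OF refl]) (auto)
  finally show ?thesis ..
qed

context measure_preserving
begin

context
  fixes P assumes P: "finite P" "P \<subseteq> events" "partition_on (space M) P"
begin

abbreviation "H n \<equiv> partition_entropy M (iterated_partition M T P n)"

lemma atom_events:
  assumes th: "\<theta> \<in> names P n"
  shows "atom M T n \<theta> \<in> events"
proof -
  have "atom M T n \<theta> = space M \<inter> (\<Inter>j\<in>{..<n}. (T ^^ j) -` \<theta> j \<inter> space M)"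
    by (auto simp: atom_def)
  moreover have "(T ^^ j) -` \<theta> j \<inter> space M \<in> events" if "j < n" for j
    using that th P by (intro measurable_sets[OF pow_measurable]) auto
  moreover from this have "(\<Inter>j\<in>{..<n}. (T ^^ j) -` \<theta> j \<inter> space M) \<in> events" if "n \<noteq> 0"
    using that by (intro sets.finite_INT) auto
  ultimately show ?thesis by (cases "n = 0") (simp_all only: not_False_eq_True lessThan_0 INT_empty Int_UNIV_right sets.top sets.Int)
qed

lemma atom_disjoint: "disjoint_family_on (atom M T n) (names P n)"
  unfolding disjoint_family_on_def using atom_inj[OF P(3)] by blast

lemma name_exists: "x \<in> space M \<Longrightarrow> \<exists>\<theta>\<in>names P n. x \<in> atom M T n \<theta>"
proof -
  assume x: "x \<in> space M"
  have "\<exists>A\<in>P. (T ^^ j) x \<in> A" for j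
    using pow_space[OF x, of j] P(3) unfolding partition_on_def by blast
  then obtain A where A: "\<And>j. A j \<in> P \<and> (T ^^ j) x \<in> A j" by metis
  have "restrict A {..<n} \<in> names P n" "x \<in> atom M T n (restrict A {..<n})"
    using A x by (auto simp: atom_def)
  then show ?thesis by blast
qed

lemma atom_cover: "(\<Union>\<theta>\<in>names P n. atom M T n \<theta>) = space M"
  using name_exists by (auto simp: atom_def)

lemma H_eq: "1 \<le> n \<Longrightarrow>
  H n = - (\<Sum>\<theta>\<in>names P n. prob (atom M T n \<theta>) * ln (prob (atom M T n \<theta>)))"
  by (rule partition_entropy_iterated[OF P(3) P(1)])

lemma entropy_le:
  fixes \<psi> :: "'a \<Rightarrow> real"
  assumes "1 \<le> n" "integrable M \<psi>"
    and "(\<Sum>\<theta>\<in>names P n. p \<theta>) \<le> 1" "\<And>\<theta>. \<theta> \<in> names P n \<Longrightarrow> 0 \<le> p \<theta>"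
    and "\<And>\<theta> x. \<theta> \<in> names P n \<Longrightarrow> 0 < prob (atom M T n \<theta>) \<Longrightarrow> x \<in> atom M T n \<theta> \<Longrightarrow> exp (\<psi> x) \<le> p \<theta>"
  shows "H n \<le> - (\<integral>x. \<psi> x \<partial>M)"
  unfolding H_eq[OF assms(1)]
  by (rule gibbs_le[where p = p]) (use assms atom_events atom_disjoint atom_cover P in \<open>auto intro!: finite_PiE\<close>)

lemma sum_prob_atom: "(\<Sum>\<theta>\<in>names P n. prob (atom M T n \<theta>)) = 1"
proof -
  have "(\<Sum>\<theta>\<in>names P n. prob (atom M T n \<theta>)) = prob (\<Union>\<theta>\<in>names P n. atom M T n \<theta>)"
    using atom_events atom_disjoint P by (intro finite_measure_finite_Union[symmetric]) (auto intro: finite_PiE)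
  then show ?thesis by (simp add: atom_cover prob_space)
qed

lemma H_nonneg: "1 \<le> n \<Longrightarrow> 0 \<le> H n"
proof -
  assume n: "1 \<le> n"
  have "prob A * ln (prob A) \<le> 0" for A
    by (cases "prob A = 0") (auto intro!: mult_nonneg_nonpos simp: zero_less_measure_iff)
  then show ?thesis unfolding H_eq[OF n] neg_0_le_iff_le by (intro sum_nonpos)
qed

text \<open>The information function of the iterated partition, with integral \<open>H n\<close>. It
  serves as the integrand in Gibbs' inequality.\<close>

definition info :: "nat \<Rightarrow> 'a \<Rightarrow> real" where
  "info n x = (\<Sum>\<theta>\<in>names P n. - ln (prob (atom M T n \<theta>)) * indicator (atom M T n \<theta>) x)"

lemma info_eq:
  assumes th: "\<theta> \<in> names P n" "x \<in> atom M T n \<theta>"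
  shows "info n x = - ln (prob (atom M T n \<theta>))"
proof -
  have "info n x = (\<Sum>\<theta>\<in>{\<theta>}. - ln (prob (atom M T n \<theta>)) * indicator (atom M T n \<theta>) x)"
    unfolding info_def using th P atom_inj[OF P(3)]
    by (intro sum.mono_neutral_right) (auto intro: finite_PiE simp: indicator_def)
  then show ?thesis using th by simp
qed

lemma info_integrable: "integrable M (info n)"
  unfolding info_def using atom_events
  by (intro Bochner_Integration.integrable_sum integrable_real_mult_indicator) auto

lemma info_integral: "1 \<le> n \<Longrightarrow> (\<integral>x. info n x \<partial>M) = H n"
proof -
  assume "1 \<le> n"
  have "(\<integral>x. info n x \<partial>M) = (\<Sum>\<theta>\<in>names P n. \<integral>x. - ln (prob (atom M T n \<theta>)) * indicator (atom M T n \<theta>) x \<partial>M)"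
    unfolding info_def using atom_events
    by (intro Bochner_Integration.integral_sum integrable_real_mult_indicator) auto
  also have "\<dots> = (\<Sum>\<theta>\<in>names P n. - ln (prob (atom M T n \<theta>)) * prob (atom M T n \<theta>))"
    using atom_events by (intro sum.cong) auto
  finally show ?thesis unfolding H_eq[OF \<open>1 \<le> n\<close>] by (simp add: sum_negf mult.commute)
qed

text \<open>Compare the law of names of length \<open>n + m\<close> with the product of the laws of
  its two halves: Gibbs' inequality with \<open>\<psi>\<close> minus the sum of the two information
  functions gives the claim, since by invariance the second one may be integrated without the shift
  by \<open>n\<close>.\<close>

lemma H_subadditive:
  assumes nm: "1 \<le> n" "1 \<le> m"
  shows "H (n + m) \<le> H n + H m"
proof -
  define a where "a \<theta> = restrict \<theta> {..<n}" for \<theta> :: "nat \<Rightarrow> 'a set"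
  define b where "b \<theta> = restrict (\<lambda>j. \<theta> (n + j)) {..<m}" for \<theta> :: "nat \<Rightarrow> 'a set"
  define p where "p \<theta> = prob (atom M T n (a \<theta>)) * prob (atom M T m (b \<theta>))" for \<theta>
  define \<psi> where "\<psi> x = - info n x - info m ((T ^^ n) x)" for x
  have ab: "a \<theta> \<in> names P n" "b \<theta> \<in> names P m" if "\<theta> \<in> names P (n + m)" for \<theta>
    using that unfolding a_def b_def by (auto simp: PiE_iff)
  have xa: "x \<in> atom M T n (a \<theta>)" "(T ^^ n) x \<in> atom M T m (b \<theta>)"
    if "\<theta> \<in> names P (n + m)" "x \<in> atom M T (n + m) \<theta>" for \<theta> x
  proof -
    show "x \<in> atom M T n (a \<theta>)" using that by (auto simp: atom_def a_def)
    have "(T ^^ j) ((T ^^ n) x) = (T ^^ (n + j)) x" for j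
      by (simp only: add.commute[of n j] funpow_add comp_apply)
    then show "(T ^^ n) x \<in> atom M T m (b \<theta>)" using that by (auto simp: atom_def b_def intro: pow_space)
  qed
  have inj: "inj_on (\<lambda>\<theta>. (a \<theta>, b \<theta>)) (names P (n + m))"
  proof (rule inj_onI)
    fix \<theta> \<theta>' assume th: "\<theta> \<in> names P (n + m)" "\<theta>' \<in> names P (n + m)" "(a \<theta>, b \<theta>) = (a \<theta>', b \<theta>')"
    show "\<theta> = \<theta>'"
    proof (rule PiE_ext[OF th(1,2)])
      fix j assume j: "j \<in> {..<n + m}"
      show "\<theta> j = \<theta>' j"
      proof (cases "j < n")
        case True
        moreover have "a \<theta> j = a \<theta>' j" using th(3) by simp
        ultimately show ?thesis by (simp add: a_def)
      next
        case False
        moreover have "j - n < m" using False j by auto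
        moreover have "b \<theta> (j - n) = b \<theta>' (j - n)" using th(3) by simp
        ultimately show ?thesis by (simp add: b_def)
      qed
    qed
  qed
  define F where "F \<theta> = prob (atom M T n \<theta>)" for \<theta>
  define G where "G \<theta> = prob (atom M T m \<theta>)" for \<theta>
  have FG: "p \<theta> = F (a \<theta>) * G (b \<theta>)" for \<theta> by (simp add: p_def F_def G_def)
  have "(\<Sum>\<theta>\<in>names P (n + m). p \<theta>) = (\<Sum>z\<in>(\<lambda>\<theta>. (a \<theta>, b \<theta>)) ` names P (n + m). F (fst z) * G (snd z))"
    by (simp add: sum.reindex[OF inj] FG)
  moreover have "\<dots> \<le> (\<Sum>z\<in>names P n \<times> names P m. F (fst z) * G (snd z))"
  proof (rule sum_mono2)
    show "finite (names P n \<times> names P m)" by (intro finite_cartesian_product finite_PiE P finite_lessThan)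
    show "(\<lambda>\<theta>. (a \<theta>, b \<theta>)) ` names P (n + m) \<subseteq> names P n \<times> names P m"
      by (rule image_subsetI) (rule SigmaI[OF ab])
    show "0 \<le> F (fst z) * G (snd z)" for z by (simp add: F_def G_def)
  qed
  moreover have "(\<Sum>z\<in>names P n \<times> names P m. F (fst z) * G (snd z)) = 1"
    unfolding sum_times_prod using sum_prob_atom[of n] sum_prob_atom[of m] by (simp add: F_def G_def)
  ultimately have p1: "(\<Sum>\<theta>\<in>names P (n + m). p \<theta>) \<le> 1" by linarith
  have p2: "exp (\<psi> x) \<le> p \<theta>"
    if th: "\<theta> \<in> names P (n + m)" "0 < prob (atom M T (n + m) \<theta>)" "x \<in> atom M T (n + m) \<theta>" for \<theta> x
  proof -
    have s1: "atom M T (n + m) \<theta> \<subseteq> atom M T n (a \<theta>)"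
      using xa(1)[OF th(1)] by (rule subsetI)
    have s2: "atom M T (n + m) \<theta> \<subseteq> (T ^^ n) -` atom M T m (b \<theta>) \<inter> space M"
    proof (rule subsetI)
      fix y assume y: "y \<in> atom M T (n + m) \<theta>"
      then have "y \<in> space M" by (simp add: atom_def)
      then show "y \<in> (T ^^ n) -` atom M T m (b \<theta>) \<inter> space M" using xa(2)[OF th(1) y] by simp
    qed
    note ev = atom_events[OF ab(1)[OF th(1)]] atom_events[OF ab(2)[OF th(1)]]
    have "prob (atom M T (n + m) \<theta>) \<le> prob (atom M T n (a \<theta>))"
      by (rule finite_measure_mono[OF s1 ev(1)])
    moreover have "prob (atom M T (n + m) \<theta>) \<le> prob (atom M T m (b \<theta>))"
      using finite_measure_mono[OF s2 measurable_sets[OF pow_measurable ev(2)]]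
      by (simp only: measure_pow_vimage[OF ev(2)])
    ultimately have "0 < prob (atom M T n (a \<theta>))" "0 < prob (atom M T m (b \<theta>))"
      using th(2) by linarith+
    then show ?thesis unfolding \<psi>_def p_def
      using info_eq[OF ab(1)[OF th(1)] xa(1)[OF th(1,3)]] info_eq[OF ab(2)[OF th(1)] xa(2)[OF th(1,3)]]
      by (simp add: exp_add)
  qed
  have "integrable M \<psi>"
    unfolding \<psi>_def
    by (intro Bochner_Integration.integrable_diff integrable_minus info_integrable integrable_pow)
  then have le: "H (n + m) \<le> - (\<integral>x. \<psi> x \<partial>M)"
    using nm p1 p2 by (intro entropy_le[where p = p]) (auto simp: p_def)
  have "(\<integral>x. \<psi> x \<partial>M) = - H n - H m"
    unfolding \<psi>_def
    by (simp add: Bochner_Integration.integral_diff[OF integrable_minus[OF info_integrable]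
          integrable_pow[OF info_integrable]] integral_pow[OF borel_measurable_integrable[OF info_integrable]]
        info_integral[OF nm(1)] info_integral[OF nm(2)])
  with le show ?thesis by simp
qed

text \<open>\<open>entropy_wrt\<close> is defined by \<open>lim\<close>, whose value means something
  only once Fekete's lemma has given convergence.\<close>

lemma entropy_wrt_limit: "(\<lambda>n. H n / real n) \<longlonglongrightarrow> entropy_wrt M T P"
proof -
  have "convergent (\<lambda>n. H n / real n)"
    by (rule fekete[where K = 0]) (auto intro: H_subadditive H_nonneg)
  then show ?thesis unfolding entropy_wrt_def by (simp add: convergent_LIMSEQ_iff)
qed

end

end

section \<open>An almost additive ergodic theorem\<close>

lemma ereal_eqI_real:
  assumes "\<And>r::real. ereal r \<le> A \<longleftrightarrow> ereal r \<le> B"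
  shows "A = B"
proof -
  have le: "A \<le> B" if h: "\<And>r::real. ereal r \<le> A \<Longrightarrow> ereal r \<le> B" for A B :: ereal
  proof (rule ccontr)
    assume "\<not> A \<le> B"
    then obtain r :: real where "B < ereal r" "ereal r < A" using ereal_dense2[of B A] by (auto simp: not_le)
    then have "ereal r \<le> B" by (intro h less_imp_le)
    then show False using \<open>B < ereal r\<close> by simp
  qed
  show ?thesis using le[of A B] le[of B A] assms by (simp add: antisym)
qed

text \<open>A form free of division and of extended reals, in which upper limits of different
  processes can be compared by inequalities at single times.\<close>

lemma le_limsup_iff:
  fixes a :: "nat \<Rightarrow> real"
  shows "ereal r \<le> limsup (\<lambda>n. ereal (a n / real n)) \<longleftrightarrow>
    (\<forall>e>0. \<forall>N. \<exists>n\<ge>N. real n * (r - e) \<le> a n)" (is "?l \<longleftrightarrow> ?r")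
proof
  assume l: ?l
  show ?r
  proof (intro allI impI)
    fix e :: real and N assume e: "0 < e"
    show "\<exists>n\<ge>N. real n * (r - e) \<le> a n"
    proof (rule ccontr)
      assume "\<not> ?thesis"
      then have h: "\<And>n. N \<le> n \<Longrightarrow> a n < real n * (r - e)" by force
      have "\<forall>\<^sub>F n in sequentially. ereal (a n / real n) \<le> ereal (r - e)"
        unfolding eventually_sequentially
      proof (intro exI allI impI)
        fix n assume n: "Suc N \<le> n"
        then show "ereal (a n / real n) \<le> ereal (r - e)"
          using h[of n] by (simp add: divide_le_eq mult.commute)
      qed
      then have "limsup (\<lambda>n. ereal (a n / real n)) \<le> ereal (r - e)" by (rule Limsup_bounded)
      with l have "ereal r \<le> ereal (r - e)" by (rule order_trans)
      then show False using e by simp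
    qed
  qed
next
  assume r: ?r
  show ?l
  proof (rule ccontr)
    assume "\<not> ?l"
    then have "limsup (\<lambda>n. ereal (a n / real n)) < ereal r" by simp
    then obtain s where s: "limsup (\<lambda>n. ereal (a n / real n)) < ereal s" "s < r"
      using ereal_dense2 by force
    from Limsup_lessD[OF s(1)] obtain N where N: "\<And>n. N \<le> n \<Longrightarrow> a n / real n < s"
      by (auto simp: eventually_sequentially)
    have "0 < (r - s) / 2" using s by simp
    with r obtain n where n: "max 1 N \<le> n" "real n * (r - (r - s) / 2) \<le> a n" by blast
    then have "a n < real n * s" using N[of n] by (simp add: divide_less_eq mult.commute)
    moreover have "real n * s \<le> real n * (r - (r - s) / 2)"
      using s by (intro mult_left_mono) (auto simp: field_simps)
    ultimately show False using n by linarith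
  qed
qed

context measure_preserving
begin

lemma integral_pow_sum:
  fixes u :: "'a \<Rightarrow> real"
  assumes "integrable M u" "finite J"
  shows "(\<integral>x. (\<Sum>j\<in>J. u ((T ^^ j) x)) \<partial>M) = real (card J) * (\<integral>x. u x \<partial>M)"
    and "integrable M (\<lambda>x. \<Sum>j\<in>J. u ((T ^^ j) x))"
proof -
  show "integrable M (\<lambda>x. \<Sum>j\<in>J. u ((T ^^ j) x))"
    using assms by (intro Bochner_Integration.integrable_sum integrable_pow)
  have "(\<integral>x. (\<Sum>j\<in>J. u ((T ^^ j) x)) \<partial>M) = (\<Sum>j\<in>J. \<integral>x. u ((T ^^ j) x) \<partial>M)"
    using assms by (intro Bochner_Integration.integral_sum integrable_pow)
  then show "(\<integral>x. (\<Sum>j\<in>J. u ((T ^^ j) x)) \<partial>M) = real (card J) * (\<integral>x. u x \<partial>M)"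
    using assms by (simp add: integral_pow borel_measurable_integrable)
qed

text \<open>Following Katznelson and Weiss, cut every orbit into pieces on which the average of \<open>s\<close> nearly attains
  its upper limit. Superadditivity adds up the pieces without loss; only points with long
  pieces and the end of the orbit cost something.\<close>

lemma superadditive_integral_ge:
  fixes s :: "nat \<Rightarrow> 'a \<Rightarrow> real" and \<psi> :: "'a \<Rightarrow> real"
  assumes int: "\<And>n. 1 \<le> n \<Longrightarrow> integrable M (s n)"
    and sup: "\<And>n m x. 1 \<le> n \<Longrightarrow> 1 \<le> m \<Longrightarrow> x \<in> space M \<Longrightarrow> s n x + s m ((T ^^ n) x) \<le> s (n + m) x"
    and psi: "integrable M \<psi>" "\<And>x. x \<in> space M \<Longrightarrow> \<psi> (T x) = \<psi> x"
    and freq: "AE x in M. \<forall>e>0. \<exists>n\<ge>1. real n * (\<psi> x - e) \<le> s n x"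
    and L: "(\<lambda>n. (\<integral>x. s n x \<partial>M) / real n) \<longlonglongrightarrow> L"
  shows "(\<integral>x. \<psi> x \<partial>M) \<le> L"
proof (rule field_le_epsilon)
  fix \<epsilon> :: real assume "0 < \<epsilon>"
  define e where "e = \<epsilon> / 2"
  have e: "0 < e" using \<open>0 < \<epsilon>\<close> by (simp add: e_def)
  \<comment> \<open>The bad points: no piece of length at most \<open>N\<close> starting there has
    an average close to \<open>\<psi>\<close>. By \<open>freq\<close> almost every point leaves
    \<open>B N\<close> eventually, so \<open>w\<close> has small integral over \<open>B N\<close>
    for large \<open>N\<close>.\<close>
  define B where "B N = {x \<in> space M. \<forall>n\<in>{1..N}. s n x < real n * (\<psi> x - e)}" for N
  \<comment> \<open>The cost of giving up one time step:
    \<open>\<psi> x - w x \<le> s 1 x\<close>.\<close>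
  define w where "w x = \<bar>s 1 x\<bar> + \<bar>\<psi> x\<bar>" for x
  have s_meas[measurable]: "s n \<in> borel_measurable M" if "1 \<le> n" for n using int[OF that] by auto
  have psi_meas[measurable]: "\<psi> \<in> borel_measurable M" using psi by auto
  have B_sets: "B N \<in> events" for N
  proof -
    have "B N = space M \<inter> (\<Inter>n\<in>{1..N}. {x \<in> space M. s n x < real n * (\<psi> x - e)})" unfolding B_def by auto
    moreover have "{x \<in> space M. s n x < real n * (\<psi> x - e)} \<in> events" if "n \<in> {1..N}" for n
    proof -
      have [measurable]: "s n \<in> borel_measurable M" using that by (intro s_meas) auto
      show ?thesis by measurable
    qed
    then have "(\<Inter>n\<in>{1..N}. {x \<in> space M. s n x < real n * (\<psi> x - e)}) \<in> events" if "1 \<le> N"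
      using that by (intro sets.finite_INT) auto
    ultimately show ?thesis by (cases "1 \<le> N") (auto simp: B_def)
  qed
  have w: "integrable M w" unfolding w_def using int[of 1] psi by auto
  have w0: "0 \<le> w x" for x by (simp add: w_def)
  have "(\<lambda>N. \<integral>x. w x * indicator (B N) x \<partial>M) \<longlonglongrightarrow> (\<integral>x. 0 \<partial>M)"
  proof (rule integral_dominated_convergence[where w = w])
    show "AE x in M. (\<lambda>N. w x * indicator (B N) x) \<longlonglongrightarrow> 0"
      using freq
    proof eventually_elim
      case (elim x)
      then obtain n where n: "1 \<le> n" "real n * (\<psi> x - e) \<le> s n x" using e by blast
      have "w x * indicator (B N) x = 0" if "n \<le> N" for N
      proof -
        have "x \<notin> B N" using n that unfolding B_def by force
        then show ?thesis by simp
      qed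
      then show ?case by (intro tendsto_eventually) (auto simp: eventually_sequentially)
    qed
    show "AE x in M. norm (w x * indicator (B N) x) \<le> w x" for N
      using w0 by (auto simp: indicator_def)
  qed (use w B_sets in \<open>auto intro!: borel_measurable_times borel_measurable_indicator\<close>)
  then have "(\<lambda>N. \<integral>x. w x * indicator (B N) x \<partial>M) \<longlonglongrightarrow> 0" by simp
  from order_tendstoD(2)[OF this e] obtain N0 where
    N0: "\<And>N. N0 \<le> N \<Longrightarrow> (\<integral>x. w x * indicator (B N) x \<partial>M) < e"
    by (auto simp: eventually_sequentially)
  define N where "N = max 1 N0"
  define d where "d x = w x * indicator (B N) x" for x
  have N: "1 \<le> N" and dN: "(\<integral>x. d x \<partial>M) < e" using N0[of N] unfolding N_def d_def by auto
  have d_int: "integrable M d" unfolding d_def by (intro integrable_real_mult_indicator B_sets w)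
  have d0: "0 \<le> d x" for x using w0[of x] by (simp add: d_def)
  have psi_pow: "\<psi> ((T ^^ j) x) = \<psi> x" if "x \<in> space M" for j x
    by (induction j) (auto simp: psi(2) pow_space that)
  have pow_add: "(T ^^ j) ((T ^^ k) x) = (T ^^ (j + k)) x" for j k x
    by (simp only: funpow_add comp_apply)
  have s1: "(\<Sum>j<n. s 1 ((T ^^ j) x)) \<le> s n x" if "1 \<le> n" "x \<in> space M" for n x
    using that(1)
  proof (induction n rule: dec_induct)
    case (step n)
    have "s n x + s 1 ((T ^^ n) x) \<le> s (n + 1) x" using step that by (intro sup) auto
    then show ?case using step by simp
  qed simp
  \<comment> \<open>Induction along the orbit. From a point outside \<open>B N\<close> jump over a
    good piece of length at most \<open>N\<close>; from a point of \<open>B N\<close> move one step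
    and pay \<open>d\<close>. The last \<open>N\<close> times, where a piece might stick out, are
    paid with \<open>w\<close>.\<close>
  have claim: "real n * (\<psi> x - e) - (\<Sum>j<n. d ((T ^^ j) x)) - (\<Sum>j\<in>{n-N..<n}. w ((T ^^ j) x)) \<le> s n x"
    if "1 \<le> n" "x \<in> space M" for n x
    using that
  proof (induction n arbitrary: x rule: less_induct)
    case (less n)
    show ?case
    proof (cases "n \<le> N")
      case True
      \<comment> \<open>Here subtraction of naturals truncates, \<open>n - N = 0\<close>, so every
        time of the segment is paid with \<open>w\<close>.\<close>
      have "real n * (\<psi> x - e) - (\<Sum>j<n. d ((T ^^ j) x)) - (\<Sum>j\<in>{n-N..<n}. w ((T ^^ j) x))
          = (\<Sum>j<n. \<psi> x - e - d ((T ^^ j) x) - w ((T ^^ j) x))"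
        using True by (simp add: sum_subtractf sum.distrib atLeast0LessThan algebra_simps)
      also have "\<dots> \<le> (\<Sum>j<n. s 1 ((T ^^ j) x))"
      proof (rule sum_mono)
        fix j
        show "\<psi> x - e - d ((T ^^ j) x) - w ((T ^^ j) x) \<le> s 1 ((T ^^ j) x)"
          using d0[of "(T ^^ j) x"] e psi_pow[OF less.prems(2), of j] unfolding w_def by linarith
      qed
      also have "\<dots> \<le> s n x" using less.prems by (rule s1)
      finally show ?thesis .
    next
      case False
      have "\<exists>t\<in>{1..N}. real t * (\<psi> x - e) - d x \<le> s t x"
      proof (cases "x \<in> B N")
        case True
        then have "real 1 * (\<psi> x - e) - d x \<le> s 1 x" using e by (simp add: d_def w_def)
        then show ?thesis using N by (intro bexI[of _ 1]) auto
      next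
        case False
        then obtain t where "t \<in> {1..N}" "real t * (\<psi> x - e) \<le> s t x"
          using less.prems unfolding B_def by force
        then show ?thesis using d0[of x] by (intro bexI[of _ t]) auto
      qed
      then obtain t where t: "1 \<le> t" "t \<le> N" "real t * (\<psi> x - e) - d x \<le> s t x" by auto
      define y where "y = (T ^^ t) x"
      have y: "y \<in> space M" "\<psi> y = \<psi> x"
        using less.prems by (auto simp: y_def pow_space psi_pow)
      have IH: "real (n - t) * (\<psi> y - e) - (\<Sum>j<n-t. d ((T ^^ j) y)) - (\<Sum>j\<in>{n-t-N..<n-t}. w ((T ^^ j) y)) \<le> s (n - t) y"
        using t False y by (intro less.IH) auto
      have shift: "(\<Sum>j\<in>{k..<n-t}. u ((T ^^ j) y)) = (\<Sum>j\<in>{k+t..<n}. u ((T ^^ j) x))" for u :: "'a \<Rightarrow> real" and k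
        using t False sum.shift_bounds_nat_ivl[of "\<lambda>j. u ((T ^^ j) x)" k t "n - t"]
        unfolding y_def pow_add by simp
      have d_le: "d x + (\<Sum>j<n-t. d ((T ^^ j) y)) \<le> (\<Sum>j<n. d ((T ^^ j) x))"
      proof -
        \<comment> \<open>Only starting points of pieces are charged; the charges at times strictly
          between 0 and \<open>t\<close> are added for free because \<open>d\<close> is
          nonnegative.\<close>
        have "d x + (\<Sum>j<n-t. d ((T ^^ j) y)) = (\<Sum>j\<in>insert 0 {t..<n}. d ((T ^^ j) x))"
          using shift[of d 0] t by (simp add: atLeast0LessThan)
        also have "\<dots> \<le> (\<Sum>j<n. d ((T ^^ j) x))"
          using d0 False N by (intro sum_mono2) auto
        finally show ?thesis .
      qed
      have w_le: "(\<Sum>j\<in>{n-t-N..<n-t}. w ((T ^^ j) y)) \<le> (\<Sum>j\<in>{n-N..<n}. w ((T ^^ j) x))"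
        unfolding shift using w0 by (intro sum_mono2) auto
      have "s t x + s (n - t) y \<le> s (t + (n - t)) x"
        unfolding y_def using t False less.prems by (intro sup) auto
      then have "s t x + s (n - t) y \<le> s n x" using t False by simp
      moreover have "real n * (\<psi> x - e) = real t * (\<psi> x - e) + real (n - t) * (\<psi> x - e)"
        using t False by (simp add: of_nat_diff algebra_simps)
      ultimately show ?thesis using IH d_le w_le t(3) unfolding y(2) by linarith
    qed
  qed
  have integ: "real n * ((\<integral>x. \<psi> x \<partial>M) - e) - real n * (\<integral>x. d x \<partial>M) - real N * (\<integral>x. w x \<partial>M) \<le> (\<integral>x. s n x \<partial>M)"
    if n: "1 \<le> n" for n
  proof -
    let ?a = "\<lambda>x. real n * (\<psi> x - e)" and ?b = "\<lambda>x. \<Sum>j<n. d ((T ^^ j) x)"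
      and ?c = "\<lambda>x. \<Sum>j\<in>{n-N..<n}. w ((T ^^ j) x)"
    have i: "integrable M ?a" "integrable M ?b" "integrable M ?c"
      using psi d_int w by (auto intro!: integral_pow_sum)
    have "(\<integral>x. ?a x - ?b x - ?c x \<partial>M) \<le> (\<integral>x. s n x \<partial>M)"
      using i int[OF n] claim[OF n] by (intro integral_mono) auto
    also have "(\<integral>x. ?a x - ?b x - ?c x \<partial>M) = (\<integral>x. ?a x \<partial>M) - (\<integral>x. ?b x \<partial>M) - (\<integral>x. ?c x \<partial>M)"
      using i by simp
    also have "\<dots> = real n * ((\<integral>x. \<psi> x \<partial>M) - e) - real n * (\<integral>x. d x \<partial>M) - real (n - (n - N)) * (\<integral>x. w x \<partial>M)"
      using psi d_int w by (simp add: integral_pow_sum prob_space)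
    moreover have "real (n - (n - N)) * (\<integral>x. w x \<partial>M) \<le> real N * (\<integral>x. w x \<partial>M)"
      using w0 by (intro mult_right_mono integral_nonneg) auto
    ultimately show ?thesis by linarith
  qed
  have lim: "(\<lambda>n. (\<integral>x. \<psi> x \<partial>M) - e - (\<integral>x. d x \<partial>M) - real N * (\<integral>x. w x \<partial>M) / real n) \<longlonglongrightarrow>
      (\<integral>x. \<psi> x \<partial>M) - e - (\<integral>x. d x \<partial>M) - 0"
    by (intro tendsto_intros lim_const_over_n)
  have ev: "\<exists>N'. \<forall>n\<ge>N'. (\<integral>x. \<psi> x \<partial>M) - e - (\<integral>x. d x \<partial>M) - real N * (\<integral>x. w x \<partial>M) / real n \<le> (\<integral>x. s n x \<partial>M) / real n"
  proof (intro exI allI impI)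
    fix n :: nat assume n: "1 \<le> n"
    show "(\<integral>x. \<psi> x \<partial>M) - e - (\<integral>x. d x \<partial>M) - real N * (\<integral>x. w x \<partial>M) / real n \<le> (\<integral>x. s n x \<partial>M) / real n"
    proof (subst pos_le_divide_eq)
      have "((\<integral>x. \<psi> x \<partial>M) - e - (\<integral>x. d x \<partial>M) - real N * (\<integral>x. w x \<partial>M) / real n) * real n =
          real n * ((\<integral>x. \<psi> x \<partial>M) - e) - real n * (\<integral>x. d x \<partial>M) - real N * (\<integral>x. w x \<partial>M)"
        using n by (simp add: field_simps)
      then show "((\<integral>x. \<psi> x \<partial>M) - e - (\<integral>x. d x \<partial>M) - real N * (\<integral>x. w x \<partial>M) / real n) * real n \<le> (\<integral>x. s n x \<partial>M)"
        using integ[OF n] by simp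
    qed (use n in simp)
  qed
  have "(\<integral>x. \<psi> x \<partial>M) - e - (\<integral>x. d x \<partial>M) - 0 \<le> L" by (rule LIMSEQ_le[OF lim L ev])
  then show "(\<integral>x. \<psi> x \<partial>M) \<le> L + \<epsilon>" using dN unfolding e_def by (simp add: field_simps)
qed

end

section \<open>Almost additive processes: upper limits, integrability, convergence\<close>

locale almost_additive_process = measure_preserving +
  fixes g :: "nat \<Rightarrow> 'a \<Rightarrow> real" and C :: real
  assumes g_meas: "\<And>n. 1 \<le> n \<Longrightarrow> g n \<in> borel_measurable M"
    and C_nonneg: "0 \<le> C"
    and g_lower: "\<And>n m x. 1 \<le> n \<Longrightarrow> 1 \<le> m \<Longrightarrow> x \<in> space M \<Longrightarrow> g n x + g m ((T ^^ n) x) - C \<le> g (n + m) x"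
    and g_upper: "\<And>n m x. 1 \<le> n \<Longrightarrow> 1 \<le> m \<Longrightarrow> x \<in> space M \<Longrightarrow> g (n + m) x \<le> g n x + g m ((T ^^ n) x) + C"
begin

lemma g_sum:
  assumes "1 \<le> n" "x \<in> space M"
  shows "\<bar>g n x - (\<Sum>j<n. g 1 ((T ^^ j) x))\<bar> \<le> C * real n"
  using assms(1)
proof (induction n rule: dec_induct)
  case base
  then show ?case using C_nonneg by simp
next
  case (step n)
  then show ?case using g_lower[of n 1 x] g_upper[of n 1 x] assms(2) by (simp add: algebra_simps)
qed

lemma g_integrable:
  assumes "integrable M (g 1)" "1 \<le> n"
  shows "integrable M (g n)"
proof (rule Bochner_Integration.integrable_bound)
  show "integrable M (\<lambda>x. (\<Sum>j<n. \<bar>g 1 ((T ^^ j) x)\<bar>) + C * real n)"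
    using integral_pow_sum(2)[OF integrable_abs[OF assms(1)], of "{..<n}"] by simp
  show "g n \<in> borel_measurable M" using assms g_meas by simp
  show "AE x in M. norm (g n x) \<le> norm ((\<Sum>j<n. \<bar>g 1 ((T ^^ j) x)\<bar>) + C * real n)"
  proof (rule AE_I2)
    fix x assume x: "x \<in> space M"
    have "\<bar>\<Sum>j<n. g 1 ((T ^^ j) x)\<bar> \<le> (\<Sum>j<n. \<bar>g 1 ((T ^^ j) x)\<bar>)" by (rule sum_abs)
    then have "\<bar>g n x\<bar> \<le> (\<Sum>j<n. \<bar>g 1 ((T ^^ j) x)\<bar>) + C * real n"
      using g_sum[OF assms(2) x] by linarith
    then show "norm (g n x) \<le> norm ((\<Sum>j<n. \<bar>g 1 ((T ^^ j) x)\<bar>) + C * real n)"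
      unfolding real_norm_def by (rule order_trans[OF _ abs_ge_self])
  qed
qed

lemma average_converges:
  assumes "integrable M (g 1)"
  obtains L where "(\<lambda>n. (\<integral>x. g n x \<partial>M) / real n) \<longlonglongrightarrow> L"
proof -
  note int = g_integrable[OF assms]
  \<comment> \<open>Adding \<open>C\<close> once turns the almost additive upper bound into exact
    subadditivity.\<close>
  define u where "u n = (\<integral>x. g n x \<partial>M) + C" for n
  have "convergent (\<lambda>n. u n / real n)"
  proof (rule fekete[where K = "- (\<bar>\<integral>x. g 1 x \<partial>M\<bar> + C)"])
    fix n m :: nat assume nm: "1 \<le> n" "1 \<le> m"
    have i: "integrable M (\<lambda>x. g m ((T ^^ n) x))" using nm int by (intro integrable_pow) auto
    have "(\<integral>x. g (n + m) x \<partial>M) \<le> (\<integral>x. g n x + g m ((T ^^ n) x) + C \<partial>M)"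
      using nm int i g_upper by (intro integral_mono) auto
    also have "\<dots> = (\<integral>x. g n x \<partial>M) + (\<integral>x. g m x \<partial>M) + C"
      using nm int i g_meas by (simp add: integral_pow prob_space)
    finally show "u (n + m) \<le> u n + u m" by (simp add: u_def)
  next
    fix n :: nat assume n: "1 \<le> n"
    have "(\<integral>x. (\<Sum>j<n. g 1 ((T ^^ j) x)) - C * real n \<partial>M) \<le> (\<integral>x. g n x \<partial>M)"
    proof (rule integral_mono)
      show "integrable M (\<lambda>x. (\<Sum>j<n. g 1 ((T ^^ j) x)) - C * real n)"
        using integral_pow_sum(2)[OF assms, of "{..<n}"] by simp
      show "(\<Sum>j<n. g 1 ((T ^^ j) x)) - C * real n \<le> g n x" if "x \<in> space M" for x
        using g_sum[OF n that] by (simp add: abs_le_iff)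
    qed (use int n in auto)
    then have "real n * (\<integral>x. g 1 x \<partial>M) - C * real n \<le> (\<integral>x. g n x \<partial>M)"
      using integral_pow_sum[OF assms, of "{..<n}"] by (simp add: prob_space)
    moreover have "real n * (\<integral>x. g 1 x \<partial>M) \<ge> - (real n * \<bar>\<integral>x. g 1 x \<partial>M\<bar>)"
      by (metis abs_ge_minus_self abs_mult abs_of_nat minus_le_iff)
    ultimately show "- (\<bar>\<integral>x. g 1 x \<partial>M\<bar> + C) * real n \<le> u n"
      using C_nonneg unfolding u_def by (simp add: algebra_simps)
  qed
  then obtain L where "(\<lambda>n. u n / real n) \<longlonglongrightarrow> L" by (auto simp: convergent_def)
  then have "(\<lambda>n. u n / real n - C / real n) \<longlonglongrightarrow> L - 0"
    by (intro tendsto_diff lim_const_over_n)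
  moreover have "u n / real n - C / real n = (\<integral>x. g n x \<partial>M) / real n" for n
    by (simp add: u_def diff_divide_distrib[symmetric])
  ultimately show ?thesis using that[of L] by simp
qed

definition upper :: "'a \<Rightarrow> ereal" where
  "upper x = limsup (\<lambda>n. ereal (g n x / real n))"

lemma average_measurable[measurable]: "(\<lambda>x. g n x / real n) \<in> borel_measurable M"
  using g_meas[of n] by (cases "1 \<le> n") (auto simp: not_le)

lemma upper_measurable[measurable]: "upper \<in> borel_measurable M"
  unfolding upper_def[abs_def] by measurable

text \<open>\<open>g (Suc n) x\<close> and \<open>g n (T x)\<close> differ by at most
  \<open>\<bar>g 1 x\<bar> + C\<close>. This depends on the point but not on \<open>n\<close> and
  disappears in the average.\<close>

lemma upper_invariant:
  assumes x: "x \<in> space M"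
  shows "upper (T x) = upper x"
proof (rule ereal_eqI_real)
  fix r :: real
  define D where "D = \<bar>g 1 x\<bar> + C"
  have D: "\<bar>g (Suc n) x - g n (T x)\<bar> \<le> D" if "1 \<le> n" for n
    using g_lower[of 1 n x] g_upper[of 1 n x] that x by (simp add: D_def)
  have big: "\<exists>n0\<ge>1. \<forall>n\<ge>n0. D + \<bar>r\<bar> + e \<le> real n * (e / 2)" if e: "0 < e" for e
  proof -
    obtain k :: nat where k: "(D + \<bar>r\<bar> + e) / (e / 2) < real k" using reals_Archimedean2 by blast
    show ?thesis
    proof (intro exI[of _ "max 1 k"] conjI allI impI)
      fix n assume "max 1 k \<le> n"
      then have "(D + \<bar>r\<bar> + e) / (e / 2) \<le> real n" using k by linarith
      then show "D + \<bar>r\<bar> + e \<le> real n * (e / 2)" using e by (subst (asm) pos_divide_le_eq) auto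
    qed simp
  qed
  show "ereal r \<le> upper (T x) \<longleftrightarrow> ereal r \<le> upper x"
    unfolding upper_def le_limsup_iff
  proof (intro iffI allI impI)
    fix e :: real and N
    assume h: "\<forall>e>0. \<forall>N. \<exists>n\<ge>N. real n * (r - e) \<le> g n (T x)" and e: "0 < e"
    obtain n0 where n0: "1 \<le> n0" "\<And>n. n0 \<le> n \<Longrightarrow> D + \<bar>r\<bar> + e \<le> real n * (e / 2)" using big[OF e] by blast
    have "0 < e / 2" using e by simp
    with h obtain n where n: "max n0 N \<le> n" "real n * (r - e / 2) \<le> g n (T x)" by blast
    have "real (Suc n) * (r - e) = real n * (r - e / 2) - real n * (e / 2) + (r - e)"
      by (simp add: algebra_simps)
    moreover have "g n (T x) - D \<le> g (Suc n) x" using n n0(1) D[of n] by linarith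
    moreover have "D + \<bar>r\<bar> + e \<le> real n * (e / 2)" using n n0(2)[of n] by simp
    ultimately have "real (Suc n) * (r - e) \<le> g (Suc n) x"
      using n(2) abs_ge_self[of r] e by linarith
    then show "\<exists>n\<ge>N. real n * (r - e) \<le> g n x" using n by (intro exI[of _ "Suc n"]) auto
  next
    fix e :: real and N
    assume h: "\<forall>e>0. \<forall>N. \<exists>n\<ge>N. real n * (r - e) \<le> g n x" and e: "0 < e"
    obtain n0 where n0: "1 \<le> n0" "\<And>n. n0 \<le> n \<Longrightarrow> D + \<bar>r\<bar> + e \<le> real n * (e / 2)" using big[OF e] by blast
    have "0 < e / 2" using e by simp
    with h obtain n' where n': "Suc (max n0 N) \<le> n'" "real n' * (r - e / 2) \<le> g n' x" by blast
    then obtain n where n: "n' = Suc n" "max n0 N \<le> n" by (cases n') auto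
    have "real n * (r - e) = real (Suc n) * (r - e / 2) - real n * (e / 2) - (r - e / 2)"
      by (simp add: algebra_simps)
    moreover have "g (Suc n) x - D \<le> g n (T x)" using n n0(1) D[of n] by linarith
    moreover have "D + \<bar>r\<bar> + e \<le> real n * (e / 2)" using n n0(2)[of n] by simp
    ultimately have "real n * (r - e) \<le> g n (T x)"
      using n'(2) n(1) abs_ge_minus_self[of r] e by simp
    then show "\<exists>n\<ge>N. real n * (r - e) \<le> g n (T x)" using n by (intro exI[of _ n]) auto
  qed
qed

text \<open>Multiplying by the indicator of an invariant set kills whole orbits only. This localises
  the integrable case to sets on which the upper limit is bounded below.\<close>

lemma process_restrict:
  assumes "E \<in> events" "\<And>x. x \<in> space M \<Longrightarrow> T x \<in> E \<longleftrightarrow> x \<in> E"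
  shows "almost_additive_process M T (\<lambda>n x. g n x * indicator E x) C"
proof
  have inv: "(T ^^ n) x \<in> E \<longleftrightarrow> x \<in> E" if "x \<in> space M" for n x
    by (induction n) (auto simp: assms(2) pow_space that)
  show "(\<lambda>x. g n x * indicator E x) \<in> borel_measurable M" if "1 \<le> n" for n
    using g_meas[OF that] assms(1) by (intro borel_measurable_times borel_measurable_indicator)
  show "0 \<le> C" by (rule C_nonneg)
  fix n m :: nat and x assume "1 \<le> n" "1 \<le> m" "x \<in> space M"
  then show "g n x * indicator E x + g m ((T ^^ n) x) * indicator E ((T ^^ n) x) - C \<le> g (n + m) x * indicator E x"
    "g (n + m) x * indicator E x \<le> g n x * indicator E x + g m ((T ^^ n) x) * indicator E ((T ^^ n) x) + C"
    using g_lower[of n m x] g_upper[of n m x] C_nonneg inv[of x n] by (auto simp: indicator_def)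
qed

text \<open>Negation swaps the two inequalities, and upper limits of the new process are negatives
  of lower limits of the old one.\<close>

lemma process_uminus: "almost_additive_process M T (\<lambda>n x. - g n x) C"
proof
  show "(\<lambda>x. - g n x) \<in> borel_measurable M" if "1 \<le> n" for n
    using g_meas[OF that] by simp
  show "0 \<le> C" by (rule C_nonneg)
  fix n m :: nat and x assume a: "1 \<le> n" "1 \<le> m" "x \<in> space M"
  show "- g n x + - g m ((T ^^ n) x) - C \<le> - g (n + m) x"
    "- g (n + m) x \<le> - g n x + - g m ((T ^^ n) x) + C"
    using g_lower[OF a] g_upper[OF a] by linarith+
qed

text \<open>\<open>g n - C\<close> is superadditive, with the same averages in the limit and the
  same upper limit, so the orbit-cutting bound applies to it.\<close>

lemma integral_le_of_le_upper:
  assumes int: "integrable M (g 1)"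
    and psi: "integrable M \<psi>" "\<And>x. x \<in> space M \<Longrightarrow> \<psi> (T x) = \<psi> x"
    and le: "AE x in M. ereal (\<psi> x) \<le> upper x"
    and L: "(\<lambda>n. (\<integral>x. g n x \<partial>M) / real n) \<longlonglongrightarrow> L"
  shows "(\<integral>x. \<psi> x \<partial>M) \<le> L"
proof (rule superadditive_integral_ge[where s = "\<lambda>n x. g n x - C"])
  show "AE x in M. \<forall>e>0. \<exists>n\<ge>1. real n * (\<psi> x - e) \<le> g n x - C"
    using le
  proof eventually_elim
    case (elim x)
    show ?case
    proof (intro allI impI)
      fix e :: real assume e: "0 < e"
      obtain k :: nat where k: "C / (e / 2) < real k" using reals_Archimedean2 by blast
      have "0 < e / 2" using e by simp
      with elim obtain n where n: "max 1 k \<le> n" "real n * (\<psi> x - e / 2) \<le> g n x"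
        unfolding upper_def le_limsup_iff by blast
      have "C / (e / 2) \<le> real n" using n k by linarith
      then have "C \<le> real n * (e / 2)" using e by (subst (asm) pos_divide_le_eq) auto
      then have "real n * (\<psi> x - e) \<le> g n x - C" using n by (simp add: algebra_simps)
      then show "\<exists>n\<ge>1. real n * (\<psi> x - e) \<le> g n x - C" using n by auto
    qed
  qed
  have "(\<lambda>n. (\<integral>x. g n x \<partial>M) / real n - C / real n) \<longlonglongrightarrow> L - 0"
    by (intro tendsto_diff L lim_const_over_n)
  then have l: "(\<lambda>n. (\<integral>x. g n x \<partial>M) / real n - C / real n) \<longlonglongrightarrow> L" by simp
  show "(\<lambda>n. (\<integral>x. g n x - C \<partial>M) / real n) \<longlonglongrightarrow> L"
    by (rule Lim_transform_eventually[OF l])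
      (auto simp: eventually_sequentially prob_space g_integrable[OF int] diff_divide_distrib intro!: exI[of _ 1])
  show "integrable M (\<lambda>x. g n x - C)" if "1 \<le> n" for n using g_integrable[OF int that] by simp
  show "g n x - C + (g m ((T ^^ n) x) - C) \<le> g (n + m) x - C"
    if "1 \<le> n" "1 \<le> m" "x \<in> space M" for n m x using g_lower[OF that] by simp
qed (use psi in auto)

text \<open>The truncations of \<open>upper\<close> at height \<open>R\<close> are bounded invariant
  functions below \<open>upper\<close>, so all their integrals are at most \<open>L\<close>. Letting
  \<open>R\<close> grow, this excludes the value \<open>\<infinity>\<close> on a set of positive
  measure and gives integrability by monotone convergence.\<close>

lemma upper_integrable_of_bounded_below:
  assumes int: "integrable M (g 1)"
    and lb: "\<And>n x. 1 \<le> n \<Longrightarrow> x \<in> space M \<Longrightarrow> - (K * real n) \<le> g n x" and "0 \<le> K"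
    and L: "(\<lambda>n. (\<integral>x. g n x \<partial>M) / real n) \<longlonglongrightarrow> L"
  obtains v where "integrable M v" "AE x in M. upper x = ereal (v x)" "(\<integral>x. v x \<partial>M) \<le> L"
proof -
  have upper_ge: "ereal (- K) \<le> upper x" if x: "x \<in> space M" for x
    unfolding upper_def
  proof (rule le_Limsup)
    show "\<forall>\<^sub>F n in sequentially. ereal (- K) \<le> ereal (g n x / real n)"
      unfolding eventually_sequentially
      by (intro exI[of _ 1] allI impI) (use lb x in \<open>auto simp: le_divide_eq\<close>)
  qed simp
  define \<psi> where "\<psi> R x = real_of_ereal (min (upper x) (ereal (real R)))" for R :: nat and x
  have psi_ereal: "ereal (\<psi> R x) = min (upper x) (ereal (real R))" if "x \<in> space M" for R x
    using upper_ge[OF that] unfolding \<psi>_def by (cases "upper x") (auto simp: min_def)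
  have psi_bd: "- K \<le> \<psi> R x" "\<psi> R x \<le> real R" if "x \<in> space M" for R x
  proof -
    have "ereal (- K) \<le> ereal (\<psi> R x)" "ereal (\<psi> R x) \<le> ereal (real R)"
      unfolding psi_ereal[OF that] using upper_ge[OF that] \<open>0 \<le> K\<close> by (auto simp: min_def)
    then show "- K \<le> \<psi> R x" "\<psi> R x \<le> real R" by auto
  qed
  have psi_meas[measurable]: "\<psi> R \<in> borel_measurable M" for R unfolding \<psi>_def[abs_def] by measurable
  have psi_int: "integrable M (\<psi> R)" for R
  proof (rule integrable_const_bound[where B = "K + real R"])
    show "AE x in M. norm (\<psi> R x) \<le> K + real R"
    proof (rule AE_I2)
      fix x assume x: "x \<in> space M"
      show "norm (\<psi> R x) \<le> K + real R"
        using psi_bd[OF x, of R] \<open>0 \<le> K\<close> unfolding real_norm_def by linarith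
    qed
  qed (rule psi_meas)
  have psi_le: "(\<integral>x. \<psi> R x \<partial>M) \<le> L" for R
  proof (rule integral_le_of_le_upper[OF int psi_int _ _ L])
    show "\<psi> R (T x) = \<psi> R x" if "x \<in> space M" for x using upper_invariant[OF that] by (simp add: \<psi>_def)
    show "AE x in M. ereal (\<psi> R x) \<le> upper x" using psi_ereal by (intro AE_I2) simp
  qed
  define F where "F = {x \<in> space M. upper x = \<infinity>}"
  have F_sets: "F \<in> events" unfolding F_def by measurable
  \<comment> \<open>The left side is linear in \<open>R\<close> with slope \<open>prob F\<close>,
    the right side is fixed, so \<open>F\<close> must be null.\<close>
  have F_le: "(real R + K) * prob F \<le> L + K" for R :: nat
  proof -
    have "(\<integral>x. (real R + K) * indicator F x \<partial>M) \<le> (\<integral>x. \<psi> R x + K \<partial>M)"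
    proof (rule integral_mono)
      show "(real R + K) * indicator F x \<le> \<psi> R x + K" if x: "x \<in> space M" for x
      proof (cases "x \<in> F")
        case True
        then have "\<psi> R x = real R" by (simp add: \<psi>_def F_def)
        then show ?thesis using True by simp
      qed (use psi_bd[OF x, of R] in simp)
      show "integrable M (\<lambda>x. (real R + K) * indicator F x)"
        by (intro integrable_real_mult_indicator F_sets) simp
    qed (use psi_int in simp)
    then show ?thesis using psi_le[of R] F_sets psi_int by (simp add: prob_space)
  qed
  have "prob F = 0"
  proof (rule ccontr)
    assume "prob F \<noteq> 0"
    then have pos: "0 < prob F" by (simp add: zero_less_measure_iff)
    obtain R :: nat where "(L + K) / prob F < real R" using reals_Archimedean2 by blast
    then have "L + K < real R * prob F" using pos by (simp add: pos_divide_less_eq)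
    moreover have "0 \<le> K * prob F" using \<open>0 \<le> K\<close> by simp
    ultimately show False using F_le[of R] by (simp add: algebra_simps)
  qed
  then have "F \<in> null_sets M" using F_sets by (simp add: null_setsI emeasure_eq_measure)
  then have AE_fin: "AE x in M. upper x \<noteq> \<infinity>" by (rule AE_mp[OF AE_not_in]) (auto simp: F_def)
  define v where "v x = real_of_ereal (upper x)" for x
  have v_eq: "AE x in M. upper x = ereal (v x)"
    using AE_fin
  proof (rule AE_mp, intro AE_I2 impI)
    fix x assume "x \<in> space M" "upper x \<noteq> \<infinity>"
    then show "upper x = ereal (v x)" using upper_ge[of x] unfolding v_def by (cases "upper x") auto
  qed
  have mono: "\<psi> R x \<le> \<psi> R' x" if "R \<le> R'" "x \<in> space M" for R R' x
  proof -
    have "ereal (\<psi> R x) \<le> ereal (\<psi> R' x)" unfolding psi_ereal[OF that(2)] using that(1) by (intro min.mono) auto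
    then show ?thesis by simp
  qed
  have "incseq (\<lambda>R. \<integral>x. \<psi> R x \<partial>M)"
    unfolding incseq_def using mono psi_int by (auto intro!: integral_mono)
  then obtain l where l: "(\<lambda>R. \<integral>x. \<psi> R x \<partial>M) \<longlonglongrightarrow> l" "\<And>R. (\<integral>x. \<psi> R x \<partial>M) \<le> l"
    using incseq_convergent[of "\<lambda>R. \<integral>x. \<psi> R x \<partial>M" L] psi_le by blast
  have "l \<le> L" using LIMSEQ_le_const2[OF l(1)] psi_le by blast
  have lim: "AE x in M. (\<lambda>R. \<psi> R x) \<longlonglongrightarrow> v x"
    using v_eq
  proof (rule AE_mp, intro AE_I2 impI)
    fix x assume x: "x \<in> space M" "upper x = ereal (v x)"
    obtain R0 :: nat where R0: "v x < real R0" using reals_Archimedean2 by blast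
    have "\<psi> R x = v x" if "R0 \<le> R" for R
    proof -
      have "v x \<le> real R" using R0 that by linarith
      then show ?thesis using psi_ereal[OF x(1), of R] x(2) by (simp add: min_def)
    qed
    then show "(\<lambda>R. \<psi> R x) \<longlonglongrightarrow> v x"
      by (intro tendsto_eventually) (auto simp: eventually_sequentially)
  qed
  have v_meas: "v \<in> borel_measurable M" unfolding v_def[abs_def] by measurable
  have mono_AE: "AE x in M. mono (\<lambda>R. \<psi> R x)" using mono by (intro AE_I2 monoI)
  have "integrable M v" "(\<integral>x. v x \<partial>M) = l"
    using integral_monotone_convergence[OF psi_int mono_AE lim l(1) v_meas]
      integrable_monotone_convergence[OF psi_int mono_AE lim l(1) v_meas] by auto
  then show ?thesis using that[of v] v_eq \<open>l \<le> L\<close> by auto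
qed

text \<open>Apply the bound on upper limits to \<open>g\<close> and to \<open>- g\<close>: the upper
  limit has integral at most \<open>L\<close> and the lower limit has integral at least
  \<open>L\<close>, so they coincide almost everywhere. The upper bound on \<open>g\<close> is a
  lower bound for \<open>- g\<close> and puts the negated process within reach of the truncation
  argument; \<open>u\<close> then lies between \<open>- v\<close> and
  \<open>\<bar>K\<bar>\<close>.\<close>

lemma ergodic_integrable:
  assumes int: "integrable M (g 1)"
    and ub: "\<And>n x. 1 \<le> n \<Longrightarrow> x \<in> space M \<Longrightarrow> g n x \<le> K * real n"
    and L: "(\<lambda>n. (\<integral>x. g n x \<partial>M) / real n) \<longlonglongrightarrow> L"
  obtains u where "integrable M u" "(\<integral>x. u x \<partial>M) = L" "AE x in M. (\<lambda>n. ereal (g n x / real n)) \<longlonglongrightarrow> ereal (u x)"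
proof -
  interpret neg: almost_additive_process M T "\<lambda>n x. - g n x" C by (rule process_uminus)
  have lb: "- (\<bar>K\<bar> * real n) \<le> - g n x" if "1 \<le> n" "x \<in> space M" for n x
  proof -
    have "K * real n \<le> \<bar>K\<bar> * real n" by (intro mult_right_mono) auto
    then show ?thesis using ub[OF that] by linarith
  qed
  have "(\<lambda>n. - ((\<integral>x. g n x \<partial>M) / real n)) \<longlonglongrightarrow> - L" by (intro tendsto_minus L)
  then have nL: "(\<lambda>n. (\<integral>x. - g n x \<partial>M) / real n) \<longlonglongrightarrow> - L" by simp
  have nint: "integrable M (\<lambda>x. - g 1 x)" using int by simp
  obtain v where v: "integrable M v" "AE x in M. neg.upper x = ereal (v x)" "(\<integral>x. v x \<partial>M) \<le> - L"
    using neg.upper_integrable_of_bounded_below[OF nint lb _ nL] by auto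
  define u where "u x = real_of_ereal (upper x)" for x
  have upper_le: "upper x \<le> ereal \<bar>K\<bar>" if x: "x \<in> space M" for x
    unfolding upper_def
  proof (rule Limsup_bounded)
    have "g n x / real n \<le> \<bar>K\<bar>" if "1 \<le> n" for n
      using lb[OF that x] that by (simp add: divide_le_eq)
    then show "\<forall>\<^sub>F n in sequentially. ereal (g n x / real n) \<le> ereal \<bar>K\<bar>"
      unfolding eventually_sequentially by (intro exI[of _ 1]) auto
  qed
  have liminf_eq: "liminf (\<lambda>n. ereal (g n x / real n)) = - neg.upper x" for x
  proof -
    have "neg.upper x = - liminf (\<lambda>n. ereal (g n x / real n))"
      using ereal_Limsup_uminus[of sequentially "\<lambda>n. ereal (g n x / real n)"] by (simp add: neg.upper_def)
    then show ?thesis by simp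
  qed
  have le: "- neg.upper x \<le> upper x" for x
    unfolding liminf_eq[symmetric] upper_def by (rule Liminf_le_Limsup) simp
  have u_eq: "AE x in M. upper x = ereal (u x) \<and> - v x \<le> u x"
    using v(2)
  proof (rule AE_mp, intro AE_I2 impI)
    fix x assume x: "x \<in> space M" "neg.upper x = ereal (v x)"
    then show "upper x = ereal (u x) \<and> - v x \<le> u x"
      using upper_le[OF x(1)] le[of x] unfolding u_def by (cases "upper x") auto
  qed
  have u_meas: "u \<in> borel_measurable M" unfolding u_def[abs_def] by measurable
  have u_int: "integrable M u"
  proof (rule Bochner_Integration.integrable_bound)
    show "integrable M (\<lambda>x. \<bar>v x\<bar> + \<bar>K\<bar>)" using v by simp
    show "AE x in M. norm (u x) \<le> norm (\<bar>v x\<bar> + \<bar>K\<bar>)"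
      using u_eq
    proof (rule AE_mp, intro AE_I2 impI)
      fix x assume x: "x \<in> space M" "upper x = ereal (u x) \<and> - v x \<le> u x"
      then have "u x \<le> \<bar>K\<bar>" using upper_le[OF x(1)] by simp
      then show "norm (u x) \<le> norm (\<bar>v x\<bar> + \<bar>K\<bar>)" using x by auto
    qed
  qed (rule u_meas)
  have "(\<integral>x. u x \<partial>M) \<le> L"
  proof (rule integral_le_of_le_upper[OF int u_int _ _ L])
    show "u (T x) = u x" if "x \<in> space M" for x using upper_invariant[OF that] by (simp add: u_def)
    show "AE x in M. ereal (u x) \<le> upper x" using u_eq by eventually_elim simp
  qed
  moreover have "(\<integral>x. - v x \<partial>M) \<le> (\<integral>x. u x \<partial>M)"
  proof (rule integral_mono_AE)
    show "AE x in M. - v x \<le> u x" using u_eq by eventually_elim simp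
  qed (use v u_int in auto)
  ultimately have uL: "(\<integral>x. u x \<partial>M) = L" and "(\<integral>x. u x + v x \<partial>M) = 0"
    using v u_int by auto
  then have "AE x in M. u x + v x = 0"
  proof (subst integral_nonneg_eq_0_iff_AE[symmetric])
    show "AE x in M. 0 \<le> u x + v x" using u_eq by eventually_elim simp
  qed (use v u_int in auto)
  then have "AE x in M. (\<lambda>n. ereal (g n x / real n)) \<longlonglongrightarrow> ereal (u x)"
    using u_eq v(2)
  proof eventually_elim
    case (elim x)
    have "- neg.upper x = ereal (u x)" using elim by (simp add: eq_neg_iff_add_eq_0 add.commute)
    then show ?case
      unfolding liminf_eq[symmetric] using elim
      by (intro Liminf_eq_Limsup) (auto simp: upper_def)
  qed
  then show ?thesis using that u_int uL by blast
qed

text \<open>A converse to the integrable case: if averages on an invariant set do not fall below an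
  integrable invariant function, then \<open>g 1\<close> is integrable there. Cut \<open>g 1\<close>
  off below at \<open>- J\<close>, bound the integrals of the truncations from below by that of
  \<open>\<psi>\<close>, uniformly in \<open>J\<close>, and let \<open>J\<close> grow.\<close>

lemma g_1_integrable_on:
  assumes ub: "\<And>x. x \<in> space M \<Longrightarrow> g 1 x \<le> K"
    and E: "E \<in> events" "\<And>x. x \<in> space M \<Longrightarrow> T x \<in> E \<longleftrightarrow> x \<in> E"
    and psi: "integrable M \<psi>" "\<And>x. x \<in> space M \<Longrightarrow> \<psi> (T x) = \<psi> x"
      "\<And>x. x \<in> space M \<Longrightarrow> x \<notin> E \<Longrightarrow> \<psi> x = 0"
    and le: "AE x in M. x \<in> E \<longrightarrow> ereal (\<psi> x) \<le> upper x"
  shows "integrable M (\<lambda>x. g 1 x * indicator E x)"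
proof -
  \<comment> \<open>The extra \<open>C\<close> makes the Birkhoff sums \<open>G n\<close> of
    \<open>h J\<close> dominate \<open>g n\<close> on \<open>E\<close>, so \<open>G\<close> has the
    larger upper limit there.\<close>
  define h where "h J x = (max (g 1 x) (- real J) + C) * indicator E x" for J :: nat and x
  have g1[measurable]: "g 1 \<in> borel_measurable M" by (rule g_meas) simp
  have [measurable]: "E \<in> events" by (rule E)
  have h_meas[measurable]: "h J \<in> borel_measurable M" for J unfolding h_def[abs_def] by measurable
  have h_int: "integrable M (h J)" for J
  proof (rule integrable_const_bound[where B = "\<bar>K\<bar> + real J + C"])
    show "AE x in M. norm (h J x) \<le> \<bar>K\<bar> + real J + C"
      using ub C_nonneg by (intro AE_I2) (fastforce simp: h_def indicator_def max_def abs_le_iff)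
  qed measurable
  have inv: "(T ^^ n) x \<in> E \<longleftrightarrow> x \<in> E" if "x \<in> space M" for n x
    by (induction n) (auto simp: E(2) pow_space that)
  have h_le: "(\<integral>x. \<psi> x \<partial>M) \<le> (\<integral>x. h J x \<partial>M)" for J
  proof -
    define G where "G n x = (\<Sum>j<n. h J ((T ^^ j) x))" for n x
    have G1: "G 1 = h J" by (auto simp: G_def)
    interpret G: almost_additive_process M T G 0
    proof
      show "G n \<in> borel_measurable M" for n unfolding G_def[abs_def] by measurable
      fix n m :: nat and x
      have "G (n + m) x = G n x + G m ((T ^^ n) x)"
      proof -
        have "G m ((T ^^ n) x) = (\<Sum>j\<in>{0+n..<m+n}. h J ((T ^^ j) x))"
          unfolding G_def sum.shift_bounds_nat_ivl by (simp add: atLeast0LessThan funpow_add)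
        moreover have "G (n + m) x = (\<Sum>j\<in>{0..<n+m}. h J ((T ^^ j) x))"
          by (simp add: G_def atLeast0LessThan)
        moreover have "\<dots> = (\<Sum>j\<in>{0..<n}. h J ((T ^^ j) x)) + (\<Sum>j\<in>{n..<n+m}. h J ((T ^^ j) x))"
          by (rule sum.atLeastLessThan_concat[symmetric]) auto
        ultimately show ?thesis by (simp add: G_def atLeast0LessThan add.commute)
      qed
      then show "G n x + G m ((T ^^ n) x) - 0 \<le> G (n + m) x" "G (n + m) x \<le> G n x + G m ((T ^^ n) x) + 0"
        by simp_all
    qed simp
    have Gint: "integrable M (G 1)" unfolding G1 by (rule h_int)
    have GL: "(\<lambda>n. (\<integral>x. G n x \<partial>M) / real n) \<longlonglongrightarrow> (\<integral>x. h J x \<partial>M)"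
    proof (rule Lim_transform_eventually[OF tendsto_const])
      show "\<forall>\<^sub>F n in sequentially. (\<integral>x. h J x \<partial>M) = (\<integral>x. G n x \<partial>M) / real n"
        unfolding eventually_sequentially G_def integral_pow_sum(1)[OF h_int finite_lessThan]
        by (intro exI[of _ 1]) auto
    qed
    show ?thesis
    proof (rule G.integral_le_of_le_upper[OF Gint psi(1,2) _ GL])
      show "AE x in M. ereal (\<psi> x) \<le> G.upper x"
        using le
      proof (rule AE_mp, intro AE_I2 impI)
        fix x assume x: "x \<in> space M" "x \<in> E \<longrightarrow> ereal (\<psi> x) \<le> upper x"
        show "ereal (\<psi> x) \<le> G.upper x"
        proof (cases "x \<in> E")
          case True
          have "g n x \<le> G n x" if n: "1 \<le> n" for n
          proof -
            have "g n x \<le> (\<Sum>j<n. g 1 ((T ^^ j) x)) + C * real n" using g_sum[OF n x(1)] by linarith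
            also have "\<dots> = (\<Sum>j<n. g 1 ((T ^^ j) x) + C)" by (simp add: sum.distrib)
            also have "\<dots> \<le> G n x" unfolding G_def
              by (intro sum_mono) (simp add: h_def inv[OF x(1)] True)
            finally show ?thesis .
          qed
          then have "upper x \<le> G.upper x" unfolding upper_def G.upper_def
            by (intro Limsup_mono) (auto simp: eventually_sequentially divide_right_mono intro!: exI[of _ 1])
          then show ?thesis using x True by auto
        next
          case False
          have "G n x = 0" for n unfolding G_def by (simp add: h_def inv[OF x(1)] False)
          then have "G.upper x = 0" unfolding G.upper_def by (simp add: Limsup_const zero_ereal_def[symmetric])
          then show ?thesis using psi(3)[OF x(1) False] by (simp add: zero_ereal_def)
        qed
      qed
    qed
  qed
  \<comment> \<open>The truncations decrease in \<open>J\<close>; the sign is changed to apply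
    monotone convergence for increasing sequences.\<close>
  define k where "k J x = - h J x" for J x
  have k_int: "integrable M (k J)" for J unfolding k_def[abs_def] using h_int by simp
  have k_mono: "AE x in M. mono (\<lambda>J. k J x)"
    unfolding k_def h_def by (intro AE_I2 monoI) (auto simp: indicator_def max_def)
  have "incseq (\<lambda>J. \<integral>x. k J x \<partial>M)"
    unfolding incseq_def
    by (intro allI impI integral_mono_AE k_int) (use k_mono in \<open>eventually_elim, auto dest: monoD\<close>)
  moreover have "(\<integral>x. k J x \<partial>M) \<le> - (\<integral>x. \<psi> x \<partial>M)" for J using h_le[of J] by (simp add: k_def)
  ultimately obtain l where l: "(\<lambda>J. \<integral>x. k J x \<partial>M) \<longlonglongrightarrow> l"
    using incseq_convergent[of "\<lambda>J. \<integral>x. k J x \<partial>M"] by blast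
  have lim: "AE x in M. (\<lambda>J. k J x) \<longlonglongrightarrow> - ((g 1 x + C) * indicator E x)"
  proof (rule AE_I2)
    fix x
    obtain J0 :: nat where J0: "- g 1 x < real J0" using reals_Archimedean2 by blast
    have "k J x = - ((g 1 x + C) * indicator E x)" if "J0 \<le> J" for J
    proof -
      have "- real J \<le> g 1 x" using J0 that by linarith
      then show ?thesis by (simp add: k_def h_def max_def)
    qed
    then show "(\<lambda>J. k J x) \<longlonglongrightarrow> - ((g 1 x + C) * indicator E x)"
      by (intro tendsto_eventually) (auto simp: eventually_sequentially)
  qed
  have m: "(\<lambda>x. - ((g 1 x + C) * indicator E x)) \<in> borel_measurable M" by measurable
  have i1: "integrable M (\<lambda>x. - ((g 1 x + C) * indicator E x))"
    by (rule integrable_monotone_convergence[OF k_int k_mono lim l m])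
  have i2: "integrable M (\<lambda>x. C * indicator E x)" by (intro integrable_real_mult_indicator) auto
  have "integrable M (\<lambda>x. - (- ((g 1 x + C) * indicator E x)) - C * indicator E x)"
    by (rule Bochner_Integration.integrable_diff[OF integrable_minus[OF i1] i2])
  then show ?thesis by (simp add: algebra_simps)
qed

text \<open>Without integrability of \<open>g 1\<close>: the sets \<open>E R\<close> on which the
  upper limit is at least \<open>- R\<close> are invariant, \<open>g 1\<close> is integrable on each
  of them, and there the integrable case applies. Off all of them the upper limit is
  \<open>-\<infinity>\<close>, which forces convergence.\<close>

lemma ergodic_AE_convergent:
  assumes ub: "\<And>n x. 1 \<le> n \<Longrightarrow> x \<in> space M \<Longrightarrow> g n x \<le> K * real n"
  shows "AE x in M. (\<lambda>n. ereal (g n x / real n)) \<longlonglongrightarrow> upper x"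
proof -
  have upper_le: "upper x \<le> ereal K" if x: "x \<in> space M" for x
    unfolding upper_def
  proof (rule Limsup_bounded)
    have "g n x / real n \<le> K" if "1 \<le> n" for n
      using ub[OF that x] that by (simp add: divide_le_eq)
    then show "\<forall>\<^sub>F n in sequentially. ereal (g n x / real n) \<le> ereal K"
      unfolding eventually_sequentially by (intro exI[of _ 1]) auto
  qed
  define E where "E R = {x \<in> space M. ereal (- real R) \<le> upper x}" for R :: nat
  have conv: "AE x in M. x \<in> E R \<longrightarrow> (\<lambda>n. ereal (g n x / real n)) \<longlonglongrightarrow> upper x" for R
  proof -
    have E: "E R \<in> events" "\<And>x. x \<in> space M \<Longrightarrow> T x \<in> E R \<longleftrightarrow> x \<in> E R"
      unfolding E_def using measurable_space[OF T_measurable] by (auto simp: upper_invariant)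
    define \<psi> where "\<psi> x = real_of_ereal (upper x) * indicator (E R) x" for x
    have fin: "ereal (\<psi> x) = upper x" "- real R \<le> \<psi> x" "\<psi> x \<le> K" if "x \<in> E R" for x
      using that upper_le[of x] by (cases "upper x"; auto simp: \<psi>_def E_def)+
    have psi: "integrable M \<psi>"
    proof (rule integrable_const_bound[where B = "real R + \<bar>K\<bar>"])
      show "AE x in M. norm (\<psi> x) \<le> real R + \<bar>K\<bar>"
      proof (rule AE_I2)
        fix x
        show "norm (\<psi> x) \<le> real R + \<bar>K\<bar>"
        proof (cases "x \<in> E R")
          case True
          then show ?thesis using fin(2,3)[OF True] unfolding real_norm_def by linarith
        qed (simp add: \<psi>_def)
      qed
      show "\<psi> \<in> borel_measurable M" unfolding \<psi>_def[abs_def] using E(1) by measurable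
    qed
    have "integrable M (\<lambda>x. g 1 x * indicator (E R) x)"
    proof (rule g_1_integrable_on[OF _ E psi])
      show "g 1 x \<le> K" if "x \<in> space M" for x using ub[of 1 x] that by simp
      show "\<psi> (T x) = \<psi> x" if "x \<in> space M" for x
        using upper_invariant[OF that] E(2)[OF that] by (simp add: \<psi>_def indicator_def)
      show "\<psi> x = 0" if "x \<notin> E R" for x using that by (simp add: \<psi>_def)
      show "AE x in M. x \<in> E R \<longrightarrow> ereal (\<psi> x) \<le> upper x" using fin by (intro AE_I2) simp
    qed
    note int = this
    interpret R: almost_additive_process M T "\<lambda>n x. g n x * indicator (E R) x" C
      by (rule process_restrict[OF E])
    obtain L where L: "(\<lambda>n. (\<integral>x. g n x * indicator (E R) x \<partial>M) / real n) \<longlonglongrightarrow> L"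
      using R.average_converges[OF int] .
    have ub': "g n x * indicator (E R) x \<le> \<bar>K\<bar> * real n" if "1 \<le> n" "x \<in> space M" for n x
    proof -
      have "K * real n \<le> \<bar>K\<bar> * real n" by (intro mult_right_mono) auto
      then show ?thesis using ub[OF that] by (auto simp: indicator_def)
    qed
    obtain u where u: "AE x in M. (\<lambda>n. ereal (g n x * indicator (E R) x / real n)) \<longlonglongrightarrow> ereal (u x)"
      using R.ergodic_integrable[OF int ub' L] by auto
    show ?thesis
      using u
    proof eventually_elim
      case (elim x)
      show ?case
      proof
        assume "x \<in> E R"
        then have "(\<lambda>n. ereal (g n x / real n)) \<longlonglongrightarrow> ereal (u x)" using elim by simp
        moreover from this have "upper x = ereal (u x)"
          unfolding upper_def by (intro lim_imp_Limsup) auto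
        ultimately show "(\<lambda>n. ereal (g n x / real n)) \<longlonglongrightarrow> upper x" by simp
      qed
    qed
  qed
  then have "AE x in M. \<forall>R. x \<in> E R \<longrightarrow> (\<lambda>n. ereal (g n x / real n)) \<longlonglongrightarrow> upper x"
    unfolding AE_all_countable by blast
  then show ?thesis
  proof (rule AE_mp, intro AE_I2 impI)
    fix x assume x: "x \<in> space M" "\<forall>R. x \<in> E R \<longrightarrow> (\<lambda>n. ereal (g n x / real n)) \<longlonglongrightarrow> upper x"
    show "(\<lambda>n. ereal (g n x / real n)) \<longlonglongrightarrow> upper x"
    proof (cases "upper x = - \<infinity>")
      case True
      have "liminf (\<lambda>n. ereal (g n x / real n)) \<le> upper x"
        unfolding upper_def by (rule Liminf_le_Limsup) simp
      then show ?thesis using True by (intro Liminf_eq_Limsup) (auto simp: upper_def)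
    next
      case False
      have "\<exists>R::nat. ereal (- real R) \<le> upper x"
      proof (cases "upper x")
        case (real r)
        obtain R :: nat where "- r < real R" using reals_Archimedean2 by blast
        then show ?thesis using real by (intro exI[of _ R]) simp
      qed (use False in auto)
      then show ?thesis using x by (auto simp: E_def)
    qed
  qed
qed

end

section \<open>Extended integrals and the equality of the two energies\<close>

lemma extended_integral_ereal:
  assumes "integrable M u"
  shows "extended_integral M (\<lambda>x. ereal (u x)) = ereal (\<integral>x. u x \<partial>M)"
proof -
  have fin: "(\<integral>\<^sup>+x. ennreal (u x) \<partial>M) \<noteq> \<infinity>" "(\<integral>\<^sup>+x. ennreal (- u x) \<partial>M) \<noteq> \<infinity>"
    using assms by (auto simp: real_integrable_def)
  have "(\<integral>x. u x \<partial>M) = enn2real (\<integral>\<^sup>+x. ennreal (u x) \<partial>M) - enn2real (\<integral>\<^sup>+x. ennreal (- u x) \<partial>M)"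
    by (rule real_lebesgue_integral_def[OF assms])
  then show ?thesis
    unfolding extended_integral_def using fin
    by (cases "\<integral>\<^sup>+x. ennreal (u x) \<partial>M"; cases "\<integral>\<^sup>+x. ennreal (- u x) \<partial>M") (auto simp: ennreal.abs_eq[symmetric])
qed

lemma extended_integral_cong_AE:
  assumes "AE x in M. u x = v x"
  shows "extended_integral M u = extended_integral M v"
proof -
  have "(\<integral>\<^sup>+x. e2ennreal (u x) \<partial>M) = (\<integral>\<^sup>+x. e2ennreal (v x) \<partial>M)"
    "(\<integral>\<^sup>+x. e2ennreal (- u x) \<partial>M) = (\<integral>\<^sup>+x. e2ennreal (- v x) \<partial>M)"
    by (intro nn_integral_cong_AE; use assms in eventually_elim; simp)+
  then show ?thesis by (simp add: extended_integral_def)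
qed

text \<open>The positive part has finite integral since \<open>u\<close> is bounded above on a
  probability space. Were the negative part finite too, \<open>u\<close> would be finite almost
  everywhere and integrable.\<close>

lemma (in prob_space) extended_integral_MInf:
  assumes meas[measurable]: "u \<in> borel_measurable M" and ub: "AE x in M. u x \<le> ereal K"
    and not_int: "\<not> ((AE x in M. u x \<noteq> - \<infinity>) \<and> integrable M (\<lambda>x. real_of_ereal (u x)))"
  shows "extended_integral M u = - \<infinity>"
proof -
  have "(\<integral>\<^sup>+x. e2ennreal (u x) \<partial>M) \<le> (\<integral>\<^sup>+x. ennreal \<bar>K\<bar> \<partial>M)"
  proof (rule nn_integral_mono_AE)
    show "AE x in M. e2ennreal (u x) \<le> ennreal \<bar>K\<bar>"
      using ub
    proof eventually_elim
      case (elim x)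
      then have "u x \<le> ereal \<bar>K\<bar>" by (rule order_trans) simp
      then have "e2ennreal (u x) \<le> e2ennreal (ereal \<bar>K\<bar>)" by (rule e2ennreal_mono)
      then show ?case by (simp add: ennreal.abs_eq[symmetric])
    qed
  qed
  then have pos: "(\<integral>\<^sup>+x. e2ennreal (u x) \<partial>M) \<noteq> \<infinity>"
    by (auto simp: emeasure_space_1 top_unique)
  have "(\<integral>\<^sup>+x. e2ennreal (- u x) \<partial>M) = \<infinity>"
  proof (rule ccontr)
    assume fin: "(\<integral>\<^sup>+x. e2ennreal (- u x) \<partial>M) \<noteq> \<infinity>"
    have "AE x in M. e2ennreal (- u x) \<noteq> \<infinity>"
      by (rule nn_integral_PInf_AE[OF _ fin]) measurable
    then have neq: "AE x in M. u x \<noteq> - \<infinity>"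
      by eventually_elim (auto simp: e2ennreal_infty)
    have eq: "AE x in M. u x = ereal (real_of_ereal (u x))"
      using neq ub
    proof eventually_elim
      case (elim x)
      then show ?case by (cases "u x") auto
    qed
    have "integrable M (\<lambda>x. real_of_ereal (u x))"
      unfolding real_integrable_def
    proof (intro conjI)
      have "(\<integral>\<^sup>+x. ennreal (real_of_ereal (u x)) \<partial>M) = (\<integral>\<^sup>+x. e2ennreal (u x) \<partial>M)"
      proof (rule nn_integral_cong_AE, use eq in eventually_elim)
        case (elim x)
        then show ?case by (cases "u x") auto
      qed
      then show "(\<integral>\<^sup>+x. ennreal (real_of_ereal (u x)) \<partial>M) \<noteq> \<infinity>" using pos by simp
      have "(\<integral>\<^sup>+x. ennreal (- real_of_ereal (u x)) \<partial>M) = (\<integral>\<^sup>+x. e2ennreal (- u x) \<partial>M)"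
      proof (rule nn_integral_cong_AE, use eq in eventually_elim)
        case (elim x)
        then show ?case by (cases "u x") auto
      qed
      then show "(\<integral>\<^sup>+x. ennreal (- real_of_ereal (u x)) \<partial>M) \<noteq> \<infinity>" using fin by simp
    qed measurable
    then show False using neq not_int by blast
  qed
  then show ?thesis unfolding extended_integral_def using pos
    by (cases "\<integral>\<^sup>+x. e2ennreal (u x) \<partial>M") auto
qed

context almost_additive_process
begin

context
  fixes K
  assumes ub: "\<And>n x. 1 \<le> n \<Longrightarrow> x \<in> space M \<Longrightarrow> g n x \<le> K * real n"
begin

lemma lim_AE_eq_upper: "AE x in M. lim (\<lambda>n. ereal (g n x / real n)) = upper x"
proof -
  have "AE x in M. (\<lambda>n. ereal (g n x / real n)) \<longlonglongrightarrow> upper x"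
    by (rule ergodic_AE_convergent) (rule ub)
  then show ?thesis by eventually_elim (rule limI)
qed

lemma extended_integrals_integrable:
  assumes int: "integrable M (g 1)" and L: "(\<lambda>n. (\<integral>x. g n x \<partial>M) / real n) \<longlonglongrightarrow> L"
  shows "extended_integral M (\<lambda>x. lim (\<lambda>n. ereal (g n x / real n))) = ereal L"
    and "lim (\<lambda>n. extended_integral M (\<lambda>x. ereal (g n x)) / ereal (real n)) = ereal L"
proof -
  obtain u where u: "integrable M u" "(\<integral>x. u x \<partial>M) = L"
      "AE x in M. (\<lambda>n. ereal (g n x / real n)) \<longlonglongrightarrow> ereal (u x)"
    using ergodic_integrable[OF int ub L] .
  have "AE x in M. lim (\<lambda>n. ereal (g n x / real n)) = ereal (u x)"
    using u(3) by eventually_elim (rule limI)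
  then show "extended_integral M (\<lambda>x. lim (\<lambda>n. ereal (g n x / real n))) = ereal L"
    using extended_integral_ereal[OF u(1)] u(2) by (simp add: extended_integral_cong_AE)
  have "(\<lambda>n. extended_integral M (\<lambda>x. ereal (g n x)) / ereal (real n)) \<longlonglongrightarrow> ereal L"
  proof (rule Lim_transform_eventually)
    show "(\<lambda>n. ereal ((\<integral>x. g n x \<partial>M) / real n)) \<longlonglongrightarrow> ereal L" using L by simp
    show "\<forall>\<^sub>F n in sequentially. ereal ((\<integral>x. g n x \<partial>M) / real n) =
        extended_integral M (\<lambda>x. ereal (g n x)) / ereal (real n)"
      unfolding eventually_sequentially
      by (intro exI[of _ 1]) (auto simp: extended_integral_ereal g_integrable[OF int])
  qed
  then show "lim (\<lambda>n. extended_integral M (\<lambda>x. ereal (g n x)) / ereal (real n)) = ereal L"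
    by (rule limI)
qed

text \<open>An integrable finite upper limit would make \<open>g 1\<close> integrable, by the
  converse above with \<open>E\<close> the whole space; so the integral of the limit is
  \<open>-\<infinity>\<close>. The integrals of all \<open>g n\<close> are
  \<open>-\<infinity>\<close> as well, hence so is their limit.\<close>

lemma extended_integrals_nonintegrable:
  assumes nint: "\<not> integrable M (g 1)"
  shows "extended_integral M (\<lambda>x. lim (\<lambda>n. ereal (g n x / real n))) = - \<infinity>"
    and "lim (\<lambda>n. extended_integral M (\<lambda>x. ereal (g n x)) / ereal (real n)) = - \<infinity>"
proof -
  have "extended_integral M upper = - \<infinity>"
  proof (rule extended_integral_MInf[OF upper_measurable])
    show "AE x in M. upper x \<le> ereal K"
    proof (rule AE_I2)
      fix x assume x: "x \<in> space M"
      have "g n x / real n \<le> K" if "1 \<le> n" for n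
        using ub[OF that x] that by (simp add: divide_le_eq)
      then show "upper x \<le> ereal K" unfolding upper_def
        by (intro Limsup_bounded) (auto simp: eventually_sequentially intro!: exI[of _ 1])
    qed
    note bd = this
    show "\<not> ((AE x in M. upper x \<noteq> - \<infinity>) \<and> integrable M (\<lambda>x. real_of_ereal (upper x)))"
    proof
      assume a: "(AE x in M. upper x \<noteq> - \<infinity>) \<and> integrable M (\<lambda>x. real_of_ereal (upper x))"
      have "integrable M (\<lambda>x. g 1 x * indicator (space M) x)"
      proof (rule g_1_integrable_on[where K = K and \<psi> = "\<lambda>x. real_of_ereal (upper x)"])
        show "g 1 x \<le> K" if "x \<in> space M" for x using ub[of 1 x] that by simp
        have "AE x in M. upper x \<noteq> - \<infinity>" using a by blast
        then show "AE x in M. x \<in> space M \<longrightarrow> ereal (real_of_ereal (upper x)) \<le> upper x"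
          using bd
        proof eventually_elim
          case (elim x)
          then show ?case by (cases "upper x") auto
        qed
      qed (use a upper_invariant measurable_space[OF T_measurable] in auto)
      moreover have "integrable M (\<lambda>x. g 1 x * indicator (space M) x) = integrable M (g 1)"
        by (rule Bochner_Integration.integrable_cong) auto
      ultimately show False using nint by simp
    qed
  qed
  then show "extended_integral M (\<lambda>x. lim (\<lambda>n. ereal (g n x / real n))) = - \<infinity>"
    using extended_integral_cong_AE[OF lim_AE_eq_upper] by simp
  have "extended_integral M (\<lambda>x. ereal (g n x)) = - \<infinity>" if n: "1 \<le> n" for n
  proof (rule extended_integral_MInf[where K = "K * real n"])
    have [measurable]: "g n \<in> borel_measurable M" using g_meas[OF n] .
    show "(\<lambda>x. ereal (g n x)) \<in> borel_measurable M" by measurable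
    show "AE x in M. ereal (g n x) \<le> ereal (K * real n)" using ub[OF n] by (intro AE_I2) simp
    have "\<not> integrable M (g n)"
    proof
      assume gn: "integrable M (g n)"
      \<comment> \<open>After splitting off the first time step, the rest of \<open>g n\<close> is
        bounded above, so \<open>g 1\<close> is at least \<open>g n\<close> up to a constant and
        inherits integrability from it.\<close>
      have lower: "g n x - (\<bar>K\<bar> * real n + C) \<le> g 1 x" if x: "x \<in> space M" for x
      proof (cases "n = 1")
        case False
        then have n': "1 \<le> n - 1" "1 + (n - 1) = n" using n by auto
        have "g n x \<le> g 1 x + g (n - 1) (T x) + C" using g_upper[of 1 "n - 1" x] n' x by simp
        moreover have "g (n - 1) (T x) \<le> K * real (n - 1)"
          using ub[OF n'(1)] measurable_space[OF T_measurable x] by simp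
        moreover have "K * real (n - 1) \<le> \<bar>K\<bar> * real n" by (intro mult_mono) auto
        ultimately show ?thesis by linarith
      next
        case True
        then show ?thesis using C_nonneg by simp
      qed
      have "integrable M (g 1)"
      proof (rule Bochner_Integration.integrable_bound)
        show "integrable M (\<lambda>x. \<bar>g n x\<bar> + \<bar>K\<bar> * real n + C)" using gn by simp
        show "g 1 \<in> borel_measurable M" by (rule g_meas) simp
        show "AE x in M. norm (g 1 x) \<le> norm (\<bar>g n x\<bar> + \<bar>K\<bar> * real n + C)"
        proof (rule AE_I2)
          fix x assume x: "x \<in> space M"
          have "\<bar>K\<bar> * 1 \<le> \<bar>K\<bar> * real n" using n by (intro mult_left_mono) auto
          then have "\<bar>g 1 x\<bar> \<le> \<bar>g n x\<bar> + \<bar>K\<bar> * real n + C"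
            using lower[OF x] ub[of 1 x] x C_nonneg by simp
          then show "norm (g 1 x) \<le> norm (\<bar>g n x\<bar> + \<bar>K\<bar> * real n + C)"
            unfolding real_norm_def by (rule order_trans[OF _ abs_ge_self])
        qed
      qed
      then show False using nint by simp
    qed
    then show "\<not> ((AE x in M. ereal (g n x) \<noteq> - \<infinity>) \<and> integrable M (\<lambda>x. real_of_ereal (ereal (g n x))))"
      by simp
  qed
  then have "(\<lambda>n. extended_integral M (\<lambda>x. ereal (g n x)) / ereal (real n)) \<longlonglongrightarrow> - \<infinity>"
    by (intro tendsto_eventually) (auto simp: eventually_sequentially intro!: exI[of _ 1])
  then show "lim (\<lambda>n. extended_integral M (\<lambda>x. ereal (g n x)) / ereal (real n)) = - \<infinity>"
    by (rule limI)
qed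

end

end

section \<open>The Borel structure of a countable Markov shift\<close>

lemma shift_pow: "(shift_map ^^ n) x = (\<lambda>i. x (i + n))"
  by (induction n) (auto simp: shift_map_def)

lemma shift_pow_mem: "x \<in> markov_shift S t \<Longrightarrow> (shift_map ^^ n) x \<in> markov_shift S t"
  by (auto simp: markov_shift_def shift_pow)

lemma shift_map_mem: "x \<in> markov_shift S t \<Longrightarrow> shift_map x \<in> markov_shift S t"
  by (auto simp: markov_shift_def shift_map_def)

definition coord :: "'a set \<Rightarrow> ('a \<Rightarrow> 'a \<Rightarrow> nat) \<Rightarrow> nat \<Rightarrow> 'a \<Rightarrow> (nat \<Rightarrow> 'a) set" where
  "coord S t i b = {x \<in> markov_shift S t. x i = b}"

lemma open_determined:
  assumes "openin (shift_topology S t) U"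
  shows "U \<subseteq> markov_shift S t \<and>
    (\<forall>x\<in>U. \<exists>n\<ge>1. \<forall>y\<in>markov_shift S t. (\<forall>i<n. y i = x i) \<longrightarrow> y \<in> U)"
proof -
  from assms have "generate_topology_on {cylinder S t w |w. w \<in> lists S \<and> w \<noteq> []} U"
    unfolding shift_topology_def by (rule openin_topology_generated_by)
  then show ?thesis
  proof induction
    case (Int a b)
    show ?case
    proof (intro conjI ballI)
      fix x assume x: "x \<in> a \<inter> b"
      with Int obtain n m where nm: "n \<ge> 1" "\<forall>y\<in>markov_shift S t. (\<forall>i<n. y i = x i) \<longrightarrow> y \<in> a"
        "m \<ge> 1" "\<forall>y\<in>markov_shift S t. (\<forall>i<m. y i = x i) \<longrightarrow> y \<in> b" by blast
      then show "\<exists>n\<ge>1. \<forall>y\<in>markov_shift S t. (\<forall>i<n. y i = x i) \<longrightarrow> y \<in> a \<inter> b"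
        by (intro exI[of _ "max n m"]) auto
    qed (use Int in blast)
  next
    case (UN K)
    show ?case
    proof (intro conjI ballI)
      fix x assume "x \<in> \<Union>K"
      then obtain k where k: "k \<in> K" "x \<in> k" by blast
      with UN.IH[OF k(1)] obtain n where n: "n \<ge> 1" "\<forall>y\<in>markov_shift S t. (\<forall>i<n. y i = x i) \<longrightarrow> y \<in> k" by blast
      show "\<exists>n\<ge>1. \<forall>y\<in>markov_shift S t. (\<forall>i<n. y i = x i) \<longrightarrow> y \<in> \<Union>K"
        using n k(1) by (intro exI[of _ n]) blast
    qed (use UN.IH in blast)
  next
    case (Basis s)
    then obtain w where w: "w \<in> lists S" "w \<noteq> []" "s = cylinder S t w" by blast
    show ?case
    proof (intro conjI ballI)
      fix x assume "x \<in> s"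
      then show "\<exists>n\<ge>1. \<forall>y\<in>markov_shift S t. (\<forall>i<n. y i = x i) \<longrightarrow> y \<in> s"
        using w by (intro exI[of _ "length w"]) (auto simp: cylinder_def Suc_le_eq)
    qed (auto simp: w(3) cylinder_def)
  qed simp
qed

lemma open_cylinder:
  "w \<in> lists S \<Longrightarrow> w \<noteq> [] \<Longrightarrow> openin (shift_topology S t) (cylinder S t w)"
  unfolding shift_topology_def by (rule topology_generated_by_Basis) auto

lemma cylinder_prefix_self:
  "x \<in> markov_shift S t \<Longrightarrow> x \<in> cylinder S t (map x [0..<n])"
  by (simp add: cylinder_def)

lemma prefix_lists: "x \<in> markov_shift S t \<Longrightarrow> map x [0..<n] \<in> lists S"
  by (auto simp: markov_shift_def)

lemma open_space: "openin (shift_topology S t) (markov_shift S t)"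
proof -
  have eq: "markov_shift S t = \<Union> {cylinder S t w |w. w \<in> lists S \<and> w \<noteq> []}"
  proof (intro equalityI subsetI)
    fix x assume x: "x \<in> markov_shift S t"
    have "x \<in> cylinder S t (map x [0..<1])" "map x [0..<1] \<in> lists S"
      using x by (rule cylinder_prefix_self, rule prefix_lists)
    then show "x \<in> \<Union> {cylinder S t w |w. w \<in> lists S \<and> w \<noteq> []}"
      by (intro UnionI[of "cylinder S t (map x [0..<1])"] CollectI exI[of _ "map x [0..<1]"] conjI) auto
  qed (auto simp: cylinder_def)
  show ?thesis
    by (subst eq) (auto intro!: openin_Union open_cylinder)
qed

lemma topspace_shift: "topspace (shift_topology S t) = markov_shift S t"
  using openin_subset[OF open_space] open_determined[OF openin_topspace] by blast

lemma sets_shift_borel: "sets (shift_borel S t) = sigma_sets (markov_shift S t) {U. openin (shift_topology S t) U}"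
  and space_shift_borel: "space (shift_borel S t) = markov_shift S t"
  unfolding shift_borel_def using open_determined by (auto intro!: sets_measure_of space_measure_of)

lemma open_coord: "openin (shift_topology S t) (coord S t i b)"
proof -
  have eq: "coord S t i b = \<Union> {cylinder S t w |w. w \<in> lists S \<and> length w = Suc i \<and> w ! i = b}"
  proof (intro equalityI subsetI)
    fix x assume x: "x \<in> coord S t i b"
    then have xm: "x \<in> markov_shift S t" "x i = b" by (auto simp: coord_def)
    have "x \<in> cylinder S t (map x [0..<Suc i])" "map x [0..<Suc i] \<in> lists S"
      using xm(1) by (rule cylinder_prefix_self, rule prefix_lists)
    moreover have "length (map x [0..<Suc i]) = Suc i" "map x [0..<Suc i] ! i = b"
      using xm by (simp_all add: nth_append)
    ultimately show "x \<in> \<Union> {cylinder S t w |w. w \<in> lists S \<and> length w = Suc i \<and> w ! i = b}" by blast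
  qed (auto simp: cylinder_def coord_def)
  show ?thesis by (subst eq) (auto intro!: openin_Union open_cylinder)
qed

text \<open>A cylinder is a finite intersection of coordinate sets, and every open set is a union of
  cylinders, a countable one because there are countably many words. Measurability can therefore be
  tested one coordinate at a time.\<close>

lemma sets_shift_borel_coord:
  assumes S: "countable S"
  shows "sets (shift_borel S t) = sigma_sets (markov_shift S t) (range (\<lambda>(i, b). coord S t i b))"
    (is "_ = sigma_sets ?X ?C")
  unfolding sets_shift_borel
proof (rule sigma_sets_eqI)
  fix U assume "U \<in> {U. openin (shift_topology S t) U}"
  then have U: "openin (shift_topology S t) U" by simp
  have C: "?C \<subseteq> Pow ?X" by (auto simp: coord_def)
  have cyl: "cylinder S t w \<in> sigma_sets ?X ?C" if "w \<noteq> []" for w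
  proof -
    have "cylinder S t w = (\<Inter>j\<in>{..<length w}. coord S t j (w ! j))"
      using that by (auto simp: cylinder_def coord_def)
    moreover interpret sigma_algebra ?X "sigma_sets ?X ?C" by (rule sigma_algebra_sigma_sets[OF C])
    have "(\<Inter>j\<in>{..<length w}. coord S t j (w ! j)) \<in> sigma_sets ?X ?C"
      using that by (intro finite_INT) auto
    ultimately show ?thesis by simp
  qed
  define W where "W = {w \<in> lists S. w \<noteq> [] \<and> cylinder S t w \<subseteq> U}"
  have "countable W" unfolding W_def by (rule countable_subset[of _ "lists S"]) (use S in auto)
  have "U = (\<Union>w\<in>W. cylinder S t w)"
  proof (intro equalityI subsetI)
    fix x assume x: "x \<in> U"
    with open_determined[OF U] obtain n where n: "n \<ge> 1" "\<forall>y\<in>?X. (\<forall>i<n. y i = x i) \<longrightarrow> y \<in> U" "x \<in> ?X" by blast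
    have "map x [0..<n] \<in> W" unfolding W_def
      using n prefix_lists[OF n(3), of n] by (auto simp: cylinder_def)
    then show "x \<in> (\<Union>w\<in>W. cylinder S t w)" using cylinder_prefix_self[OF n(3), of n] by blast
  qed (auto simp: W_def)
  moreover interpret sigma_algebra ?X "sigma_sets ?X ?C" by (rule sigma_algebra_sigma_sets[OF C])
  have "(\<Union>w\<in>W. cylinder S t w) \<in> sigma_sets ?X ?C"
    by (rule countable_UN'[OF \<open>countable W\<close>]) (auto simp: W_def cyl)
  ultimately show "U \<in> sigma_sets ?X ?C" by simp
next
  fix U assume "U \<in> ?C"
  then show "U \<in> sigma_sets ?X {U. openin (shift_topology S t) U}" using open_coord by fastforce
qed

lemma coord_sets: "coord S t i b \<in> sets (shift_borel S t)"
  unfolding sets_shift_borel using open_coord by (intro sigma_sets.Basic) simp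

lemma measurable_to_shift_borel:
  assumes S: "countable S"
    and h: "\<And>x. x \<in> space N \<Longrightarrow> h x \<in> markov_shift S t"
    and c: "\<And>i b. {x \<in> space N. h x i = b} \<in> sets N"
  shows "h \<in> measurable N (shift_borel S t)"
proof (rule measurable_sigma_sets[OF sets_shift_borel_coord[OF S]])
  fix y assume "y \<in> range (\<lambda>(i, b). coord S t i b)"
  then obtain i b where y: "y = coord S t i b" by auto
  have "h -` y \<inter> space N = {x \<in> space N. h x i = b}" using h by (auto simp: y coord_def)
  then show "h -` y \<inter> space N \<in> sets N" using c by simp
qed (use h in \<open>auto simp: coord_def\<close>)

lemma shift_measurable:
  assumes "countable S"
  shows "shift_map \<in> measurable (shift_borel S t) (shift_borel S t)"
proof (rule measurable_to_shift_borel[OF assms])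
  fix i b
  have "{x \<in> space (shift_borel S t). shift_map x i = b} = coord S t (Suc i) b"
    by (auto simp: space_shift_borel coord_def shift_map_def)
  then show "{x \<in> space (shift_borel S t). shift_map x i = b} \<in> sets (shift_borel S t)"
    using coord_sets by simp
qed (auto simp: space_shift_borel shift_map_mem)

lemma continuous_imp_measurable:
  assumes "continuous_map (shift_topology S t) euclideanreal u"
  shows "u \<in> borel_measurable (shift_borel S t)"
proof (rule borel_measurableI)
  fix A :: "real set" assume "open A"
  then have "openin (shift_topology S t) {x \<in> topspace (shift_topology S t). u x \<in> A}"
    using assms by (intro openin_continuous_map_preimage) auto
  moreover have "{x \<in> topspace (shift_topology S t). u x \<in> A} = u -` A \<inter> space (shift_borel S t)"
    by (auto simp: topspace_shift space_shift_borel)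
  ultimately show "u -` A \<inter> space (shift_borel S t) \<in> sets (shift_borel S t)"
    unfolding sets_shift_borel by (auto intro: sigma_sets.Basic)
qed

text \<open>Within the shift space such a set is a union of cylinders of length \<open>N\<close>,
  possibly infinitely many.\<close>

definition determined :: "'a set \<Rightarrow> ('a \<Rightarrow> 'a \<Rightarrow> nat) \<Rightarrow> nat \<Rightarrow> (nat \<Rightarrow> 'a) set \<Rightarrow> bool" where
  "determined S t N D \<longleftrightarrow>
    (\<forall>x\<in>markov_shift S t. \<forall>y\<in>markov_shift S t. (\<forall>i<N. x i = y i) \<longrightarrow> (x \<in> D \<longleftrightarrow> y \<in> D))"

lemma determined_mono: "determined S t N D \<Longrightarrow> N \<le> N' \<Longrightarrow> determined S t N' D"
  unfolding determined_def by (meson order_less_le_trans)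

text \<open>Induction over the generated sigma-algebra. Complements leave the symmetric difference
  unchanged; a countable union is first cut to finitely many sets, whose approximations then share
  the longest of finitely many windows.\<close>

lemma approximate_by_determined:
  assumes S: "countable S" and fin: "finite_measure \<mu>" and sets: "sets \<mu> = sets (shift_borel S t)"
    and A: "A \<in> sets \<mu>" and e: "0 < e"
  shows "\<exists>N D. D \<in> sets \<mu> \<and> determined S t N D \<and> measure \<mu> (sym_diff A D) < e"
proof -
  interpret finite_measure \<mu> by fact
  let ?X = "markov_shift S t"
  have space: "space \<mu> = ?X" using sets_eq_imp_space_eq[OF sets] by (simp add: space_shift_borel)
  from A have "A \<in> sigma_sets ?X (range (\<lambda>(i, b). coord S t i b))"
    unfolding sets sets_shift_borel_coord[OF S] .
  then show ?thesis using e
  proof (induction arbitrary: e)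
    case (Basic a)
    then obtain i b where a: "a = coord S t i b" by auto
    have "determined S t (Suc i) a" unfolding a determined_def by (auto simp: coord_def)
    then show ?case using Basic coord_sets[of S t i b] a sets by (intro exI[of _ "Suc i"] exI[of _ a]) auto
  next
    case Empty
    show ?case by (intro exI[of _ 0] exI[of _ "{}"]) (auto simp: determined_def Empty)
  next
    case (Compl a)
    from Compl.IH[OF Compl.prems] obtain N D where D: "D \<in> sets \<mu>" "determined S t N D" "measure \<mu> (sym_diff a D) < e" by blast
    have "a \<in> sets \<mu>" unfolding sets sets_shift_borel_coord[OF S] by (rule Compl.hyps)
    then have "a \<subseteq> ?X" "D \<subseteq> ?X" using D(1) sets.sets_into_space space by blast+
    then have "sym_diff (?X - a) (?X - D) = sym_diff a D" by blast
    moreover have "determined S t N (?X - D)" using D(2) unfolding determined_def by blast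
    moreover have "?X - D \<in> sets \<mu>" using D(1) sets.compl_sets[of D \<mu>] by (simp add: space)
    ultimately show ?case using D(3) by (intro exI[of _ N] exI[of _ "?X - D"]) auto
  next
    case (Union a)
    have a: "a i \<in> sets \<mu>" for i unfolding sets sets_shift_borel_coord[OF S] by (rule Union.hyps)
    define B where "B n = (\<Union>i<n. a i)" for n
    have B: "B n \<in> sets \<mu>" for n unfolding B_def using a by (intro sets.finite_UN) auto
    have UB: "(\<Union>n. B n) = (\<Union>i. a i)" unfolding B_def by blast
    have "incseq B" unfolding incseq_def B_def by (intro allI impI UN_mono) auto
    then have "(\<lambda>n. measure \<mu> (B n)) \<longlonglongrightarrow> measure \<mu> (\<Union>n. B n)"
      using B by (intro finite_Lim_measure_incseq) auto
    moreover have "measure \<mu> (\<Union>n. B n) - e / 2 < measure \<mu> (\<Union>n. B n)" using Union.prems by simp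
    ultimately have "\<forall>\<^sub>F n in sequentially. measure \<mu> (\<Union>n. B n) - e / 2 < measure \<mu> (B n)"
      by (rule order_tendstoD(1))
    then obtain n where "measure \<mu> (\<Union>n. B n) - e / 2 < measure \<mu> (B n)"
      by (auto simp: eventually_sequentially)
    then have n: "measure \<mu> (\<Union>i. a i) - measure \<mu> (B n) < e / 2" unfolding UB by simp
    \<comment> \<open>Half of \<open>e\<close> pays for the tail of the union, the other half is
      shared by \<open>n\<close> approximations; adding 1 covers \<open>n = 0\<close> and keeps the
      bound strict.\<close>
    define e' where "e' = e / (2 * (real n + 1))"
    have e': "0 < e'" unfolding e'_def using Union.prems by simp
    have ne': "real n * e' < e / 2" unfolding e'_def using Union.prems by (simp add: field_simps)
    have "\<forall>i. \<exists>N D. D \<in> sets \<mu> \<and> determined S t N D \<and> measure \<mu> (sym_diff (a i) D) < e'"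
      using Union.IH[OF e'] by blast
    then obtain N D where ND: "\<And>i. D i \<in> sets \<mu>" "\<And>i. determined S t (N i) (D i)"
      "\<And>i. measure \<mu> (sym_diff (a i) (D i)) < e'" by metis
    define N' where "N' = Max (insert 0 (N ` {..<n}))"
    define D' where "D' = (\<Union>i<n. D i)"
    have "N i \<le> N'" if "i < n" for i unfolding N'_def using that by (intro Max_ge) auto
    then have det: "determined S t N' (D i)" if "i < n" for i using determined_mono[OF ND(2)] that by blast
    have "determined S t N' D'"
      unfolding determined_def
    proof (intro ballI impI)
      fix x y assume "x \<in> ?X" "y \<in> ?X" "\<forall>i<N'. x i = y i"
      then have "x \<in> D i \<longleftrightarrow> y \<in> D i" if "i < n" for i using det[OF that] unfolding determined_def by blast
      then show "x \<in> D' \<longleftrightarrow> y \<in> D'" unfolding D'_def by blast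
    qed
    moreover have D': "D' \<in> sets \<mu>" unfolding D'_def using ND(1) by (intro sets.finite_UN) auto
    moreover have "measure \<mu> (sym_diff (\<Union>i. a i) D') < e"
    proof -
      have Ua: "(\<Union>i. a i) \<in> sets \<mu>" using a by auto
      have sub: "sym_diff (\<Union>i. a i) D' \<subseteq> ((\<Union>i. a i) - B n) \<union> (\<Union>i<n. sym_diff (a i) (D i))"
        unfolding D'_def B_def by blast
      have s: "sym_diff (a i) (D i) \<in> sets \<mu>" for i using a ND(1) by auto
      have "measure \<mu> (sym_diff (\<Union>i. a i) D') \<le> measure \<mu> (((\<Union>i. a i) - B n) \<union> (\<Union>i<n. sym_diff (a i) (D i)))"
        by (rule finite_measure_mono[OF sub]) (use Ua B s in \<open>auto intro!: sets.finite_UN\<close>)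
      also have "\<dots> \<le> measure \<mu> ((\<Union>i. a i) - B n) + measure \<mu> (\<Union>i<n. sym_diff (a i) (D i))"
        by (rule measure_Un_le) (use Ua B s in \<open>auto intro!: sets.finite_UN\<close>)
      also have "measure \<mu> ((\<Union>i. a i) - B n) = measure \<mu> (\<Union>i. a i) - measure \<mu> (B n)"
        by (rule finite_measure_Diff[OF Ua B]) (auto simp: B_def)
      also have "measure \<mu> (\<Union>i<n. sym_diff (a i) (D i)) \<le> (\<Sum>i<n. measure \<mu> (sym_diff (a i) (D i)))"
        by (rule measure_UNION_le) (use s in auto)
      also have "\<dots> \<le> (\<Sum>i<n. e')" using ND(3) by (intro sum_mono) (simp add: less_imp_le)
      also have "\<dots> = real n * e'" by simp
      finally show ?thesis using n ne' by linarith
    qed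
    ultimately show ?case by blast
  qed
qed

section \<open>Almost additive Bowen sequences\<close>

text \<open>The hypotheses in logarithmic form with the constants fixed: \<open>C\<close> for almost
  additivity, \<open>V\<close> for the logarithm of the variation, \<open>K\<close> for the upper
  bound of \<open>ln (f 1)\<close>. All are taken nonnegative so that errors only
  accumulate.\<close>

locale bowen_potential =
  fixes S :: "'a set" and t :: "'a \<Rightarrow> 'a \<Rightarrow> nat" and f :: "nat \<Rightarrow> (nat \<Rightarrow> 'a) \<Rightarrow> real"
    and C V K :: real
  assumes countable_S: "countable S"
    and mixing: "topologically_mixing S t"
    and f_cont: "\<And>n. 1 \<le> n \<Longrightarrow> continuous_map (shift_topology S t) euclideanreal (f n)"
    and f_pos: "\<And>n x. 1 \<le> n \<Longrightarrow> x \<in> markov_shift S t \<Longrightarrow> 0 < f n x"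
    and C_nonneg: "0 \<le> C"
    and f_lower: "\<And>n m x. 1 \<le> n \<Longrightarrow> 1 \<le> m \<Longrightarrow> x \<in> markov_shift S t \<Longrightarrow>
        ln (f n x) + ln (f m ((shift_map ^^ n) x)) - C \<le> ln (f (n + m) x)"
    and f_upper: "\<And>n m x. 1 \<le> n \<Longrightarrow> 1 \<le> m \<Longrightarrow> x \<in> markov_shift S t \<Longrightarrow>
        ln (f (n + m) x) \<le> ln (f n x) + ln (f m ((shift_map ^^ n) x)) + C"
    and V_nonneg: "0 \<le> V"
    and bowen: "\<And>n x y. 1 \<le> n \<Longrightarrow> x \<in> markov_shift S t \<Longrightarrow> y \<in> markov_shift S t \<Longrightarrow>
        (\<And>i. i < n \<Longrightarrow> x i = y i) \<Longrightarrow> ln (f n x) \<le> ln (f n y) + V"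
    and K_nonneg: "0 \<le> K"
    and f_ub: "\<And>x. x \<in> markov_shift S t \<Longrightarrow> ln (f 1 x) \<le> K"
begin

abbreviation "X \<equiv> markov_shift S t"
abbreviation "per a n \<equiv> {x \<in> X. (shift_map ^^ n) x = x \<and> x 0 = a}"

lemma f_ub_n: "1 \<le> n \<Longrightarrow> x \<in> X \<Longrightarrow> ln (f n x) \<le> (K + C) * real n"
proof (induction n arbitrary: x rule: dec_induct)
  case base
  then show ?case using f_ub[of x] C_nonneg by simp
next
  case (step n)
  have "ln (f (n + 1) x) \<le> ln (f n x) + ln (f 1 ((shift_map ^^ n) x)) + C"
    using step by (intro f_upper) auto
  moreover have "ln (f 1 ((shift_map ^^ n) x)) \<le> K" by (rule f_ub[OF shift_pow_mem[OF step.prems]])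
  moreover have "ln (f n x) \<le> (K + C) * real n" by (rule step.IH[OF step.prems])
  moreover have "(K + C) * real (Suc n) = (K + C) * real n + K + C" by (simp add: algebra_simps)
  ultimately show ?case by simp
qed

lemma invariant_process:
  assumes "\<mu> \<in> invariant_measures S t"
  shows "almost_additive_process \<mu> shift_map (\<lambda>n x. ln (f n x)) C"
    and "space \<mu> = X" and "sets \<mu> = sets (shift_borel S t)"
proof -
  from assms have sets: "sets \<mu> = sets (shift_borel S t)" and p: "prob_space \<mu>"
    and inv: "\<And>A. A \<in> sets \<mu> \<Longrightarrow> emeasure \<mu> (shift_map -` A \<inter> space \<mu>) = emeasure \<mu> A"
    by (auto simp: invariant_measures_def)
  then show "sets \<mu> = sets (shift_borel S t)" by simp
  show space: "space \<mu> = X" using sets_eq_imp_space_eq[OF sets] by (simp add: space_shift_borel)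
  interpret prob_space \<mu> by (rule p)
  show "almost_additive_process \<mu> shift_map (\<lambda>n x. ln (f n x)) C"
  proof
    show "shift_map \<in> measurable \<mu> \<mu>"
      using shift_measurable[OF countable_S, of t] by (simp add: measurable_cong_sets[OF sets sets])
    fix n assume n: "(1::nat) \<le> n"
    have "f n \<in> borel_measurable \<mu>"
      using continuous_imp_measurable[OF f_cont[OF n]] by (simp add: measurable_cong_sets[OF sets refl])
    then show "(\<lambda>x. ln (f n x)) \<in> borel_measurable \<mu>" by measurable
  qed (use inv C_nonneg f_lower f_upper space in auto)
qed

lemma partition_function_eq_SUP:
  "partition_function S t f a n = (SUP Y\<in>{Y. finite Y \<and> Y \<subseteq> per a n}. \<Sum>x\<in>Y. ennreal (f n x))"
proof -
  let ?P = "{x \<in> X. (shift_map ^^ n) x = x}"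
  let ?h = "\<lambda>x. ennreal (f n x) * indicator (cylinder S t [a]) x"
  have ind: "x \<in> cylinder S t [a] \<longleftrightarrow> x \<in> X \<and> x 0 = a" for x by (auto simp: cylinder_def)
  have "partition_function S t f a n = (SUP Y\<in>{Y. finite Y \<and> Y \<subseteq> ?P}. sum ?h Y)"
    unfolding partition_function_def by (rule nonneg_infsum_complete) simp
  also have "\<dots> = (SUP Y\<in>{Y. finite Y \<and> Y \<subseteq> per a n}. \<Sum>x\<in>Y. ennreal (f n x))"
  proof (rule SUP_eq)
    fix Y assume Y: "Y \<in> {Y. finite Y \<and> Y \<subseteq> ?P}"
    have "sum ?h Y = (\<Sum>x\<in>Y \<inter> per a n. ?h x)"
      using Y by (intro sum.mono_neutral_right) (auto simp: ind indicator_def)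
    also have "\<dots> = (\<Sum>x\<in>Y \<inter> per a n. ennreal (f n x))"
      by (rule sum.cong) (auto simp: ind)
    finally show "\<exists>Y'\<in>{Y. finite Y \<and> Y \<subseteq> per a n}. sum ?h Y \<le> (\<Sum>x\<in>Y'. ennreal (f n x))"
      using Y by (intro bexI[of _ "Y \<inter> per a n"]) auto
  next
    fix Y assume Y: "Y \<in> {Y. finite Y \<and> Y \<subseteq> per a n}"
    have "(\<Sum>x\<in>Y. ennreal (f n x)) = sum ?h Y"
    proof (rule sum.cong[OF refl])
      fix x assume "x \<in> Y"
      then have "x \<in> per a n" using Y by blast
      then show "ennreal (f n x) = ?h x" by (simp add: ind)
    qed
    then show "\<exists>Y'\<in>{Y. finite Y \<and> Y \<subseteq> ?P}. (\<Sum>x\<in>Y. ennreal (f n x)) \<le> sum ?h Y'"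
      using Y by (intro bexI[of _ Y]) auto
  qed
  finally show ?thesis .
qed

text \<open>The infinite sum enters both bounds only through its finite subsums: the upper bound
  needs all of them to be small, the lower bound one that is large.\<close>

lemma partition_function_le_iff:
  assumes "1 \<le> n" "0 \<le> c"
  shows "partition_function S t f a n \<le> ennreal c \<longleftrightarrow>
    (\<forall>Y. finite Y \<longrightarrow> Y \<subseteq> per a n \<longrightarrow> (\<Sum>x\<in>Y. f n x) \<le> c)"
proof -
  have "(\<Sum>x\<in>Y. ennreal (f n x)) = ennreal (\<Sum>x\<in>Y. f n x)" if "Y \<subseteq> per a n" for Y
    using that f_pos[OF assms(1)] by (intro sum_ennreal) (auto intro: less_imp_le)
  then show ?thesis
    unfolding partition_function_eq_SUP SUP_le_iff using assms(2) by (auto simp: ennreal_le_iff)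
qed

end

section \<open>Gluing\<close>

text \<open>The periodic point of period \<open>k + n + k\<close> that reads \<open>k\<close>
  letters of \<open>p\<close>, then \<open>n\<close> letters of \<open>x\<close>, then
  \<open>k\<close> letters of \<open>z\<close>.\<close>

definition glue :: "(nat \<Rightarrow> 'a) \<Rightarrow> (nat \<Rightarrow> 'a) \<Rightarrow> (nat \<Rightarrow> 'a) \<Rightarrow> nat \<Rightarrow> nat \<Rightarrow> nat \<Rightarrow> 'a" where
  "glue p x z k n i =
     (let j = i mod (k + n + k) in if j < k then p j else if j < k + n then x (j - k) else z (j - k - n))"

lemma glue_coords:
  assumes "1 \<le> k" and "x n = z 0"
  shows "i < k \<Longrightarrow> glue p x z k n i = p i"
    and "j \<le> n \<Longrightarrow> glue p x z k n (k + j) = x j"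
    and "i < k \<Longrightarrow> glue p x z k n (k + n + i) = z i"
  using assms by (auto simp: glue_def Let_def)

lemma glue_periodic: "(shift_map ^^ (k + n + k)) (glue p x z k n) = glue p x z k n"
  by (auto simp: shift_pow glue_def)

text \<open>Each word starts with the letter that its predecessor would show next, cyclically. A
  transition across a seam is therefore one already present in the word to the left of the
  seam.\<close>

lemma glue_mem:
  assumes X: "p \<in> markov_shift S t" "x \<in> markov_shift S t" "z \<in> markov_shift S t"
    and k: "1 \<le> k" and n: "1 \<le> n" and eq: "p k = x 0" "x n = z 0" "z k = p 0"
  shows "glue p x z k n \<in> markov_shift S t"
proof -
  define u where "u j = (if j < k then p j else if j < k + n then x (j - k) else z (j - k - n))" for j
  have y: "glue p x z k n i = u (i mod (k + n + k))" for i by (simp add: glue_def u_def Let_def)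
  have mem: "u j \<in> S" for j using X by (auto simp: u_def markov_shift_def)
  have u0: "u (k + n + k) = u 0" using eq k by (simp add: u_def)
  have tr: "t (u r) (u (Suc r)) = 1" for r
  proof -
    have T: "t (p i) (p (Suc i)) = 1" "t (x i) (x (Suc i)) = 1" "t (z i) (z (Suc i)) = 1" for i
      using X by (auto simp: markov_shift_def)
    consider "Suc r < k" | "Suc r = k" | "k \<le> r" "Suc r < k + n" | "k \<le> r" "Suc r = k + n" | "k + n \<le> r" by linarith
    then show ?thesis
    proof cases
      case 1 then show ?thesis using T(1)[of r] by (simp add: u_def)
    next
      case 2 then show ?thesis using T(1)[of r] eq n by (auto simp: u_def)
    next
      case 3 then show ?thesis using T(2)[of "r - k"] by (simp add: u_def Suc_diff_le)
    next
      case 4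
      then have "Suc (r - k) = n" by simp
      then show ?thesis using T(2)[of "r - k"] 4 eq by (simp add: u_def)
    next
      case 5
      then have "Suc (r - k - n) = Suc r - k - n" by simp
      then show ?thesis using T(3)[of "r - k - n"] 5 by (simp add: u_def)
    qed
  qed
  have "t (glue p x z k n i) (glue p x z k n (Suc i)) = 1" for i
    unfolding y by (metis mod_Suc tr u0)
  then show ?thesis using mem unfolding markov_shift_def y by auto
qed

lemma has_sum_finite_sum:
  fixes h :: "'i \<Rightarrow> 'b \<Rightarrow> real"
  assumes "finite I" "\<And>i. i \<in> I \<Longrightarrow> (h i has_sum a i) A"
  shows "((\<lambda>x. \<Sum>i\<in>I. h i x) has_sum (\<Sum>i\<in>I. a i)) A"
  using assms
proof (induction I rule: finite_induct)
  case (insert i I)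
  then have "((\<lambda>x. h i x + (\<Sum>i\<in>I. h i x)) has_sum (a i + (\<Sum>i\<in>I. a i))) A"
    by (intro has_sum_add) auto
  then show ?case using insert by simp
qed simp

context bowen_potential
begin

text \<open>Mixing gives a threshold for every pair of letters; finiteness of \<open>F\<close> makes
  one length \<open>k\<close> work for all paths from \<open>a\<close> to \<open>F\<close> and
  back.\<close>

lemma connecting_words:
  assumes F: "finite F" "F \<subseteq> S" and a: "a \<in> S"
  obtains k p z where "1 \<le> k"
    and "\<And>b. b \<in> F \<Longrightarrow> p b \<in> X \<and> p b 0 = a \<and> p b k = b"
    and "\<And>b. b \<in> F \<Longrightarrow> z b \<in> X \<and> z b 0 = b \<and> z b k = a"
proof -
  have conn: "\<forall>\<^sub>F n in sequentially. \<exists>x\<in>X. x 0 = b \<and> x n = c" if "b \<in> S" "c \<in> S" for b c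
  proof -
    from mixing[unfolded topologically_mixing_def, rule_format, OF that]
    obtain N where N: "\<forall>n>N. cylinder S t [b] \<inter> (shift_map ^^ n) -` cylinder S t [c] \<noteq> {}"
      by (rule exE)
    have "\<exists>x\<in>X. x 0 = b \<and> x n = c" if "Suc N \<le> n" for n
    proof -
      have "cylinder S t [b] \<inter> (shift_map ^^ n) -` cylinder S t [c] \<noteq> {}" using N that by simp
      then obtain x where "x \<in> cylinder S t [b] \<inter> (shift_map ^^ n) -` cylinder S t [c]" by (meson ex_in_conv)
      then show ?thesis by (intro bexI[of _ x]) (auto simp: cylinder_def shift_pow)
    qed
    then show ?thesis by (auto simp: eventually_sequentially)
  qed
  have "\<forall>\<^sub>F n in sequentially. \<forall>b\<in>F. \<exists>x\<in>X. x 0 = a \<and> x n = b"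
    using F a by (intro eventually_ball_finite ballI conn) auto
  moreover have "\<forall>\<^sub>F n in sequentially. \<forall>b\<in>F. \<exists>x\<in>X. x 0 = b \<and> x n = a"
    using F a by (intro eventually_ball_finite ballI conn) auto
  ultimately have "\<forall>\<^sub>F n in sequentially. 1 \<le> n \<and> (\<forall>b\<in>F. \<exists>x\<in>X. x 0 = a \<and> x n = b) \<and> (\<forall>b\<in>F. \<exists>x\<in>X. x 0 = b \<and> x n = a)"
    using eventually_ge_at_top[of 1] by eventually_elim auto
  then obtain k where "\<forall>n\<ge>k. 1 \<le> n \<and> (\<forall>b\<in>F. \<exists>x\<in>X. x 0 = a \<and> x n = b) \<and> (\<forall>b\<in>F. \<exists>x\<in>X. x 0 = b \<and> x n = a)"
    unfolding eventually_sequentially by (rule exE)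
  from spec[OF this, of k] have k: "1 \<le> k" "\<forall>b\<in>F. \<exists>x. x \<in> X \<and> x 0 = a \<and> x k = b"
    "\<forall>b\<in>F. \<exists>x. x \<in> X \<and> x 0 = b \<and> x k = a" by auto
  from bchoice[OF k(2)] obtain p where p: "\<forall>b\<in>F. p b \<in> X \<and> p b 0 = a \<and> p b k = b" by (rule exE)
  from bchoice[OF k(3)] obtain z where z: "\<forall>b\<in>F. z b \<in> X \<and> z b 0 = b \<and> z b k = a" by (rule exE)
  show ?thesis using that[OF k(1), of p z] p z by blast
qed

lemma letters_sets:
  assumes "countable F"
  shows "{x \<in> X. x i \<in> F} \<in> sets (shift_borel S t)"
proof -
  have "{x \<in> X. x i \<in> F} = (\<Union>b\<in>F. coord S t i b)" by (auto simp: coord_def)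
  moreover have "(\<Union>b\<in>F. coord S t i b) \<in> sets (shift_borel S t)"
    by (rule sets.countable_UN'[OF assms]) (auto simp: coord_sets)
  ultimately show ?thesis by simp
qed

text \<open>Exhaust the countable alphabet by finite sets: the events that the first letter is
  outside decrease to the empty set.\<close>

lemma finite_letters:
  assumes mu: "\<mu> \<in> invariant_measures S t" and e: "0 < e"
  obtains F where "finite F" "F \<subseteq> S" "measure \<mu> {x \<in> X. x 0 \<notin> F} < e"
proof -
  interpret pr: almost_additive_process \<mu> shift_map "\<lambda>n x. ln (f n x)" C by (rule invariant_process(1)[OF mu])
  note space = invariant_process(2)[OF mu] and sets = invariant_process(3)[OF mu]
  define G where "G n = from_nat_into S ` {..<n}" for n
  obtain x0 where "x0 \<in> X" using pr.not_empty space by auto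
  then have ne: "S \<noteq> {}" by (auto simp: markov_shift_def)
  have range: "range (from_nat_into S) = S" by (rule range_from_nat_into[OF ne countable_S])
  have A: "{x \<in> X. x 0 \<notin> G n} \<in> sets \<mu>" for n
  proof -
    have "X - {x \<in> X. x 0 \<in> G n} \<in> sets \<mu>"
      using letters_sets[of "G n" 0] sets.compl_sets[of "{x \<in> X. x 0 \<in> G n}" \<mu>] by (simp add: sets space G_def)
    moreover have "X - {x \<in> X. x 0 \<in> G n} = {x \<in> X. x 0 \<notin> G n}" by auto
    ultimately show ?thesis by simp
  qed
  have "(\<lambda>n. measure \<mu> {x \<in> X. x 0 \<notin> G n}) \<longlonglongrightarrow> measure \<mu> (\<Inter>n. {x \<in> X. x 0 \<notin> G n})"
  proof (rule pr.finite_Lim_measure_decseq)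
    have "G m \<subseteq> G n" if "m \<le> n" for m n unfolding G_def using that by (intro image_mono) auto
    then show "decseq (\<lambda>n. {x \<in> X. x 0 \<notin> G n})" unfolding decseq_def by blast
  qed (use A in auto)
  moreover have "(\<Inter>n. {x \<in> X. x 0 \<notin> G n}) = {}"
  proof -
    have "\<exists>n. x 0 \<in> G n" if "x \<in> X" for x
    proof -
      have "x 0 \<in> range (from_nat_into S)" using that unfolding range by (simp add: markov_shift_def)
      then obtain i where "x 0 = from_nat_into S i" by blast
      then show ?thesis by (intro exI[of _ "Suc i"]) (simp add: G_def)
    qed
    then show ?thesis by blast
  qed
  ultimately have "(\<lambda>n. measure \<mu> {x \<in> X. x 0 \<notin> G n}) \<longlonglongrightarrow> 0" by simp
  from order_tendstoD(2)[OF this e] obtain n where "measure \<mu> {x \<in> X. x 0 \<notin> G n} < e"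
    by (auto simp: eventually_sequentially)
  moreover have "G n \<subseteq> S" using range by (auto simp: G_def)
  ultimately show ?thesis using that[of "G n"] by (simp add: G_def)
qed

text \<open>Three comparisons of words by the Bowen property cost \<open>V\<close> each, two cuts
  cost \<open>C\<close> each.\<close>

lemma glue_potential:
  assumes X: "p \<in> X" "x \<in> X" "z \<in> X"
    and k: "1 \<le> k" and n: "1 \<le> n" and eq: "p k = x 0" "x n = z 0" "z k = p 0"
  shows "ln (f k p) + ln (f n x) + ln (f k z) - (3 * V + 2 * C) \<le> ln (f (k + n + k) (glue p x z k n))"
proof -
  define y where "y = glue p x z k n"
  have y: "y \<in> X" unfolding y_def by (rule glue_mem[OF X k n eq])
  note co = glue_coords[where p = p and x = x and z = z and k = k and n = n, OF k eq(2)]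
  have s1: "(shift_map ^^ k) y \<in> X" "(shift_map ^^ (k + n)) y \<in> X" using y by (auto intro: shift_pow_mem)
  have "ln (f k p) \<le> ln (f k y) + V"
    using co(1) by (intro bowen k X y) (simp add: y_def)
  moreover have "ln (f n x) \<le> ln (f n ((shift_map ^^ k) y)) + V"
    using co(2) by (intro bowen n X s1) (simp add: y_def shift_pow add.commute)
  moreover have "ln (f k z) \<le> ln (f k ((shift_map ^^ (k + n)) y)) + V"
    using co(3) by (intro bowen k X s1) (simp add: y_def shift_pow add.commute)
  moreover have "ln (f k y) + ln (f n ((shift_map ^^ k) y)) - C \<le> ln (f (k + n) y)"
    by (rule f_lower[OF k n y])
  moreover have "ln (f (k + n) y) + ln (f k ((shift_map ^^ (k + n)) y)) - C \<le> ln (f (k + n + k) y)"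
    using k y by (intro f_lower) auto
  ultimately show ?thesis unfolding y_def by linarith
qed

end

section \<open>Entropy plus energy is at most the pressure\<close>

lemma minus_ln_one_minus_le:
  fixes \<epsilon> :: real
  assumes "0 < \<epsilon>"
  obtains \<delta> where "0 < \<delta>" "\<delta> < 1" "- ln (1 - \<delta>) \<le> \<epsilon>"
proof
  show "0 < \<epsilon> / (1 + \<epsilon>)" "\<epsilon> / (1 + \<epsilon>) < 1" using assms by auto
  have "1 - \<epsilon> / (1 + \<epsilon>) = inverse (1 + \<epsilon>)" using assms by (simp add: field_simps)
  then have "- ln (1 - \<epsilon> / (1 + \<epsilon>)) = ln (1 + \<epsilon>)" using assms by (simp add: ln_inverse)
  then show "- ln (1 - \<epsilon> / (1 + \<epsilon>)) \<le> \<epsilon>" using assms ln_add_one_self_le_self[of \<epsilon>] by simp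
qed

context bowen_potential
begin

text \<open>\<open>c\<close>, \<open>N\<close> and \<open>k\<close> do not depend on
  \<open>m\<close>, so \<open>m\<close> can be sent to infinity afterwards. Of the error
  \<open>3 * \<epsilon>\<close> per unit of time, two parts pay for approximating \<open>P\<close>
  and one for orbits that start or end outside the finite set of letters.\<close>

lemma entropy_le_partition_function:
  assumes mu: "\<mu> \<in> invariant_measures S t"
    and int: "integrable \<mu> (\<lambda>x. ln (f 1 x))"
    and a: "a \<in> S"
    and P: "finite P" "P \<subseteq> sets \<mu>" "partition_on (space \<mu>) P"
    and \<epsilon>: "0 < \<epsilon>"
  obtains c N k where
    "\<And>m. 1 \<le> m \<Longrightarrow> partition_function S t f a (k + (m + N) + k) \<le> ennreal (exp (real (k + (m + N) + k) * s)) \<Longrightarrow>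
      partition_entropy \<mu> (iterated_partition \<mu> shift_map P m) + (\<integral>x. ln (f (m + N) x) \<partial>\<mu>)
        \<le> c + real (k + (m + N) + k) * (s + 3 * \<epsilon>)"
proof -
  interpret pr: almost_additive_process \<mu> shift_map "\<lambda>n x. ln (f n x)" C by (rule invariant_process(1)[OF mu])
  note space = invariant_process(2)[OF mu] and sets = invariant_process(3)[OF mu]
  have P_ne: "P \<noteq> {}" using pr.not_empty P(3) by (auto simp: partition_on_def)
  define q where "q = real (card P)"
  have q: "1 \<le> q" using P_ne P(1) by (simp add: q_def Suc_le_eq card_gt_0_iff)
  obtain \<delta> where \<delta>: "0 < \<delta>" "\<delta> < 1" "- ln (1 - \<delta>) \<le> \<epsilon>" using minus_ln_one_minus_le[OF \<epsilon>] .
  \<comment> \<open>The logarithmic price of misreading one letter of a name;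
    \<open>\<epsilon>1\<close> is chosen so that this price times the probability of an error is at
    most \<open>\<epsilon>\<close>.\<close>
  define lq where "lq = ln (q / \<delta>)"
  have "\<delta> \<le> q" using \<delta> q by linarith
  then have lq: "0 \<le> lq" unfolding lq_def using \<delta> q by (intro ln_ge_zero) (simp add: field_simps)
  define \<epsilon>1 where "\<epsilon>1 = \<epsilon> / (1 + lq)"
  have \<epsilon>1: "0 < \<epsilon>1" "\<epsilon>1 * lq \<le> \<epsilon>" unfolding \<epsilon>1_def using \<epsilon> lq by (auto simp: field_simps)

  have "\<forall>A\<in>P. \<exists>ND. snd ND \<in> sets \<mu> \<and> determined S t (fst ND) (snd ND) \<and> measure \<mu> (sym_diff A (snd ND)) < \<epsilon>1 / q"
  proof
    fix A assume "A \<in> P"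
    then have "A \<in> sets \<mu>" using P by auto
    moreover have "0 < \<epsilon>1 / q" using \<epsilon>1 q by simp
    ultimately obtain N D where "D \<in> sets \<mu>" "determined S t N D" "measure \<mu> (sym_diff A D) < \<epsilon>1 / q"
      using approximate_by_determined[OF countable_S pr.finite_measure_axioms sets] by blast
    then show "\<exists>ND. snd ND \<in> sets \<mu> \<and> determined S t (fst ND) (snd ND) \<and> measure \<mu> (sym_diff A (snd ND)) < \<epsilon>1 / q"
      by (intro exI[of _ "(N, D)"]) simp
  qed
  from bchoice[OF this] obtain ND where ND: "\<forall>A\<in>P. snd (ND A) \<in> sets \<mu> \<and> determined S t (fst (ND A)) (snd (ND A)) \<and>
      measure \<mu> (sym_diff A (snd (ND A))) < \<epsilon>1 / q" by (rule exE)
  define D where "D A = snd (ND A)" for A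
  define N where "N = Max (insert 1 ((\<lambda>A. fst (ND A)) ` P))"
  have D_sets: "D A \<in> sets \<mu>" and D_small: "measure \<mu> (sym_diff A (D A)) < \<epsilon>1 / q"
    and D_det: "determined S t N (D A)" if "A \<in> P" for A
  proof -
    show "D A \<in> sets \<mu>" "measure \<mu> (sym_diff A (D A)) < \<epsilon>1 / q" using ND that by (auto simp: D_def)
    have "fst (ND A) \<le> N" unfolding N_def using that P(1) by (intro Max_ge) auto
    moreover have "determined S t (fst (ND A)) (D A)" using ND that by (auto simp: D_def)
    ultimately show "determined S t N (D A)" by (rule determined_mono[rotated])
  qed
  define bad1 where "bad1 = (\<Union>A\<in>P. sym_diff A (D A))"
  have sd: "sym_diff A (D A) \<in> sets \<mu>" if "A \<in> P" for A using that P(2) D_sets[OF that] by auto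
  have bad1_sets: "bad1 \<in> sets \<mu>" unfolding bad1_def by (rule sets.finite_UN[OF P(1) sd])
  have bad1_le: "measure \<mu> bad1 \<le> \<epsilon>1"
  proof -
    have "measure \<mu> bad1 \<le> (\<Sum>A\<in>P. measure \<mu> (sym_diff A (D A)))"
      unfolding bad1_def by (rule measure_UNION_le[OF P(1) sd])
    also have "\<dots> \<le> (\<Sum>A\<in>P. \<epsilon>1 / q)" by (rule sum_mono) (simp add: D_small less_imp_le)
    also have "\<dots> = \<epsilon>1" using q by (simp add: q_def)
    finally show ?thesis .
  qed
  \<comment> \<open>The guess of the \<open>P\<close>-cell of \<open>x\<close> from its first
    \<open>N\<close> coordinates. The sets \<open>D A\<close> may overlap or miss \<open>x\<close>;
    the choice depends only on which of them contain \<open>x\<close>, hence only on these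
    coordinates.\<close>
  define \<eta> where "\<eta> x = (SOME A. A \<in> P \<and> x \<in> D A)" for x
  have eta_det: "\<eta> x = \<eta> y" if "x \<in> X" "y \<in> X" "\<And>i. i < N \<Longrightarrow> x i = y i" for x y
  proof -
    have "x \<in> D A \<longleftrightarrow> y \<in> D A" if "A \<in> P" for A
      using D_det[OF that] \<open>x \<in> X\<close> \<open>y \<in> X\<close> \<open>\<And>i. i < N \<Longrightarrow> x i = y i\<close> unfolding determined_def by blast
    then have "(\<lambda>A. A \<in> P \<and> x \<in> D A) = (\<lambda>A. A \<in> P \<and> y \<in> D A)" by blast
    then show ?thesis by (simp add: \<eta>_def)
  qed
  have eta_eq: "\<eta> x = A" if "x \<notin> bad1" "A \<in> P" "x \<in> A" for x A
    unfolding \<eta>_def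
  proof (rule some_equality)
    show "A \<in> P \<and> x \<in> D A" using that unfolding bad1_def by blast
    fix B assume B: "B \<in> P \<and> x \<in> D B"
    then have "x \<in> B" using that(1) unfolding bad1_def by blast
    then show "B = A" using B that by (intro partition_onD_eq[OF P(3)]) auto
  qed
  \<comment> \<open>A noisy channel: keep the guess, except for a uniform letter with probability
    \<open>\<delta>\<close>. The uniform part keeps every entry positive, so that a wrong guess has
    finite cost. A guess outside \<open>P\<close> is possible and makes the sum less than 1.\<close>
  define r where "r A B = (if A = B then 1 - \<delta> else 0) + \<delta> / q" for A B :: "(nat \<Rightarrow> 'a) set"
  have r_pos: "0 < r A B" for A B using \<delta> q by (auto simp: r_def add_nonneg_pos)
  have r_sum: "(\<Sum>A\<in>P. r A B) \<le> 1" for B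
  proof -
    have "(\<Sum>A\<in>P. r A B) = (\<Sum>A\<in>P. if A = B then 1 - \<delta> else 0) + (\<Sum>A\<in>P. \<delta> / q)"
      unfolding r_def by (rule sum.distrib)
    also have "(\<Sum>A\<in>P. \<delta> / q) = \<delta>" using q by (simp add: q_def)
    also have "(\<Sum>A\<in>P. if A = B then 1 - \<delta> else 0) = (if B \<in> P then 1 - \<delta> else 0)" using P(1) by simp
    finally show ?thesis using \<delta> by (auto split: if_splits)
  qed
  \<comment> \<open>The logarithmic cost of passing one letter through the channel:
    \<open>- ln (1 - \<delta>)\<close> always, and \<open>lq\<close> more where the guess may be
    wrong.\<close>
  define \<rho> where "\<rho> x = - ln (1 - \<delta>) + lq * indicator bad1 x" for x
  have rho_nonneg: "0 \<le> \<rho> x" for x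
  proof -
    have "ln (1 - \<delta>) \<le> 0" using \<delta> by simp
    moreover have "0 \<le> lq * indicator bad1 x" using lq by simp
    ultimately show ?thesis unfolding \<rho>_def by linarith
  qed
  have rho_int: "integrable \<mu> \<rho>" unfolding \<rho>_def using bad1_sets
    by (intro Bochner_Integration.integrable_add integrable_real_mult_indicator) auto
  have rho_le: "(\<integral>x. \<rho> x \<partial>\<mu>) \<le> 2 * \<epsilon>"
  proof -
    have "integrable \<mu> (\<lambda>x. lq * indicator bad1 x)"
      by (intro integrable_real_mult_indicator bad1_sets) simp
    then have "(\<integral>x. \<rho> x \<partial>\<mu>) = - ln (1 - \<delta>) + lq * measure \<mu> bad1"
      unfolding \<rho>_def using bad1_sets by (subst Bochner_Integration.integral_add) (auto simp: pr.prob_space)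
    also have "lq * measure \<mu> bad1 \<le> lq * \<epsilon>1" using bad1_le lq by (rule mult_left_mono)
    finally show ?thesis using \<delta>(3) \<epsilon>1(2) by (simp add: mult.commute)
  qed
  have r_ge: "exp (- \<rho> x) \<le> r A (\<eta> x)" if "A \<in> P" "x \<in> A" for x A
  proof (cases "x \<in> bad1")
    case True
    have "exp (- \<rho> x) = exp (ln (1 - \<delta>) + - lq)" using True by (simp add: \<rho>_def)
    also have "\<dots> = (1 - \<delta>) * (\<delta> / q)" unfolding exp_add using \<delta> q by (simp add: lq_def exp_minus)
    also have "\<dots> \<le> 1 * (\<delta> / q)" using \<delta> q by (intro mult_right_mono) auto
    also have "\<dots> \<le> r A (\<eta> x)" using \<delta> by (simp add: r_def)
    finally show ?thesis .
  next
    case False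
    then have "\<eta> x = A" using eta_eq that by blast
    then show ?thesis using False \<delta> q by (simp add: \<rho>_def r_def)
  qed

  \<comment> \<open>Losses per unit of time on a bad orbit: \<open>ln q\<close> for the uniform
    weight of its name, \<open>K + C\<close> for the energy that is discarded,
    \<open>\<bar>s\<bar>\<close> for the normalisation. \<open>\<epsilon>2\<close> makes bad orbits
    rare enough to pay for all three.\<close>
  define W where "W = ln q + (K + C) + \<bar>s\<bar>"
  have W: "0 \<le> W" unfolding W_def using q K_nonneg C_nonneg by simp
  define \<epsilon>2 where "\<epsilon>2 = \<epsilon> / (2 * (1 + W))"
  have \<epsilon>2: "0 < \<epsilon>2" "2 * \<epsilon>2 * W \<le> \<epsilon>" unfolding \<epsilon>2_def using \<epsilon> W by (auto simp: field_simps)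
  obtain F where F: "finite F" "F \<subseteq> S" "measure \<mu> {x \<in> X. x 0 \<notin> F} < \<epsilon>2"
    using finite_letters[OF mu \<epsilon>2(1)] .
  obtain k p z where k: "1 \<le> k"
    and p: "\<And>b. b \<in> F \<Longrightarrow> p b \<in> X \<and> p b 0 = a \<and> p b k = b"
    and z: "\<And>b. b \<in> F \<Longrightarrow> z b \<in> X \<and> z b 0 = b \<and> z b k = a"
    using connecting_words[OF F(1,2) a] by blast
  \<comment> \<open>The cost of gluing. The sums over \<open>F\<close> dominate the weights of
    whichever connecting words are used.\<close>
  define c where "c = 3 * V + 2 * C + (\<Sum>b\<in>F. \<bar>ln (f k (p b))\<bar>) + (\<Sum>b\<in>F. \<bar>ln (f k (z b))\<bar>)"
  have c: "0 \<le> c" unfolding c_def using V_nonneg C_nonneg by (intro add_nonneg_nonneg sum_nonneg) auto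

  have main: "partition_entropy \<mu> (iterated_partition \<mu> shift_map P m) + (\<integral>x. ln (f (m + N) x) \<partial>\<mu>)
        \<le> (ln 2 + c) + real (k + (m + N) + k) * (s + 3 * \<epsilon>)"
    if m: "1 \<le> m" and Z: "partition_function S t f a (k + (m + N) + k) \<le> ennreal (exp (real (k + (m + N) + k) * s))"
    for m
  proof -
    \<comment> \<open>The guess at time \<open>j < m\<close> looks at coordinates up to
      \<open>j + N - 1\<close>, so a name of length \<open>m\<close> needs an orbit segment of
      length \<open>m + N\<close>.\<close>
    define n where "n = m + N"
    define n' where "n' = k + n + k"
    have n: "1 \<le> n" "1 \<le> n'" "m \<le> n'" "n \<le> n'" using m by (auto simp: n_def n'_def)
    have Zsum: "(\<Sum>y\<in>Y. f n' y) \<le> exp (real n' * s)" if "finite Y" "Y \<subseteq> per a n'" for Y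
      using Z that n partition_function_le_iff[of n' "exp (real n' * s)" a] by (simp add: n'_def n_def)
    define good where "good = {x \<in> X. x 0 \<in> F \<and> x n \<in> F}"
    have good_sets: "good \<in> sets \<mu>"
    proof -
      have "good = {x \<in> X. x 0 \<in> F} \<inter> {x \<in> X. x n \<in> F}" by (auto simp: good_def)
      then show ?thesis using letters_sets[OF countable_finite[OF F(1)]] by (simp add: sets sets.Int)
    qed
    define bad where "bad = X - good"
    have bad_sets: "bad \<in> sets \<mu>" unfolding bad_def using sets.compl_sets[OF good_sets] by (simp add: space)
    have bad_le: "measure \<mu> bad \<le> 2 * \<epsilon>2"
    proof -
      let ?E = "{x \<in> X. x 0 \<notin> F}"
      have E: "?E \<in> sets \<mu>"
      proof -
        have "?E = space \<mu> - {x \<in> X. x 0 \<in> F}" by (auto simp: space)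
        moreover have "{x \<in> X. x 0 \<in> F} \<in> sets \<mu>"
          unfolding sets by (rule letters_sets[OF countable_finite[OF F(1)]])
        ultimately show ?thesis by (simp only: sets.compl_sets)
      qed
      have sub: "bad \<subseteq> ?E \<union> ((shift_map ^^ n) -` ?E \<inter> space \<mu>)"
        by (auto simp: bad_def good_def space shift_pow shift_pow_mem[unfolded shift_pow])
      have E': "(shift_map ^^ n) -` ?E \<inter> space \<mu> \<in> sets \<mu>" by (rule measurable_sets[OF pr.pow_measurable E])
      have "measure \<mu> bad \<le> measure \<mu> (?E \<union> ((shift_map ^^ n) -` ?E \<inter> space \<mu>))"
        using E E' by (intro pr.finite_measure_mono[OF sub]) auto
      also have "\<dots> \<le> measure \<mu> ?E + measure \<mu> ((shift_map ^^ n) -` ?E \<inter> space \<mu>)"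
        by (rule measure_Un_le[OF E E'])
      finally show ?thesis using F(3) pr.measure_pow_vimage[OF E, of n] by simp
    qed
    \<comment> \<open>Normalises the weights of the periodic points, whose sum is at most
      \<open>exp (real n' * s)\<close>.\<close>
    define e where "e = exp (- (real n' * s))"
    \<comment> \<open>The weight of a name: half is uniform and takes care of the bad orbits, half reads the name off
      the periodic points with weights \<open>f n'\<close>, each letter being perturbed by the channel \<open>r\<close>
      to account for the error of the approximation \<open>\<eta>\<close> of \<open>P\<close>.\<close>
    define h where "h \<theta> y = f n' y * e * (\<Prod>j<m. r (\<theta> j) (\<eta> ((shift_map ^^ (k + j)) y)))" for \<theta> y
    define pw where "pw \<theta> = (1 / q) ^ m / 2 + infsum (h \<theta>) (per a n') / 2" for \<theta>
    have e: "0 < e" by (simp add: e_def)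
    have h_nonneg: "0 \<le> h \<theta> y" if "y \<in> per a n'" for \<theta> y
      unfolding h_def using that f_pos[OF n(2), of y] e r_pos by (intro mult_nonneg_nonneg prod_nonneg) (auto intro: less_imp_le)
    have fin_names: "finite (names P m)" by (rule finite_PiE) (simp_all add: P)
    have h_sum: "(\<Sum>\<theta>\<in>names P m. \<Sum>y\<in>Y. h \<theta> y) \<le> 1" if Y: "finite Y" "Y \<subseteq> per a n'" for Y
    proof -
      have "(\<Sum>\<theta>\<in>names P m. \<Sum>y\<in>Y. h \<theta> y) = (\<Sum>y\<in>Y. \<Sum>\<theta>\<in>names P m. h \<theta> y)" by (rule sum.swap)
      also have "\<dots> \<le> (\<Sum>y\<in>Y. f n' y * e)"
      proof (rule sum_mono)
        fix y assume "y \<in> Y"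
        then have y: "y \<in> X" using Y by auto
        have "(\<Sum>\<theta>\<in>names P m. h \<theta> y) = f n' y * e * (\<Sum>\<theta>\<in>names P m. \<Prod>j<m. r (\<theta> j) (\<eta> ((shift_map ^^ (k + j)) y)))"
          unfolding h_def by (simp add: sum_distrib_left)
        \<comment> \<open>Summing over all names factors into one sum per letter, each at most 1:
          the channel turns every periodic point into a sub-probability on names.\<close>
        also have "(\<Sum>\<theta>\<in>names P m. \<Prod>j<m. r (\<theta> j) (\<eta> ((shift_map ^^ (k + j)) y))) =
            (\<Prod>j<m. \<Sum>A\<in>P. r A (\<eta> ((shift_map ^^ (k + j)) y)))"
          by (rule prod_sum_PiE[symmetric]) (simp_all add: P)
        also have "\<dots> \<le> 1" using r_sum r_pos by (intro prod_le_1) (auto intro!: sum_nonneg intro: less_imp_le)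
        finally show "(\<Sum>\<theta>\<in>names P m. h \<theta> y) \<le> f n' y * e"
          using f_pos[OF n(2) y] e by (simp add: mult_left_le)
      qed
      also have "\<dots> = (\<Sum>y\<in>Y. f n' y) * e" by (simp add: sum_distrib_right)
      also have "\<dots> \<le> exp (real n' * s) * e" using Zsum[OF Y] e by (intro mult_right_mono) auto
      also have "\<dots> = 1" by (simp add: e_def exp_minus)
      finally show ?thesis .
    qed
    \<comment> \<open>There may be infinitely many periodic points, and without summability
      \<open>infsum\<close> would only return its default value. The total over all names bounds
      every finite subsum.\<close>
    have h_summable: "h \<theta> summable_on per a n'" if th: "\<theta> \<in> names P m" for \<theta>
    proof (rule nonneg_bdd_above_summable_on)
      show "bdd_above (sum (h \<theta>) ` {Y. Y \<subseteq> per a n' \<and> finite Y})"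
      proof (rule bdd_aboveI2)
        fix Y assume "Y \<in> {Y. Y \<subseteq> per a n' \<and> finite Y}"
        then have Y: "finite Y" "Y \<subseteq> per a n'" by auto
        have "sum (h \<theta>) Y \<le> (\<Sum>\<theta>\<in>names P m. \<Sum>y\<in>Y. h \<theta> y)"
          using Y h_nonneg by (intro member_le_sum[OF th _ fin_names] sum_nonneg) blast
        then show "sum (h \<theta>) Y \<le> 1" using h_sum[OF Y] by linarith
      qed
    qed (rule h_nonneg)
    have h_infsum: "(\<Sum>\<theta>\<in>names P m. infsum (h \<theta>) (per a n')) \<le> 1"
    proof (rule has_sum_le_finite_sums)
      show "((\<lambda>y. \<Sum>\<theta>\<in>names P m. h \<theta> y) has_sum (\<Sum>\<theta>\<in>names P m. infsum (h \<theta>) (per a n'))) (per a n')"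
        by (intro has_sum_finite_sum fin_names has_sum_infsum h_summable)
      show "(\<Sum>y\<in>Y. \<Sum>\<theta>\<in>names P m. h \<theta> y) \<le> 1" if "finite Y" "Y \<subseteq> per a n'" for Y
        using h_sum[OF that] by (subst sum.swap)
    qed
    have pw_sum: "(\<Sum>\<theta>\<in>names P m. pw \<theta>) \<le> 1"
    proof -
      have "(\<Sum>\<theta>\<in>names P m. (1 / q) ^ m) = 1"
        using P(1) P_ne by (simp add: card_PiE q_def power_divide)
      then have "(\<Sum>\<theta>\<in>names P m. (1 / q) ^ m / 2) = 1 / 2" by (simp only: sum_divide_distrib[symmetric])
      moreover have "(\<Sum>\<theta>\<in>names P m. infsum (h \<theta>) (per a n') / 2) \<le> 1 / 2"
        using h_infsum by (simp add: sum_divide_distrib[symmetric])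
      ultimately show ?thesis unfolding pw_def sum.distrib by linarith
    qed
    have inf_nonneg: "0 \<le> infsum (h \<theta>) (per a n')" for \<theta> by (rule infsum_nonneg) (rule h_nonneg)
    have pw_nonneg: "0 \<le> pw \<theta>" for \<theta> using q inf_nonneg[of \<theta>] by (simp add: pw_def)

    define R where "R x = (\<Sum>j<m. \<rho> ((shift_map ^^ j) x))" for x
    \<comment> \<open>A pointwise lower bound for the logarithm of \<open>pw\<close>: the part from
      periodic points on \<open>good\<close>, the uniform part on \<open>bad\<close>. It is not
      constant on atoms, since neither \<open>good\<close> nor \<open>f n\<close> follows the
      names.\<close>
    define \<psi> where "\<psi> x = - ln 2 - R x + (ln (f n x) - (c + real n' * s)) * indicator good x
        - real m * ln q * indicator bad x" for x
    have R_nonneg: "0 \<le> R x" for x unfolding R_def using rho_nonneg by (intro sum_nonneg) auto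
    have exp_psi: "exp (\<psi> x) \<le> pw \<theta>" if th: "\<theta> \<in> names P m" and x: "x \<in> atom \<mu> shift_map m \<theta>" for \<theta> x
    proof -
      have xX: "x \<in> X" and xj: "\<And>j. j < m \<Longrightarrow> (shift_map ^^ j) x \<in> \<theta> j" using x by (auto simp: atom_def space)
      show ?thesis
      proof (cases "x \<in> good")
        case True
        define y where "y = glue (p (x 0)) x (z (x n)) k n"
        have F0: "x 0 \<in> F" "x n \<in> F" using True by (auto simp: good_def)
        note pp = p[OF F0(1)] and zz = z[OF F0(2)]
        have eq: "p (x 0) k = x 0" "x n = z (x n) 0" "z (x n) k = p (x 0) 0" using pp zz by auto
        have yX: "y \<in> X" unfolding y_def using pp zz xX by (intro glue_mem[OF _ _ _ k n(1) eq]) auto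
        note co = glue_coords[where p = "p (x 0)" and x = x and z = "z (x n)" and k = k and n = n, OF k eq(2)]
        have y0: "y 0 = a" using co(1)[of 0] k pp by (simp add: y_def)
        have "(shift_map ^^ n') y = y" unfolding y_def n'_def by (rule glue_periodic)
        then have y_per: "y \<in> per a n'" using yX y0 by simp
        have eta_y: "\<eta> ((shift_map ^^ (k + j)) y) = \<eta> ((shift_map ^^ j) x)" if "j < m" for j
        proof (rule eta_det)
          show "(shift_map ^^ (k + j)) y \<in> X" "(shift_map ^^ j) x \<in> X" using xX yX by (auto intro: shift_pow_mem)
          fix i assume "i < N"
          then have "y (k + (i + j)) = x (i + j)" unfolding y_def using that by (intro co(2)) (simp add: n_def)
          then show "(shift_map ^^ (k + j)) y i = (shift_map ^^ j) x i" by (simp add: shift_pow algebra_simps)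
        qed
        have "ln (f n x) - c \<le> ln (f n' y)"
        proof -
          have "ln (f k (p (x 0))) + ln (f n x) + ln (f k (z (x n))) - (3 * V + 2 * C) \<le> ln (f n' y)"
            unfolding y_def n'_def using pp zz xX by (intro glue_potential[OF _ _ _ k n(1) eq]) auto
          moreover have "\<bar>ln (f k (p (x 0)))\<bar> \<le> (\<Sum>b\<in>F. \<bar>ln (f k (p b))\<bar>)"
            by (rule member_le_sum[OF F0(1) _ F(1)]) simp
          moreover have "\<bar>ln (f k (z (x n)))\<bar> \<le> (\<Sum>b\<in>F. \<bar>ln (f k (z b))\<bar>)"
            by (rule member_le_sum[OF F0(2) _ F(1)]) simp
          ultimately show ?thesis unfolding c_def by linarith
        qed
        then have f_ge: "exp (ln (f n x) - c) \<le> f n' y"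
          using f_pos[OF n(2) yX] by (simp add: ln_ge_iff[symmetric])
        have "exp (\<psi> x) = exp (ln (f n x) - c) * e * exp (- R x) * exp (- ln 2)"
          using True by (simp add: \<psi>_def bad_def e_def exp_add[symmetric] algebra_simps)
        also have "exp (- R x) = (\<Prod>j<m. exp (- \<rho> ((shift_map ^^ j) x)))"
          unfolding R_def by (simp add: exp_sum sum_negf[symmetric])
        also have "exp (ln (f n x) - c) * e * (\<Prod>j<m. exp (- \<rho> ((shift_map ^^ j) x))) * exp (- ln 2)
            \<le> f n' y * e * (\<Prod>j<m. r (\<theta> j) (\<eta> ((shift_map ^^ (k + j)) y))) * exp (- ln 2)"
        proof (intro mult_right_mono mult_mono f_ge)
          show "(\<Prod>j<m. exp (- \<rho> ((shift_map ^^ j) x))) \<le> (\<Prod>j<m. r (\<theta> j) (\<eta> ((shift_map ^^ (k + j)) y)))"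
          proof (rule prod_mono)
            fix j assume "j \<in> {..<m}"
            then have "j < m" "\<theta> j \<in> P" using th by auto
            then show "0 \<le> exp (- \<rho> ((shift_map ^^ j) x)) \<and> exp (- \<rho> ((shift_map ^^ j) x)) \<le> r (\<theta> j) (\<eta> ((shift_map ^^ (k + j)) y))"
              using r_ge[of "\<theta> j" "(shift_map ^^ j) x"] xj[of j] eta_y[of j] by simp
          qed
        qed (use e f_pos[OF n(2) yX] in \<open>auto intro!: prod_nonneg mult_nonneg_nonneg\<close>)
        also have "\<dots> = h \<theta> y / 2" by (simp add: h_def exp_minus)
        also have "h \<theta> y \<le> infsum (h \<theta>) (per a n')"
          using finite_sum_le_infsum[OF h_summable[OF th], of "{y}"] y_per h_nonneg by auto
        finally have "exp (\<psi> x) \<le> infsum (h \<theta>) (per a n') / 2" by simp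
        also have "\<dots> \<le> pw \<theta>" using q by (simp add: pw_def)
        finally show ?thesis .
      next
        case False
        then have "\<psi> x = - ln 2 - R x - real m * ln q" using xX by (simp add: \<psi>_def bad_def)
        then have "exp (\<psi> x) \<le> exp (- ln 2 - real m * ln q)" using R_nonneg[of x] by simp
        also have "\<dots> = (1 / q) ^ m / 2"
        proof -
          have "exp (real m * ln q) = q ^ m" using q by (simp add: exp_of_nat_mult)
          moreover have "exp (- ln 2 - real m * ln q) = exp (- ln 2) / exp (real m * ln q)" by (rule exp_diff)
          ultimately show ?thesis by (simp add: exp_minus power_divide)
        qed
        also have "\<dots> \<le> pw \<theta>" using inf_nonneg[of \<theta>] by (simp add: pw_def)
        finally show ?thesis .
      qed
    qed
    have ln_int: "integrable \<mu> (\<lambda>x. ln (f n x))" by (rule pr.g_integrable[OF int n(1)])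
    have R_int: "integrable \<mu> R" unfolding R_def[abs_def] by (rule pr.integral_pow_sum(2)[OF rho_int]) simp
    have i1: "integrable \<mu> (\<lambda>x. (ln (f n x) - (c + real n' * s)) * indicator good x)"
      using ln_int by (intro integrable_real_mult_indicator good_sets) simp
    have i2: "integrable \<mu> (\<lambda>x. real m * ln q * indicator bad x)"
      by (intro integrable_real_mult_indicator bad_sets) simp
    have i0: "integrable \<mu> (\<lambda>x. - ln 2 - R x)" using R_int by simp
    have i01: "integrable \<mu> (\<lambda>x. - ln 2 - R x + (ln (f n x) - (c + real n' * s)) * indicator good x)"
      by (rule Bochner_Integration.integrable_add[OF i0 i1])
    have psi_int: "integrable \<mu> \<psi>"
      unfolding \<psi>_def[abs_def] by (rule Bochner_Integration.integrable_diff[OF i01 i2])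
    have "partition_entropy \<mu> (iterated_partition \<mu> shift_map P m) \<le> - (\<integral>x. \<psi> x \<partial>\<mu>)"
      by (rule pr.entropy_le[OF P m psi_int pw_sum pw_nonneg exp_psi])
    moreover have "(\<integral>x. \<psi> x \<partial>\<mu>) = - ln 2 - (\<integral>x. R x \<partial>\<mu>) + (\<integral>x. (ln (f n x) - (c + real n' * s)) * indicator good x \<partial>\<mu>)
        - (\<integral>x. real m * ln q * indicator bad x \<partial>\<mu>)"
      unfolding \<psi>_def[abs_def] Bochner_Integration.integral_diff[OF i01 i2] Bochner_Integration.integral_add[OF i0 i1]
      using R_int by (simp add: pr.prob_space)
    moreover have "(\<integral>x. R x \<partial>\<mu>) \<le> real n' * (2 * \<epsilon>)"
    proof -
      have "(\<integral>x. R x \<partial>\<mu>) = real m * (\<integral>x. \<rho> x \<partial>\<mu>)"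
        unfolding R_def using pr.integral_pow_sum(1)[OF rho_int, of "{..<m}"] by simp
      also have "\<dots> \<le> real n' * (2 * \<epsilon>)" using rho_le n \<epsilon> rho_nonneg
        by (intro mult_mono) (auto intro!: integral_nonneg)
      finally show ?thesis .
    qed
    moreover have "(\<integral>x. real m * ln q * indicator bad x \<partial>\<mu>) \<le> real n' * (ln q * measure \<mu> bad)"
    proof -
      have "(\<integral>x. real m * ln q * indicator bad x \<partial>\<mu>) = real m * (ln q * measure \<mu> bad)"
        using bad_sets by simp
      also have "\<dots> \<le> real n' * (ln q * measure \<mu> bad)" using n q by (intro mult_right_mono) auto
      finally show ?thesis .
    qed
    moreover have "(\<integral>x. ln (f n x) \<partial>\<mu>) - c - real n' * s - real n' * ((\<bar>s\<bar> + (K + C)) * measure \<mu> bad)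
        \<le> (\<integral>x. (ln (f n x) - (c + real n' * s)) * indicator good x \<partial>\<mu>)"
    proof -
      \<comment> \<open>Restricting the energy to \<open>good\<close> loses on each bad point at
        most this much, because \<open>ln (f n)\<close> is bounded above linearly in time.\<close>
      let ?B = "real n' * (\<bar>s\<bar> + (K + C))"
      have iB: "integrable \<mu> (\<lambda>x. ?B * indicator bad x)"
        by (intro integrable_real_mult_indicator bad_sets) simp
      have iL: "integrable \<mu> (\<lambda>x. ln (f n x) - (c + real n' * s))" using ln_int by simp
      have "(\<integral>x. (ln (f n x) - (c + real n' * s)) - ?B * indicator bad x \<partial>\<mu>)
          \<le> (\<integral>x. (ln (f n x) - (c + real n' * s)) * indicator good x \<partial>\<mu>)"
      proof (rule integral_mono[OF Bochner_Integration.integrable_diff[OF iL iB] i1])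
        fix x assume "x \<in> space \<mu>"
        then have x: "x \<in> X" by (simp add: space)
        show "(ln (f n x) - (c + real n' * s)) - ?B * indicator bad x \<le> (ln (f n x) - (c + real n' * s)) * indicator good x"
        proof (cases "x \<in> good")
          case False
          have "ln (f n x) \<le> (K + C) * real n" by (rule f_ub_n[OF n(1) x])
          also have "\<dots> \<le> (K + C) * real n'" using n K_nonneg C_nonneg by (intro mult_left_mono) auto
          finally have "ln (f n x) \<le> real n' * (K + C)" by (simp add: mult.commute)
          moreover have "- (real n' * s) \<le> real n' * \<bar>s\<bar>"
            by (metis abs_ge_minus_self abs_mult abs_of_nat)
          ultimately show ?thesis using False x c by (simp add: bad_def distrib_left)
        qed (simp add: bad_def)
      qed
      also have "(\<integral>x. (ln (f n x) - (c + real n' * s)) - ?B * indicator bad x \<partial>\<mu>) =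
          (\<integral>x. ln (f n x) \<partial>\<mu>) - (c + real n' * s) - ?B * measure \<mu> bad"
        unfolding Bochner_Integration.integral_diff[OF iL iB] using ln_int bad_sets by (simp add: pr.prob_space)
      finally show ?thesis by (simp add: algebra_simps)
    qed
    ultimately have "partition_entropy \<mu> (iterated_partition \<mu> shift_map P m) + (\<integral>x. ln (f n x) \<partial>\<mu>)
        \<le> ln 2 + c + real n' * s + real n' * (2 * \<epsilon>) + (real n' * (ln q * measure \<mu> bad) + real n' * ((\<bar>s\<bar> + (K + C)) * measure \<mu> bad))"
      by linarith
    also have "real n' * (ln q * measure \<mu> bad) + real n' * ((\<bar>s\<bar> + (K + C)) * measure \<mu> bad) = real n' * (measure \<mu> bad * W)"
      by (simp add: W_def algebra_simps)
    also have "\<dots> \<le> real n' * \<epsilon>"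
    proof (intro mult_left_mono)
      have "measure \<mu> bad * W \<le> 2 * \<epsilon>2 * W" using bad_le W by (intro mult_right_mono) auto
      then show "measure \<mu> bad * W \<le> \<epsilon>" using \<epsilon>2(2) by linarith
    qed simp
    finally show ?thesis by (simp add: n_def n'_def algebra_simps)
  qed
  show ?thesis by (rule that[of k N "ln 2 + c", OF main])
qed

text \<open>The bound on the partition function is available along some subsequence only. This is
  enough because entropy and energy per unit of time converge, and it is what yields the lower
  growth rate.\<close>

lemma entropy_energy_le:
  assumes mu: "\<mu> \<in> invariant_measures S t"
    and int: "integrable \<mu> (\<lambda>x. ln (f 1 x))"
    and L: "(\<lambda>n. (\<integral>x. ln (f n x) \<partial>\<mu>) / real n) \<longlonglongrightarrow> L"
    and a: "a \<in> S"
    and P: "finite P" "P \<subseteq> sets \<mu>" "partition_on (space \<mu>) P"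
    and freq: "\<And>N. \<exists>n\<ge>N. partition_function S t f a n \<le> ennreal (exp (real n * s))"
  shows "entropy_wrt \<mu> shift_map P + L \<le> s"
proof (rule field_le_epsilon)
  fix \<epsilon> :: real assume "0 < \<epsilon>"
  then have e: "0 < \<epsilon> / 3" by simp
  interpret pr: almost_additive_process \<mu> shift_map "\<lambda>n x. ln (f n x)" C by (rule invariant_process(1)[OF mu])
  let ?H = "\<lambda>m. partition_entropy \<mu> (iterated_partition \<mu> shift_map P m)"
  obtain c N k where main: "\<And>m. 1 \<le> m \<Longrightarrow> partition_function S t f a (k + (m + N) + k) \<le> ennreal (exp (real (k + (m + N) + k) * s)) \<Longrightarrow>
      ?H m + (\<integral>x. ln (f (m + N) x) \<partial>\<mu>) \<le> c + real (k + (m + N) + k) * (s + 3 * (\<epsilon> / 3))"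
    by (rule entropy_le_partition_function[OF mu int a P e, where s = s]) (erule that)
  define w where "w = s + \<epsilon>"
  define d where "d = c + real (k + N + k) * w"
  \<comment> \<open>\<open>real m * Y m\<close> is entropy plus energy minus its bound. The factor
    \<open>1 + real N / real m\<close> converts the average over time \<open>m + N\<close> into one
    over time \<open>m\<close>; \<open>d\<close> holds all constants. A positive limit would
    contradict the bound along the subsequence.\<close>
  define Y where "Y m = ?H m / real m + (\<integral>x. ln (f (m + N) x) \<partial>\<mu>) / real (m + N) * (1 + real N / real m) - (d / real m + w)" for m
  have "Y \<longlonglongrightarrow> entropy_wrt \<mu> shift_map P + L * (1 + 0) - (0 + w)"
    unfolding Y_def
    by (intro tendsto_intros lim_const_over_n pr.entropy_wrt_limit[OF P] LIMSEQ_ignore_initial_segment[OF L])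
  then have lim: "Y \<longlonglongrightarrow> entropy_wrt \<mu> shift_map P + L - w" by simp
  show "entropy_wrt \<mu> shift_map P + L \<le> s + \<epsilon>"
  proof (rule ccontr)
    assume "\<not> ?thesis"
    then have "0 < entropy_wrt \<mu> shift_map P + L - w" by (simp add: w_def)
    from order_tendstoD(1)[OF lim this] obtain m0 where m0: "\<forall>m\<ge>m0. 0 < Y m"
      unfolding eventually_sequentially by (rule exE)
    obtain n where n: "k + (max 1 m0 + N) + k \<le> n" "partition_function S t f a n \<le> ennreal (exp (real n * s))"
      using freq by blast
    define m where "m = n - (k + N + k)"
    have m: "1 \<le> m" "m0 \<le> m" "n = k + (m + N) + k" using n by (auto simp: m_def)
    have "?H m + (\<integral>x. ln (f (m + N) x) \<partial>\<mu>) \<le> c + real (k + (m + N) + k) * w"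
      using main[OF m(1)] n(2) m(3) by (simp add: w_def)
    also have "\<dots> = d + real m * w" by (simp add: d_def algebra_simps)
    finally have le: "?H m + (\<integral>x. ln (f (m + N) x) \<partial>\<mu>) \<le> d + real m * w" .
    have "real m * Y m = ?H m + (\<integral>x. ln (f (m + N) x) \<partial>\<mu>) - (d + real m * w)"
    proof -
      have "real m * (1 + real N / real m) = real (m + N)" using m by (simp add: field_simps)
      then have "real m * ((\<integral>x. ln (f (m + N) x) \<partial>\<mu>) / real (m + N) * (1 + real N / real m)) =
          (\<integral>x. ln (f (m + N) x) \<partial>\<mu>) / real (m + N) * real (m + N)" by (metis mult.left_commute)
      also have "\<dots> = (\<integral>x. ln (f (m + N) x) \<partial>\<mu>)" using m by simp
      finally have "real m * ((\<integral>x. ln (f (m + N) x) \<partial>\<mu>) / real (m + N) * (1 + real N / real m)) = (\<integral>x. ln (f (m + N) x) \<partial>\<mu>)" .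
      moreover have "real m * (?H m / real m) = ?H m" "real m * (d / real m) = d" using m by auto
      ultimately show ?thesis unfolding Y_def right_diff_distrib distrib_left by linarith
    qed
    then have "real m * Y m \<le> 0" using le by simp
    moreover have "0 < real m * Y m" using m0 m by simp
    ultimately show False by simp
  qed
qed

end

section \<open>Bernoulli measures on concatenations of periodic words\<close>

text \<open>All words have the same length \<open>n\<close>, so an infinite concatenation can be decoded once the phase
  is known; choosing the phase \<open>k\<close> uniformly in \<open>{..<n}\<close> makes the measure shift invariant.\<close>

locale periodic_words = bowen_potential +
  fixes a :: 'a and n :: nat and Y :: "(nat \<Rightarrow> 'a) set"
  assumes n_pos: "1 \<le> n" and Y_fin: "finite Y" and Y_ne: "Y \<noteq> {}" and Y_per: "Y \<subseteq> per a n"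
begin

definition "Z = (\<Sum>y\<in>Y. f n y)"
definition "p = embed_pmf (\<lambda>y. if y \<in> Y then f n y / Z else 0)"
definition "B = (\<Pi>\<^sub>M q\<in>(UNIV :: nat set). measure_pmf p)"
text \<open>The sample space of \<open>p\<close> consists of all functions; replacing those outside
  \<open>Y\<close> by some member of \<open>Y\<close> makes every concatenation admissible, not
  merely almost every one.\<close>

definition "word w = (if w \<in> Y then w else (SOME y. y \<in> Y))"
definition "conc k \<omega> = (\<lambda>i. word (\<omega> ((i + k) div n)) ((i + k) mod n))"
text \<open>The phase also ranges over all naturals; reducing it modulo \<open>n\<close> lets bounds
  for \<open>k < n\<close> hold everywhere on the product space.\<close>

definition "\<mu> = distr (measure_pmf (pmf_of_set {..<n}) \<Otimes>\<^sub>M B) (shift_borel S t) (\<lambda>(k, \<omega>). conc (k mod n) \<omega>)"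
text \<open>The mean of \<open>ln (f n)\<close> over one random word. The Shannon entropy of
  \<open>p\<close> is \<open>ln Z - E\<close>, so entropy plus mean energy of a word is
  \<open>ln Z\<close>.\<close>

definition "E = (\<Sum>y\<in>Y. ln (f n y) * (f n y / Z))"
definition "\<nu> k A = measure B {\<omega>. conc k \<omega> \<in> A}"

lemma Y_mem: "y \<in> Y \<Longrightarrow> y \<in> X" "y \<in> Y \<Longrightarrow> y 0 = a" "y \<in> Y \<Longrightarrow> y (i + n) = y i"
proof -
  assume "y \<in> Y"
  then have y: "y \<in> X" "(shift_map ^^ n) y = y" "y 0 = a" using Y_per by auto
  then show "y \<in> X" "y 0 = a" by simp_all
  show "y (i + n) = y i" using fun_cong[OF y(2), of i] by (simp add: shift_pow)
qed

lemma Y_mod: "y \<in> Y \<Longrightarrow> y (i mod n) = y i"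
proof (induction i rule: less_induct)
  case (less i)
  show ?case
  proof (cases "i < n")
    case False
    then have "y ((i - n) mod n) = y (i - n)" using less n_pos by auto
    then show ?thesis using False Y_mem(3)[OF less.prems, of "i - n"] by (simp add: le_mod_geq)
  qed simp
qed

lemma Y_eqI: "y \<in> Y \<Longrightarrow> y' \<in> Y \<Longrightarrow> (\<And>i. i < n \<Longrightarrow> y i = y' i) \<Longrightarrow> y = y'"
  using Y_mod n_pos by (metis ext mod_less_divisor less_le_trans zero_less_one)

lemma word_Y: "word w \<in> Y"
  using Y_ne someI_ex[of "\<lambda>y. y \<in> Y"] by (auto simp: word_def)

lemma f_Y_pos: "y \<in> Y \<Longrightarrow> 0 < f n y"
  using f_pos[OF n_pos Y_mem(1)] .

lemma Z_pos: "0 < Z"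
  unfolding Z_def using Y_fin Y_ne f_Y_pos by (intro sum_pos) auto

lemma pmf_p: "pmf p y = (if y \<in> Y then f n y / Z else 0)"
  unfolding p_def
proof (rule pmf_embed_pmf)
  show "0 \<le> (if y \<in> Y then f n y / Z else 0)" for y
    using f_Y_pos[of y] Z_pos by auto
  have "(\<integral>\<^sup>+y. ennreal (if y \<in> Y then f n y / Z else 0) \<partial>count_space UNIV) = (\<Sum>y\<in>Y. ennreal (if y \<in> Y then f n y / Z else 0))"
    using Y_fin by (intro nn_integral_count_space') auto
  also have "\<dots> = (\<Sum>y\<in>Y. ennreal (f n y / Z))" by (intro sum.cong) auto
  also have "\<dots> = ennreal (\<Sum>y\<in>Y. f n y / Z)"
    using f_Y_pos Z_pos by (intro sum_ennreal) (auto intro: less_imp_le)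
  also have "(\<Sum>y\<in>Y. f n y / Z) = 1" using Z_pos by (simp add: sum_divide_distrib[symmetric] Z_def)
  finally show "(\<integral>\<^sup>+y. ennreal (if y \<in> Y then f n y / Z else 0) \<partial>count_space UNIV) = 1" by simp
qed

lemma set_p: "set_pmf p = Y"
  using f_Y_pos Z_pos by (force simp: set_pmf_eq pmf_p)

interpretation P: product_prob_space "\<lambda>_::nat. measure_pmf p" UNIV
  by (rule product_prob_spaceI) (rule prob_space_measure_pmf)

interpretation B: prob_space B
  unfolding B_def by (rule P.prob_space_axioms)

interpretation KB: pair_prob_space "measure_pmf (pmf_of_set {..<n})" B ..

lemma space_B: "space B = UNIV"
  by (simp add: B_def space_PiM PiE_UNIV_domain)

lemma component_measurable: "(\<lambda>\<omega>. \<omega> q) \<in> measurable B (measure_pmf p)"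
  unfolding B_def by (rule measurable_component_singleton) simp

lemma component_sets: "{\<omega>. Q (\<omega> q)} \<in> sets B"
proof -
  have "(\<lambda>\<omega>. \<omega> q) -` {w. Q w} \<inter> space B \<in> sets B"
    by (rule measurable_sets[OF component_measurable]) simp
  then show ?thesis by (simp add: space_B vimage_def)
qed

lemma integral_component:
  fixes v :: "(nat \<Rightarrow> 'a) \<Rightarrow> real"
  shows "integrable B (\<lambda>\<omega>. v (\<omega> q))"
    and "(\<integral>\<omega>. v (\<omega> q) \<partial>B) = (\<Sum>y\<in>Y. v y * (f n y / Z))"
proof -
  have d: "distr B (measure_pmf p) (\<lambda>\<omega>. \<omega> q) = measure_pmf p"
    unfolding B_def by (rule P.PiM_component) simp
  have "integrable (distr B (measure_pmf p) (\<lambda>\<omega>. \<omega> q)) v"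
    unfolding d by (rule integrable_measure_pmf_finite) (simp add: set_p Y_fin)
  then show "integrable B (\<lambda>\<omega>. v (\<omega> q))" by (rule integrable_distr[OF component_measurable])
  have "(\<integral>\<omega>. v (\<omega> q) \<partial>B) = (\<integral>w. v w \<partial>measure_pmf p)"
    using integral_distr[OF component_measurable, of v q] by (simp add: d)
  also have "\<dots> = (\<Sum>y\<in>Y. v y * pmf p y)"
    by (rule integral_measure_pmf_real[OF Y_fin]) (simp add: set_p)
  also have "\<dots> = (\<Sum>y\<in>Y. v y * (f n y / Z))" by (intro sum.cong) (simp_all add: pmf_p)
  finally show "(\<integral>\<omega>. v (\<omega> q) \<partial>B) = (\<Sum>y\<in>Y. v y * (f n y / Z))" .
qed

lemma conc_shift: "(shift_map ^^ j) (conc k \<omega>) = conc (k + j) \<omega>"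
  by (simp add: shift_pow conc_def algebra_simps)

text \<open>All words start with \<open>a\<close> and have period \<open>n\<close>, so each of them
  would itself continue with \<open>a\<close>: any two may follow each other.\<close>

lemma conc_mem: "conc k \<omega> \<in> X"
proof -
  have "conc 0 \<omega> \<in> X"
    unfolding markov_shift_def
  proof (intro CollectI conjI allI)
    fix i
    define y where "y = word (\<omega> (i div n))"
    have y: "y \<in> Y" "y \<in> X" unfolding y_def by (rule word_Y, rule Y_mem(1)[OF word_Y])
    have i: "conc 0 \<omega> i = y (i mod n)" by (simp add: conc_def y_def)
    show "conc 0 \<omega> i \<in> S" unfolding i using y(2) by (simp add: markov_shift_def)
    have "conc 0 \<omega> (Suc i) = y (Suc (i mod n))"
    proof (cases "Suc (i mod n) = n")
      case True
      then have "conc 0 \<omega> (Suc i) = word (\<omega> (Suc i div n)) 0" by (simp add: conc_def mod_Suc)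
      also have "\<dots> = y 0" using Y_mem(2)[OF word_Y] Y_mem(2)[OF y(1)] by simp
      also have "\<dots> = y (Suc (i mod n))" using Y_mem(3)[OF y(1), of 0] True by simp
      finally show ?thesis .
    next
      case False
      then show ?thesis by (simp add: conc_def y_def mod_Suc div_Suc)
    qed
    then show "t (conc 0 \<omega> i) (conc 0 \<omega> (Suc i)) = 1" unfolding i using y(2) by (simp add: markov_shift_def)
  qed
  then have "(shift_map ^^ k) (conc 0 \<omega>) \<in> X" by (rule shift_pow_mem)
  then show ?thesis by (simp add: conc_shift)
qed

lemma conc_block: "i < n \<Longrightarrow> conc (q * n) \<omega> i = word (\<omega> q) i"
  by (simp add: conc_def)

lemma conc_measurable: "conc k \<in> measurable B (shift_borel S t)"
proof (rule measurable_to_shift_borel[OF countable_S conc_mem])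
  fix i b
  have "{\<omega> \<in> space B. conc k \<omega> i = b} = {\<omega>. word (\<omega> ((i + k) div n)) ((i + k) mod n) = b}"
    by (simp add: space_B conc_def)
  then show "{\<omega> \<in> space B. conc k \<omega> i = b} \<in> sets B" using component_sets by simp
qed

lemma conc_sets: "A \<in> sets (shift_borel S t) \<Longrightarrow> {\<omega>. conc k \<omega> \<in> A} \<in> sets B"
  using measurable_sets[OF conc_measurable, of A k] by (simp add: space_B vimage_def)

lemma pair_measurable:
  "(\<lambda>(k, \<omega>). conc (k mod n) \<omega>) \<in> measurable (measure_pmf (pmf_of_set {..<n}) \<Otimes>\<^sub>M B) (shift_borel S t)"
  (is "?U \<in> measurable ?\<Omega> _")
proof (rule measurable_to_shift_borel[OF countable_S])
  fix i b
  have eq: "{x \<in> space ?\<Omega>. ?U x i = b} = (\<Union>k. {k} \<times> {\<omega>. conc (k mod n) \<omega> \<in> coord S t i b})"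
    by (auto simp: space_pair_measure space_B coord_def conc_mem)
  have "{k} \<times> {\<omega>. conc (k mod n) \<omega> \<in> coord S t i b} \<in> sets ?\<Omega>" for k
    by (intro pair_measureI conc_sets coord_sets) simp
  then show "{x \<in> space ?\<Omega>. ?U x i = b} \<in> sets ?\<Omega>" unfolding eq by (intro sets.countable_UN) auto
qed (auto simp: conc_mem)

lemma mu_sets: "sets \<mu> = sets (shift_borel S t)" and mu_space: "space \<mu> = X"
  by (simp_all add: \<mu>_def space_shift_borel)

lemma mu_prob: "prob_space \<mu>"
  unfolding \<mu>_def by (rule KB.prob_space_distr[OF pair_measurable])

lemma measure_mu:
  assumes A: "A \<in> sets (shift_borel S t)"
  shows "measure \<mu> A = (\<Sum>k<n. \<nu> k A) / real n"
proof -
  let ?\<Omega> = "measure_pmf (pmf_of_set {..<n}) \<Otimes>\<^sub>M B"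
  have ne: "{..<n} \<noteq> {}" using n_pos by (simp add: lessThan_empty_iff)
  define U where "U = (\<lambda>(k, \<omega>). conc (k mod n) \<omega>) -` A \<inter> space ?\<Omega>"
  have U: "U \<in> sets ?\<Omega>" unfolding U_def by (rule measurable_sets[OF pair_measurable A])
  have "emeasure \<mu> A = emeasure ?\<Omega> U"
    unfolding \<mu>_def U_def by (rule emeasure_distr[OF pair_measurable A])
  also have "\<dots> = (\<integral>\<^sup>+k. emeasure B (Pair k -` U) \<partial>measure_pmf (pmf_of_set {..<n}))"
    by (rule B.emeasure_pair_measure_alt[OF U])
  also have "\<dots> = (\<integral>\<^sup>+k. ennreal (\<nu> (k mod n) A) \<partial>measure_pmf (pmf_of_set {..<n}))"
    by (intro nn_integral_cong) (simp add: \<nu>_def U_def space_pair_measure space_B B.emeasure_eq_measure vimage_def)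
  also have "\<dots> = (\<Sum>k<n. ennreal (\<nu> (k mod n) A)) / real (card {..<n})"
    using ne by (subst nn_integral_pmf_of_set) (auto simp: ennreal_of_nat_eq_real_of_nat)
  also have "(\<Sum>k<n. ennreal (\<nu> (k mod n) A)) = (\<Sum>k<n. ennreal (\<nu> k A))" by (intro sum.cong) auto
  also have "\<dots> = ennreal (\<Sum>k<n. \<nu> k A)" by (intro sum_ennreal) (simp add: \<nu>_def)
  also have "ennreal (\<Sum>k<n. \<nu> k A) / real (card {..<n}) = ennreal ((\<Sum>k<n. \<nu> k A) / real n)"
    using n_pos by (simp add: divide_ennreal ennreal_of_nat_eq_real_of_nat \<nu>_def sum_nonneg)
  finally show ?thesis
    by (simp add: Sigma_Algebra.measure_def[of \<mu>] \<nu>_def sum_nonneg)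
qed

text \<open>Advancing the phase by a full block drops the first word, and an independent identically
  distributed sequence keeps its law under this.\<close>

lemma nu_periodic:
  assumes A: "A \<in> sets (shift_borel S t)"
  shows "\<nu> n A = \<nu> 0 A"
proof -
  define \<tau> where "\<tau> = (\<lambda>\<omega>::nat \<Rightarrow> (nat \<Rightarrow> 'a). \<lambda>q. \<omega> (Suc q))"
  have d: "distr B B \<tau> = B"
    using distr_PiM_reindex[of UNIV "\<lambda>_. measure_pmf p" Suc UNIV]
    by (simp add: B_def \<tau>_def prob_space_measure_pmf restrict_UNIV)
  have tau: "\<tau> \<in> measurable B B"
    unfolding B_def \<tau>_def by (rule measurable_PiM_single') (auto intro!: measurable_component_singleton simp: space_PiM PiE_UNIV_domain)
  have "conc 0 (\<tau> \<omega>) = conc n \<omega>" for \<omega>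
    using n_pos by (auto simp: conc_def \<tau>_def)
  then have "{\<omega>. conc n \<omega> \<in> A} = \<tau> -` {\<omega>. conc 0 \<omega> \<in> A} \<inter> space B" by (auto simp: space_B)
  then show ?thesis
    unfolding \<nu>_def using measure_distr[OF tau conc_sets[OF A, of 0]] by (simp add: d)
qed

text \<open>The shift raises the phase by one, so the average over a full cycle of phases only
  exchanges \<open>\<nu> 0\<close> for \<open>\<nu> n\<close>.\<close>

lemma mu_invariant: "\<mu> \<in> invariant_measures S t"
  unfolding invariant_measures_def
proof (intro CollectI conjI ballI mu_sets mu_prob)
  interpret mu: prob_space \<mu> by (rule mu_prob)
  fix A assume "A \<in> sets \<mu>"
  then have A: "A \<in> sets (shift_borel S t)" by (simp add: mu_sets)
  define A' where "A' = shift_map -` A \<inter> space \<mu>"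
  have A': "A' \<in> sets (shift_borel S t)"
    using measurable_sets[OF shift_measurable[OF countable_S] A] by (simp add: A'_def mu_space space_shift_borel)
  have "conc k \<omega> \<in> A' \<longleftrightarrow> conc (Suc k) \<omega> \<in> A" for k \<omega>
    using conc_shift[of 1 k \<omega>] by (simp add: A'_def mu_space conc_mem)
  then have "\<nu> k A' = \<nu> (Suc k) A" for k by (simp add: \<nu>_def)
  then have "(\<Sum>k<n. \<nu> k A') = (\<Sum>k<n. \<nu> (Suc k) A)" by simp
  also have "\<dots> = (\<Sum>k<n. \<nu> k A)"
  proof -
    have "\<nu> 0 A + (\<Sum>k<n. \<nu> (Suc k) A) = (\<Sum>k<n. \<nu> k A) + \<nu> n A"
      using sum.lessThan_Suc_shift[of "\<lambda>k. \<nu> k A" n] sum.lessThan_Suc[of "\<lambda>k. \<nu> k A" n] by linarith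
    then show ?thesis using nu_periodic[OF A] by simp
  qed
  finally have "measure \<mu> A' = measure \<mu> A" by (simp add: measure_mu A A')
  then show "emeasure \<mu> (shift_map -` A \<inter> space \<mu>) = emeasure \<mu> A"
    by (simp add: mu.emeasure_eq_measure A'_def)
qed

text \<open>By the Bowen property the first letter determines \<open>ln (f 1)\<close> up to
  \<open>V\<close>, and it is one of the finitely many letters of words in \<open>Y\<close>.\<close>

lemma ln_f_1_bounded:
  obtains b where "\<And>k \<omega>. \<bar>ln (f 1 (conc k \<omega>))\<bar> \<le> b"
proof
  fix k \<omega>
  define y where "y = word (\<omega> (k div n))"
  define r where "r = k mod n"
  have y: "y \<in> Y" "y \<in> X" unfolding y_def by (rule word_Y, rule Y_mem(1)[OF word_Y])
  have r: "r < n" using n_pos by (simp add: r_def)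
  have "ln (f 1 ((shift_map ^^ r) y)) \<le> ln (f 1 (conc k \<omega>)) + V"
  proof (rule bowen[OF order_refl shift_pow_mem[OF y(2)] conc_mem])
    fix i :: nat assume "i < 1"
    then show "(shift_map ^^ r) y i = conc k \<omega> i" by (simp add: shift_pow conc_def y_def r_def)
  qed
  moreover have "ln (f 1 (conc k \<omega>)) \<le> K" by (rule f_ub[OF conc_mem])
  moreover have "\<bar>ln (f 1 ((shift_map ^^ r) y))\<bar> \<le> (\<Sum>y\<in>Y. \<Sum>r<n. \<bar>ln (f 1 ((shift_map ^^ r) y))\<bar>)"
  proof -
    have "\<bar>ln (f 1 ((shift_map ^^ r) y))\<bar> \<le> (\<Sum>r<n. \<bar>ln (f 1 ((shift_map ^^ r) y))\<bar>)"
      using r by (intro member_le_sum) auto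
    also have "\<dots> \<le> (\<Sum>y\<in>Y. \<Sum>r<n. \<bar>ln (f 1 ((shift_map ^^ r) y))\<bar>)"
      by (rule member_le_sum[OF y(1) _ Y_fin]) (simp add: sum_nonneg)
    finally show ?thesis .
  qed
  ultimately show "\<bar>ln (f 1 (conc k \<omega>))\<bar> \<le> K + V + (\<Sum>y\<in>Y. \<Sum>r<n. \<bar>ln (f 1 ((shift_map ^^ r) y))\<bar>)"
    using K_nonneg V_nonneg by linarith
qed

lemma ln_f_integrable:
  assumes m: "1 \<le> m"
  shows "integrable \<mu> (\<lambda>x. ln (f m x))"
proof -
  interpret pr: almost_additive_process \<mu> shift_map "\<lambda>n x. ln (f n x)" C
    by (rule invariant_process(1)[OF mu_invariant])
  obtain b where b: "\<And>k \<omega>. \<bar>ln (f 1 (conc k \<omega>))\<bar> \<le> b" by (rule ln_f_1_bounded) (erule that)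
  have meas: "(\<lambda>x. ln (f 1 x)) \<in> borel_measurable (shift_borel S t)"
    using continuous_imp_measurable[OF f_cont[of 1]] by measurable
  have "integrable \<mu> (\<lambda>x. ln (f 1 x))"
    unfolding \<mu>_def
  proof (subst integrable_distr_eq[OF pair_measurable meas], rule KB.integrable_const_bound[where B = b])
    show "(\<lambda>x. ln (f 1 (case x of (k, \<omega>) \<Rightarrow> conc (k mod n) \<omega>))) \<in> borel_measurable (measure_pmf (pmf_of_set {..<n}) \<Otimes>\<^sub>M B)"
      using measurable_comp[OF pair_measurable meas] by (simp add: comp_def)
  qed (use b in auto)
  then show ?thesis by (rule pr.g_integrable[OF _ m])
qed

text \<open>Every block costs \<open>V\<close> for replacing the concatenation by its word and
  \<open>C\<close> for the cut.\<close>

lemma ln_f_conc_0: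
  assumes "1 \<le> m"
  shows "(\<Sum>q<m. ln (f n (word (\<omega> q)))) - real m * (V + C) \<le> ln (f (m * n) (conc 0 \<omega>))"
  using assms
proof (induction m rule: dec_induct)
  case base
  have "ln (f n (word (\<omega> 0))) \<le> ln (f n (conc 0 \<omega>)) + V"
    using conc_block[of _ 0 \<omega>] Y_mem(1)[OF word_Y] by (intro bowen n_pos conc_mem) auto
  then show ?case using C_nonneg by simp
next
  case (step m)
  have "ln (f n (word (\<omega> m))) \<le> ln (f n (conc (m * n) \<omega>)) + V"
    using conc_block[of _ m \<omega>] Y_mem(1)[OF word_Y] by (intro bowen n_pos conc_mem) auto
  moreover have "ln (f (m * n) (conc 0 \<omega>)) + ln (f n ((shift_map ^^ (m * n)) (conc 0 \<omega>))) - C \<le> ln (f (m * n + n) (conc 0 \<omega>))"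
    using step n_pos by (intro f_lower conc_mem) auto
  moreover have "m * n + n = Suc m * n" by simp
  ultimately show ?case using step.IH by (simp add: conc_shift algebra_simps)
qed

text \<open>Reduce phase \<open>k\<close> to phase 0 by cutting the segment of length
  \<open>m * n + k\<close> in two ways: after \<open>m * n\<close> steps from below, after
  \<open>k\<close> steps from above. The two short pieces are bounded by a constant independent of
  \<open>m\<close>, \<open>k\<close> and the words.\<close>

lemma ln_f_conc:
  obtains c where "\<And>m k \<omega>. 1 \<le> m \<Longrightarrow> k < n \<Longrightarrow>
    (\<Sum>q<m. ln (f n (word (\<omega> q)))) - real m * (V + C) - c \<le> ln (f (m * n) (conc k \<omega>))"
proof
  define b where "b = V + (\<Sum>y\<in>Y. \<Sum>k\<in>{1..n}. \<bar>ln (f k y)\<bar>)"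
  have b0: "0 \<le> b" unfolding b_def using V_nonneg by (intro add_nonneg_nonneg sum_nonneg) auto
  have KC: "0 \<le> K + C" using K_nonneg C_nonneg by simp
  fix m k \<omega> assume m: "(1::nat) \<le> m" and k: "k < n"
  have "ln (f (m * n) (conc 0 \<omega>)) - (b + (K + C) * real n + 2 * C) \<le> ln (f (m * n) (conc k \<omega>))"
  proof (cases "k = 0")
    case True
    have "0 \<le> (K + C) * real n" using KC by simp
    then show ?thesis using True b0 C_nonneg by simp
  next
    case False
    then have k1: "1 \<le> k" by simp
    have mn: "1 \<le> m * n" using m n_pos by simp
    have y: "word (\<omega> m) \<in> Y" by (rule word_Y)
    have "\<bar>ln (f k (word (\<omega> m)))\<bar> \<le> (\<Sum>k\<in>{1..n}. \<bar>ln (f k (word (\<omega> m)))\<bar>)"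
      using k k1 by (intro member_le_sum) auto
    also have "\<dots> \<le> (\<Sum>y\<in>Y. \<Sum>k\<in>{1..n}. \<bar>ln (f k y)\<bar>)"
      by (rule member_le_sum[OF y _ Y_fin]) (simp add: sum_nonneg)
    finally have "- b + V \<le> ln (f k (word (\<omega> m)))" unfolding b_def by linarith
    moreover have "ln (f k (word (\<omega> m))) \<le> ln (f k (conc (m * n) \<omega>)) + V"
      using conc_block[of _ m \<omega>] Y_mem(1)[OF y] k by (intro bowen k1 conc_mem) auto
    moreover have "ln (f (m * n) (conc 0 \<omega>)) + ln (f k ((shift_map ^^ (m * n)) (conc 0 \<omega>))) - C \<le> ln (f (m * n + k) (conc 0 \<omega>))"
      by (intro f_lower conc_mem mn k1)
    moreover have "ln (f (k + m * n) (conc 0 \<omega>)) \<le> ln (f k (conc 0 \<omega>)) + ln (f (m * n) ((shift_map ^^ k) (conc 0 \<omega>))) + C"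
      by (intro f_upper conc_mem mn k1)
    moreover have "ln (f k (conc 0 \<omega>)) \<le> (K + C) * real k" by (intro f_ub_n k1 conc_mem)
    moreover have "(K + C) * real k \<le> (K + C) * real n" using k KC by (intro mult_left_mono) auto
    moreover have "m * n + k = k + m * n" by simp
    ultimately show ?thesis by (simp add: conc_shift)
  qed
  then show "(\<Sum>q<m. ln (f n (word (\<omega> q)))) - real m * (V + C) - (b + (K + C) * real n + 2 * C) \<le> ln (f (m * n) (conc k \<omega>))"
    using ln_f_conc_0[OF m, of \<omega>] by linarith
qed

lemma word_sum:
  fixes h :: "(nat \<Rightarrow> 'a) \<Rightarrow> real"
  shows "integrable B (\<lambda>\<omega>. \<Sum>q\<in>J. h (word (\<omega> q)))"
    and "finite J \<Longrightarrow> (\<integral>\<omega>. (\<Sum>q\<in>J. h (word (\<omega> q))) \<partial>B) = real (card J) * (\<Sum>y\<in>Y. h y * (f n y / Z))"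
proof -
  note i = integral_component[of "\<lambda>w. h (word w)"]
  show "integrable B (\<lambda>\<omega>. \<Sum>q\<in>J. h (word (\<omega> q)))"
    by (intro Bochner_Integration.integrable_sum i(1))
  have "(\<integral>\<omega>. (\<Sum>q\<in>J. h (word (\<omega> q))) \<partial>B) = (\<Sum>q\<in>J. \<integral>\<omega>. h (word (\<omega> q)) \<partial>B)"
    by (intro Bochner_Integration.integral_sum i(1))
  also have "\<dots> = (\<Sum>q\<in>J. \<Sum>y\<in>Y. h y * (f n y / Z))"
    unfolding i(2) by (intro sum.cong refl) (simp add: word_def)
  finally show "(\<integral>\<omega>. (\<Sum>q\<in>J. h (word (\<omega> q))) \<partial>B) = real (card J) * (\<Sum>y\<in>Y. h y * (f n y / Z))" by simp
qed

text \<open>Integrating the pointwise bound gives \<open>E - V - C\<close> per block, up to a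
  constant that vanishes as the number of blocks grows.\<close>

lemma energy_ge:
  assumes L: "(\<lambda>m. (\<integral>x. ln (f m x) \<partial>\<mu>) / real m) \<longlonglongrightarrow> L"
  shows "(E - V - C) / real n \<le> L"
proof -
  obtain c where c: "\<And>m k \<omega>. 1 \<le> m \<Longrightarrow> k < n \<Longrightarrow>
    (\<Sum>q<m. ln (f n (word (\<omega> q)))) - real m * (V + C) - c \<le> ln (f (m * n) (conc k \<omega>))"
    by (rule ln_f_conc) (erule that)
  have lower: "real m * (E - V - C) - c \<le> (\<integral>x. ln (f (m * n) x) \<partial>\<mu>)" if m: "1 \<le> m" for m
  proof -
    let ?\<Omega> = "measure_pmf (pmf_of_set {..<n}) \<Otimes>\<^sub>M B"
    let ?U = "\<lambda>(k, \<omega>). conc (k mod n) \<omega>"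
    let ?G = "\<lambda>\<omega>. (\<Sum>q<m. ln (f n (word (\<omega> q)))) - real m * (V + C) - c"
    have mn: "1 \<le> m * n" using m n_pos by simp
    have meas: "(\<lambda>x. ln (f (m * n) x)) \<in> borel_measurable (shift_borel S t)"
      using continuous_imp_measurable[OF f_cont[OF mn]] by measurable
    have iU: "integrable ?\<Omega> (\<lambda>x. ln (f (m * n) (?U x)))"
      using ln_f_integrable[OF mn] unfolding \<mu>_def by (subst (asm) integrable_distr_eq[OF pair_measurable meas])
    have iG: "integrable B ?G" using word_sum(1)[where h = "\<lambda>y. ln (f n y)" and J = "{..<m}"] by simp
    have snd: "distr ?\<Omega> B snd = B"
    proof (rule measure_eqI)
      fix A assume "A \<in> sets (distr ?\<Omega> B snd)"
      then have A: "A \<in> sets B" by simp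
      have "snd -` A \<inter> space ?\<Omega> = UNIV \<times> A"
        using sets.sets_into_space[OF A] by (auto simp: space_pair_measure)
      then show "emeasure (distr ?\<Omega> B snd) A = emeasure B A"
        using A by (simp add: emeasure_distr B.emeasure_pair_measure_Times)
    qed simp
    have iG': "integrable ?\<Omega> (\<lambda>x. ?G (snd x))"
      using iG by (intro integrable_distr[OF measurable_snd]) (simp add: snd)
    have "(\<integral>x. ?G (snd x) \<partial>?\<Omega>) = (\<integral>\<omega>. ?G \<omega> \<partial>B)"
      using integral_distr[of snd ?\<Omega> B ?G] iG by (simp add: snd)
    also have "\<dots> = real m * E - real m * (V + C) - c"
      using word_sum[where h = "\<lambda>y. ln (f n y)" and J = "{..<m}"] by (simp add: B.prob_space E_def)
    finally have "real m * (E - V - C) - c = (\<integral>x. ?G (snd x) \<partial>?\<Omega>)" by (simp add: algebra_simps)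
    also have "\<dots> \<le> (\<integral>x. ln (f (m * n) (?U x)) \<partial>?\<Omega>)"
      using c[OF m] n_pos by (intro integral_mono iG' iU) (auto simp: case_prod_beta)
    also have "\<dots> = (\<integral>x. ln (f (m * n) x) \<partial>\<mu>)"
      unfolding \<mu>_def by (rule integral_distr[OF pair_measurable meas, symmetric])
    finally show ?thesis .
  qed
  have sm: "strict_mono (\<lambda>m. m * n)" using n_pos by (auto simp: strict_mono_def)
  have lim1: "(\<lambda>m. (\<integral>x. ln (f (m * n) x) \<partial>\<mu>) / real (m * n)) \<longlonglongrightarrow> L"
    using LIMSEQ_subseq_LIMSEQ[OF L sm] by (simp add: comp_def)
  have lim2: "(\<lambda>m. (E - V - C) / real n - (c / real n) / real m) \<longlonglongrightarrow> (E - V - C) / real n - 0"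
    by (intro tendsto_intros lim_const_over_n)
  have "\<exists>N. \<forall>m\<ge>N. (E - V - C) / real n - (c / real n) / real m \<le> (\<integral>x. ln (f (m * n) x) \<partial>\<mu>) / real (m * n)"
  proof (intro exI[of _ 1] allI impI)
    fix m :: nat assume m: "1 \<le> m"
    have "(E - V - C) / real n - (c / real n) / real m = (real m * (E - V - C) - c) / real (m * n)"
      using m n_pos by (simp add: field_simps)
    also have "\<dots> \<le> (\<integral>x. ln (f (m * n) x) \<partial>\<mu>) / real (m * n)"
      using lower[OF m] by (intro divide_right_mono) auto
    finally show "(E - V - C) / real n - (c / real n) / real m \<le> (\<integral>x. ln (f (m * n) x) \<partial>\<mu>) / real (m * n)" .
  qed
  from LIMSEQ_le[OF lim2 lim1 this] show ?thesis by simp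
qed

section \<open>Entropy of the measure on concatenations\<close>

definition "letters = (\<Union>y\<in>Y. y ` {..<n})"
definition "rest = {x \<in> X. x 0 \<notin> letters}"
text \<open>A finite partition that still distinguishes all letters occurring in concatenations;
  \<open>rest\<close> is never visited by them. The empty set is removed because
  \<open>partition_on\<close> forbids it.\<close>

definition "P = insert rest (coord S t 0 ` letters) - {{}}"

lemma letters_finite: "finite letters"
  using Y_fin by (auto simp: letters_def)

lemma conc_letters: "conc k \<omega> i \<in> letters"
  unfolding conc_def letters_def using n_pos
  by (intro UN_I[where a = "word (\<omega> ((i + k) div n))"] word_Y imageI) simp

lemma P_partition: "finite P" "P \<subseteq> sets \<mu>" "partition_on (space \<mu>) P"
proof -
  show "finite P" using letters_finite by (simp add: P_def)
  have "{x \<in> X. x 0 \<in> letters} \<in> sets (shift_borel S t)"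
    by (rule letters_sets) (simp add: letters_finite countable_finite)
  then have "space (shift_borel S t) - {x \<in> X. x 0 \<in> letters} \<in> sets (shift_borel S t)" by (rule sets.compl_sets)
  moreover have "space (shift_borel S t) - {x \<in> X. x 0 \<in> letters} = rest" by (auto simp: rest_def space_shift_borel)
  ultimately have "rest \<in> sets (shift_borel S t)" by simp
  then show "P \<subseteq> sets \<mu>" by (auto simp: P_def mu_sets coord_sets)
  show "partition_on (space \<mu>) P"
    unfolding mu_space
  proof (rule partition_onI)
    show "\<Union> P = X" by (auto simp: P_def rest_def coord_def)
    show "disjnt A A'" if "A \<in> P" "A' \<in> P" "A \<noteq> A'" for A A'
      using that by (auto simp: P_def rest_def coord_def disjnt_def)
  qed (auto simp: P_def)
qed

lemma P_coord: "A \<in> P \<Longrightarrow> x \<in> A \<Longrightarrow> x 0 \<in> letters \<Longrightarrow> A = coord S t 0 (x 0)"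
  by (auto simp: P_def rest_def coord_def)

lemma sum_p: "(\<Sum>y\<in>Y. f n y / Z) = 1"
  using Z_pos by (simp add: sum_divide_distrib[symmetric] Z_def)

lemma measure_p_word: "y \<in> Y \<Longrightarrow> measure (measure_pmf p) {w. word w = y} = f n y / Z"
proof -
  assume y: "y \<in> Y"
  have "measure (measure_pmf p) {w. word w = y} = measure (measure_pmf p) ({w. word w = y} \<inter> set_pmf p)"
    by (rule measure_Int_set_pmf[symmetric])
  also have "{w. word w = y} \<inter> set_pmf p = {y}" using y by (auto simp: set_p word_def)
  finally show ?thesis using y by (simp add: measure_pmf_single pmf_p)
qed

lemma measure_words:
  "measure B {\<omega>'. \<forall>q\<in>{1..Q}. word (\<omega>' q) = word (\<omega> q)} = (\<Prod>q\<in>{1..Q}. f n (word (\<omega> q)) / Z)"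
proof -
  have "{\<omega>' \<in> space B. \<forall>q\<in>{1..Q}. \<omega>' q \<in> {w. word w = word (\<omega> q)}} = {\<omega>'. \<forall>q\<in>{1..Q}. word (\<omega>' q) = word (\<omega> q)}"
    by (simp add: space_B)
  moreover have "emeasure B {\<omega>' \<in> space B. \<forall>q\<in>{1..Q}. \<omega>' q \<in> {w. word w = word (\<omega> q)}} =
      (\<Prod>q\<in>{1..Q}. emeasure (measure_pmf p) {w. word w = word (\<omega> q)})"
    unfolding B_def by (rule P.emeasure_PiM_Collect) auto
  moreover have "(\<Prod>q\<in>{1..Q}. emeasure (measure_pmf p) {w. word w = word (\<omega> q)}) = (\<Prod>q\<in>{1..Q}. ennreal (f n (word (\<omega> q)) / Z))"
    by (intro prod.cong refl) (simp add: measure_pmf.emeasure_eq_measure measure_p_word word_Y)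
  moreover have "\<dots> = ennreal (\<Prod>q\<in>{1..Q}. f n (word (\<omega> q)) / Z)"
    using f_Y_pos[OF word_Y] Z_pos by (intro prod_ennreal) (simp add: less_imp_le)
  moreover have "0 \<le> (\<Prod>q\<in>{1..Q}. f n (word (\<omega> q)) / Z)"
    using f_Y_pos[OF word_Y] Z_pos by (intro prod_nonneg) (simp add: less_imp_le)
  ultimately show ?thesis by (simp add: Sigma_Algebra.measure_def)
qed

text \<open>Jensen's inequality for the convex function \<open>x ln x\<close>, proved termwise as in
  Gibbs' inequality. Thus averaging over the phases does not lower the entropy.\<close>

lemma average_xlogx_le:
  fixes v :: "nat \<Rightarrow> real"
  assumes v: "\<And>k. 0 \<le> v k"
  shows "real n * ((\<Sum>k<n. v k) / real n * ln ((\<Sum>k<n. v k) / real n)) \<le> (\<Sum>k<n. v k * ln (v k))"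
proof -
  define m where "m = (\<Sum>k<n. v k) / real n"
  have m: "real n * m = (\<Sum>k<n. v k)" using n_pos by (simp add: m_def)
  have m0: "0 \<le> m" using v by (simp add: m_def sum_nonneg)
  have "v k * ln m \<le> v k * ln (v k) + (m - v k)" if "k < n" for k
  proof (cases "v k = 0")
    case True
    then show ?thesis using m0 by simp
  next
    case False
    then have vk: "0 < v k" using v[of k] by simp
    have "v k \<le> (\<Sum>k<n. v k)" using v that by (intro member_le_sum) auto
    then have mp: "0 < m" using vk n_pos by (simp add: m_def)
    have "v k * ln m = v k * ln (v k) + v k * ln (m / v k)" using vk mp by (simp add: ln_div algebra_simps)
    also have "v k * ln (m / v k) \<le> v k * (m / v k - 1)" using vk mp by (intro mult_left_mono ln_le_minus_one) auto
    also have "\<dots> = m - v k" using vk by (simp add: field_simps)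
    finally show ?thesis by simp
  qed
  then have "(\<Sum>k<n. v k * ln m) \<le> (\<Sum>k<n. v k * ln (v k) + (m - v k))" by (intro sum_mono) auto
  also have "\<dots> = (\<Sum>k<n. v k * ln (v k)) + (real n * m - (\<Sum>k<n. v k))" by (simp add: sum.distrib sum_subtractf)
  also have "\<dots> = (\<Sum>k<n. v k * ln (v k))" using m by simp
  finally have "(\<Sum>k<n. v k) * ln m \<le> (\<Sum>k<n. v k * ln (v k))" by (simp add: sum_distrib_right)
  moreover have "real n * (m * ln m) = (\<Sum>k<n. v k) * ln m" unfolding m[symmetric] by simp
  ultimately show ?thesis unfolding m_def by linarith
qed

text \<open>At phase \<open>k\<close> the block with index 0 may be cut at its beginning, but blocks
  1 to \<open>Q\<close> lie entirely within the first \<open>Suc Q * n\<close> times, so the name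
  spells out their words.\<close>

lemma words_eq_of_atom:
  assumes th: "\<theta> \<in> names P (Suc Q * n)" and k: "k < n"
    and w: "conc k \<omega> \<in> atom \<mu> shift_map (Suc Q * n) \<theta>" "conc k \<omega>' \<in> atom \<mu> shift_map (Suc Q * n) \<theta>"
    and q: "q \<in> {1..Q}"
  shows "word (\<omega>' q) = word (\<omega> q)"
proof (rule Y_eqI[OF word_Y word_Y])
  fix i assume i: "i < n"
  define j where "j = q * n + i - k"
  have "n \<le> q * n" using q by simp
  then have jk: "j + k = q * n + i" using k unfolding j_def by linarith
  have "q * n + i < Suc q * n" using i by simp
  also have "\<dots> \<le> Suc Q * n" using q by (intro mult_le_mono1) simp
  finally have j: "j < Suc Q * n" using jk by linarith
  then have tj: "\<theta> j \<in> P" using th by auto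
  have c: "coord S t 0 ((conc (k + j) \<omega>'') 0) = \<theta> j" if "conc k \<omega>'' \<in> atom \<mu> shift_map (Suc Q * n) \<theta>" for \<omega>''
  proof -
    have "(shift_map ^^ j) (conc k \<omega>'') \<in> \<theta> j" using that j by (simp add: atom_def)
    then have "conc (k + j) \<omega>'' \<in> \<theta> j" by (simp only: conc_shift)
    from P_coord[OF tj this conc_letters] show ?thesis by simp
  qed
  have "conc (k + j) \<omega>' \<in> coord S t 0 ((conc (k + j) \<omega>') 0)" by (simp add: coord_def conc_mem)
  then have "conc (k + j) \<omega>' \<in> coord S t 0 ((conc (k + j) \<omega>) 0)" by (simp only: c[OF w(1)] c[OF w(2)])
  then have eq: "conc (k + j) \<omega>' 0 = conc (k + j) \<omega> 0" by (simp add: coord_def)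
  have "conc (k + j) \<omega>'' 0 = word (\<omega>'' q) i" for \<omega>''
  proof -
    have "(k + j) div n = q" "(k + j) mod n = i" using jk i by (simp_all add: add.commute)
    then show ?thesis by (simp add: conc_def)
  qed
  then show "word (\<omega>' q) i = word (\<omega> q) i" using eq by simp
qed

text \<open>For a known phase, the atom of a concatenation lies in the event that \<open>Q\<close>
  independent words are prescribed, so its probability is at most the product of theirs. Taking
  logarithms and integrating gives \<open>Q\<close> times the entropy of \<open>p\<close>; convexity
  removes the phase.\<close>

lemma block_entropy_ge:
  "real Q * (ln Z - E) \<le> partition_entropy \<mu> (iterated_partition \<mu> shift_map P (Suc Q * n))"
proof -
  interpret pr: almost_additive_process \<mu> shift_map "\<lambda>n x. ln (f n x)" C
    by (rule invariant_process(1)[OF mu_invariant])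
  define m where "m = Suc Q * n"
  have m: "1 \<le> m" using n_pos by (simp add: m_def)
  let ?N = "names P m" and ?A = "atom \<mu> shift_map m"
  have fin: "finite ?N" by (rule finite_PiE) (simp_all add: P_partition)
  have A: "?A \<theta> \<in> sets (shift_borel S t)" if "\<theta> \<in> ?N" for \<theta>
    using pr.atom_events[OF P_partition that] by (simp add: mu_sets)
  have phase: "(\<Sum>\<theta>\<in>?N. \<nu> k (?A \<theta>) * ln (\<nu> k (?A \<theta>))) \<le> real Q * (E - ln Z)" if k: "k < n" for k
  proof -
    \<comment> \<open>The log-probability of words 1 to \<open>Q\<close>, while \<open>s\<close>
      below is the log-probability of the atom.\<close>
    define \<phi> where "\<phi> \<omega> = (\<Sum>q\<in>{1..Q}. ln (f n (word (\<omega> q))) - ln Z)" for \<omega>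
    define ev where "ev \<theta> = {\<omega>. conc k \<omega> \<in> ?A \<theta>}" for \<theta>
    have ev: "ev \<theta> \<in> sets B" if "\<theta> \<in> ?N" for \<theta> unfolding ev_def by (rule conc_sets[OF A[OF that]])
    have nu: "\<nu> k (?A \<theta>) = measure B (ev \<theta>)" for \<theta> by (simp add: \<nu>_def ev_def)
    define s where "s \<omega> = (\<Sum>\<theta>\<in>?N. ln (measure B (ev \<theta>)) * indicator (ev \<theta>) \<omega>)" for \<omega>
    have s_i: "integrable B (\<lambda>\<omega>. ln (measure B (ev \<theta>)) * indicator (ev \<theta>) \<omega>)" if "\<theta> \<in> ?N" for \<theta>
      by (intro integrable_real_mult_indicator ev that) simp
    have s_int: "integrable B s" unfolding s_def[abs_def] by (intro Bochner_Integration.integrable_sum s_i)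
    have "(\<integral>\<omega>. s \<omega> \<partial>B) = (\<Sum>\<theta>\<in>?N. \<integral>\<omega>. ln (measure B (ev \<theta>)) * indicator (ev \<theta>) \<omega> \<partial>B)"
      unfolding s_def by (intro Bochner_Integration.integral_sum s_i)
    also have "\<dots> = (\<Sum>\<theta>\<in>?N. \<nu> k (?A \<theta>) * ln (\<nu> k (?A \<theta>)))"
      by (intro sum.cong refl) (simp add: ev nu)
    finally have s_eq: "(\<integral>\<omega>. s \<omega> \<partial>B) = (\<Sum>\<theta>\<in>?N. \<nu> k (?A \<theta>) * ln (\<nu> k (?A \<theta>)))" .
    note ws = word_sum[where h = "\<lambda>y. ln (f n y) - ln Z" and J = "{1..Q}"]
    have phi_int: "integrable B \<phi>" unfolding \<phi>_def[abs_def] by (rule ws(1))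
    have "(\<integral>\<omega>. \<phi> \<omega> \<partial>B) = real Q * (\<Sum>y\<in>Y. (ln (f n y) - ln Z) * (f n y / Z))"
      unfolding \<phi>_def using ws(2) by simp
    also have "(\<Sum>y\<in>Y. (ln (f n y) - ln Z) * (f n y / Z)) = E - ln Z * (\<Sum>y\<in>Y. f n y / Z)"
      unfolding E_def left_diff_distrib sum_subtractf sum_distrib_left ..
    finally have phi_eq: "(\<integral>\<omega>. \<phi> \<omega> \<partial>B) = real Q * (E - ln Z)" by (simp add: sum_p)
    \<comment> \<open>On an atom of measure 0 the value of \<open>ln 0\<close> is a mere default,
      and the comparison of \<open>s\<close> with \<open>\<phi>\<close> would be unfounded
      there.\<close>
    have "AE \<omega> in B. \<forall>\<theta>\<in>?N. measure B (ev \<theta>) = 0 \<longrightarrow> \<omega> \<notin> ev \<theta>"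
    proof (rule AE_finite_allI[OF fin])
      fix \<theta> assume "\<theta> \<in> ?N"
      then have "ev \<theta> \<in> null_sets B" if "measure B (ev \<theta>) = 0"
        using that ev by (simp add: null_setsI B.emeasure_eq_measure)
      then show "AE \<omega> in B. measure B (ev \<theta>) = 0 \<longrightarrow> \<omega> \<notin> ev \<theta>"
        using AE_not_in by (cases "measure B (ev \<theta>) = 0") auto
    qed
    then have "AE \<omega> in B. s \<omega> \<le> \<phi> \<omega>"
    proof (rule AE_mp, intro AE_I2 impI)
      fix \<omega> assume nz: "\<forall>\<theta>\<in>?N. measure B (ev \<theta>) = 0 \<longrightarrow> \<omega> \<notin> ev \<theta>"
      have "conc k \<omega> \<in> space \<mu>" by (simp add: mu_space conc_mem)
      from pr.name_exists[OF P_partition this, of m] obtain \<theta> where th: "\<theta> \<in> ?N" "conc k \<omega> \<in> ?A \<theta>" by (rule bexE)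
      have "s \<omega> = (\<Sum>\<theta>\<in>{\<theta>}. ln (measure B (ev \<theta>)) * indicator (ev \<theta>) \<omega>)"
        unfolding s_def
      proof (rule sum.mono_neutral_right[OF fin])
        show "\<forall>\<theta>'\<in>?N - {\<theta>}. ln (measure B (ev \<theta>')) * indicator (ev \<theta>') \<omega> = 0"
        proof
          fix \<theta>' assume t': "\<theta>' \<in> ?N - {\<theta>}"
          have "\<omega> \<notin> ev \<theta>'"
          proof
            assume "\<omega> \<in> ev \<theta>'"
            then have "conc k \<omega> \<in> ?A \<theta>'" by (simp add: ev_def)
            then have "\<theta>' = \<theta>" using t' th by (intro atom_inj[OF P_partition(3)]) auto
            then show False using t' by simp
          qed
          then show "ln (measure B (ev \<theta>')) * indicator (ev \<theta>') \<omega> = 0" by simp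
        qed
      qed (use th in simp)
      then have s: "s \<omega> = ln (measure B (ev \<theta>))" using th by (simp add: ev_def)
      have pos: "0 < measure B (ev \<theta>)"
        using nz th by (auto simp: ev_def zero_less_measure_iff)
      have "ev \<theta> \<subseteq> {\<omega>'. \<forall>q\<in>{1..Q}. word (\<omega>' q) = word (\<omega> q)}"
      proof (intro subsetI CollectI ballI)
        fix \<omega>' q assume w: "\<omega>' \<in> ev \<theta>" "q \<in> {1..Q}"
        then have "conc k \<omega>' \<in> ?A \<theta>" by (simp add: ev_def)
        then show "word (\<omega>' q) = word (\<omega> q)"
          using words_eq_of_atom[OF th(1)[unfolded m_def] k _ _ w(2)] th(2) unfolding m_def by blast
      qed
      moreover have "{\<omega>'. \<forall>q\<in>{1..Q}. word (\<omega>' q) = word (\<omega> q)} \<in> sets B"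
      proof -
        have "{\<omega>'. \<forall>q\<in>{1..Q}. word (\<omega>' q) = word (\<omega> q)} = space B \<inter> (\<Inter>q\<in>{1..Q}. {\<omega>'. word (\<omega>' q) = word (\<omega> q)})"
          by (auto simp: space_B)
        moreover have "space B \<inter> (\<Inter>q\<in>{1..Q}. {\<omega>'. word (\<omega>' q) = word (\<omega> q)}) \<in> sets B"
        proof (cases "Q = 0")
          case False
          then show ?thesis by (intro sets.Int sets.top sets.finite_INT component_sets) auto
        qed simp
        ultimately show ?thesis by simp
      qed
      ultimately have le_prod: "measure B (ev \<theta>) \<le> (\<Prod>q\<in>{1..Q}. f n (word (\<omega> q)) / Z)"
        unfolding measure_words[symmetric] by (rule B.finite_measure_mono)
      have nz: "f n (word (\<omega> q)) \<noteq> 0" "Z \<noteq> 0" for q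
        using f_Y_pos[OF word_Y, of "\<omega> q"] Z_pos by auto
      have "s \<omega> \<le> ln (\<Prod>q\<in>{1..Q}. f n (word (\<omega> q)) / Z)"
        unfolding s using pos le_prod by (subst ln_le_cancel_iff) auto
      also have "\<dots> = (\<Sum>q\<in>{1..Q}. ln (f n (word (\<omega> q)) / Z))"
        by (intro ln_prod) (simp_all add: nz)
      also have "\<dots> = \<phi> \<omega>"
        unfolding \<phi>_def by (intro sum.cong refl) (simp add: ln_div nz)
      finally show "s \<omega> \<le> \<phi> \<omega>" .
    qed
    then have "(\<integral>\<omega>. s \<omega> \<partial>B) \<le> (\<integral>\<omega>. \<phi> \<omega> \<partial>B)" by (rule integral_mono_AE[OF s_int phi_int])
    then show ?thesis unfolding s_eq phi_eq .
  qed
  have "real n * (\<Sum>\<theta>\<in>?N. measure \<mu> (?A \<theta>) * ln (measure \<mu> (?A \<theta>))) =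
      (\<Sum>\<theta>\<in>?N. real n * ((\<Sum>k<n. \<nu> k (?A \<theta>)) / real n * ln ((\<Sum>k<n. \<nu> k (?A \<theta>)) / real n)))"
    unfolding sum_distrib_left by (intro sum.cong refl) (simp only: measure_mu A)
  also have "\<dots> \<le> (\<Sum>\<theta>\<in>?N. \<Sum>k<n. \<nu> k (?A \<theta>) * ln (\<nu> k (?A \<theta>)))"
    by (intro sum_mono average_xlogx_le) (simp add: \<nu>_def)
  also have "\<dots> = (\<Sum>k<n. \<Sum>\<theta>\<in>?N. \<nu> k (?A \<theta>) * ln (\<nu> k (?A \<theta>)))" by (rule sum.swap)
  also have "\<dots> \<le> (\<Sum>k<n. real Q * (E - ln Z))" by (intro sum_mono phase) simp
  also have "\<dots> = real n * (real Q * (E - ln Z))" by simp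
  finally have "(\<Sum>\<theta>\<in>?N. measure \<mu> (?A \<theta>) * ln (measure \<mu> (?A \<theta>))) \<le> real Q * (E - ln Z)"
    using n_pos by simp
  then show ?thesis unfolding m_def[symmetric] pr.H_eq[OF P_partition m] by (simp add: algebra_simps)
qed

lemma entropy_ge: "(ln Z - E) / real n \<le> entropy_wrt \<mu> shift_map P"
proof -
  interpret pr: almost_additive_process \<mu> shift_map "\<lambda>n x. ln (f n x)" C
    by (rule invariant_process(1)[OF mu_invariant])
  let ?H = "\<lambda>m. partition_entropy \<mu> (iterated_partition \<mu> shift_map P m)"
  have sm: "strict_mono (\<lambda>Q. Suc Q * n)" using n_pos by (auto simp: strict_mono_def)
  have lim1: "(\<lambda>Q. ?H (Suc Q * n) / real (Suc Q * n)) \<longlonglongrightarrow> entropy_wrt \<mu> shift_map P"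
    using LIMSEQ_subseq_LIMSEQ[OF pr.entropy_wrt_limit[OF P_partition] sm] by (simp add: comp_def)
  \<comment> \<open>Of \<open>Suc Q\<close> blocks only \<open>Q\<close> are known to be decoded;
    the loss factor tends to 1.\<close>
  have lim2: "(\<lambda>Q. (ln Z - E) / real n * (1 - inverse (real (Suc Q)))) \<longlonglongrightarrow> (ln Z - E) / real n * (1 - 0)"
    by (intro tendsto_intros LIMSEQ_inverse_real_of_nat)
  have "\<exists>N. \<forall>Q\<ge>N. (ln Z - E) / real n * (1 - inverse (real (Suc Q))) \<le> ?H (Suc Q * n) / real (Suc Q * n)"
  proof (intro exI[of _ 0] allI impI)
    fix Q
    have "(ln Z - E) / real n * (1 - inverse (real (Suc Q))) = real Q * (ln Z - E) / real (Suc Q * n)"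
      using n_pos by (simp add: field_simps)
    also have "\<dots> \<le> ?H (Suc Q * n) / real (Suc Q * n)"
      using block_entropy_ge[of Q] by (intro divide_right_mono) auto
    finally show "(ln Z - E) / real n * (1 - inverse (real (Suc Q))) \<le> ?H (Suc Q * n) / real (Suc Q * n)" .
  qed
  from LIMSEQ_le[OF lim2 lim1 this] show ?thesis by simp
qed

end

context bowen_potential
begin

text \<open>With probabilities proportional to \<open>f n\<close>, the terms \<open>E\<close> of the
  entropy bound and of the energy bound cancel and leave \<open>ln Z\<close>.\<close>

lemma exists_measure_ge:
  assumes "1 \<le> n" "finite Y" "Y \<noteq> {}" "Y \<subseteq> per a n"
  shows "\<exists>\<mu> P L. \<mu> \<in> invariant_measures S t \<and> integrable \<mu> (\<lambda>x. ln (f 1 x)) \<and>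
    (\<lambda>m. (\<integral>x. ln (f m x) \<partial>\<mu>) / real m) \<longlonglongrightarrow> L \<and>
    finite P \<and> P \<subseteq> sets \<mu> \<and> partition_on (space \<mu>) P \<and>
    (ln (\<Sum>y\<in>Y. f n y) - V - C) / real n \<le> entropy_wrt \<mu> shift_map P + L"
proof -
  interpret periodic_words S t f C V K a n Y by unfold_locales (use assms in auto)
  interpret pr: almost_additive_process \<mu> shift_map "\<lambda>n x. ln (f n x)" C
    by (rule invariant_process(1)[OF mu_invariant])
  have int: "integrable \<mu> (\<lambda>x. ln (f 1 x))" by (rule ln_f_integrable) simp
  obtain L where L: "(\<lambda>m. (\<integral>x. ln (f m x) \<partial>\<mu>) / real m) \<longlonglongrightarrow> L"
    using pr.average_converges[OF int] .
  have "(ln Z - E) / real n + (E - V - C) / real n \<le> entropy_wrt \<mu> shift_map P + L"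
    by (rule add_mono[OF entropy_ge energy_ge[OF L]])
  moreover have "(ln Z - E) / real n + (E - V - C) / real n = (ln (\<Sum>y\<in>Y. f n y) - V - C) / real n"
    by (simp add: Z_def add_divide_distrib[symmetric])
  ultimately show ?thesis using mu_invariant int L P_partition by fastforce
qed

section \<open>The variational principle\<close>

lemma integrals_agree:
  assumes mu: "\<mu> \<in> invariant_measures S t"
  shows "integral_of_limit f \<mu> = limit_of_integrals f \<mu>"
    and "\<not> integrable \<mu> (\<lambda>x. ln (f 1 x)) \<Longrightarrow> limit_of_integrals f \<mu> = - \<infinity>"
    and "integrable \<mu> (\<lambda>x. ln (f 1 x)) \<Longrightarrow> (\<lambda>n. (\<integral>x. ln (f n x) \<partial>\<mu>) / real n) \<longlonglongrightarrow> L \<Longrightarrow>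
      limit_of_integrals f \<mu> = ereal L"
proof -
  interpret pr: almost_additive_process \<mu> shift_map "\<lambda>n x. ln (f n x)" C by (rule invariant_process(1)[OF mu])
  have ub: "ln (f n x) \<le> (K + C) * real n" if "1 \<le> n" "x \<in> space \<mu>" for n x
    using f_ub_n[OF that(1)] that(2) invariant_process(2)[OF mu] by simp
  show "limit_of_integrals f \<mu> = - \<infinity>" if "\<not> integrable \<mu> (\<lambda>x. ln (f 1 x))"
    unfolding limit_of_integrals_def by (rule pr.extended_integrals_nonintegrable(2)[OF ub that])
  show lim: "limit_of_integrals f \<mu> = ereal L"
    if "integrable \<mu> (\<lambda>x. ln (f 1 x))" "(\<lambda>n. (\<integral>x. ln (f n x) \<partial>\<mu>) / real n) \<longlonglongrightarrow> L" for L
    unfolding limit_of_integrals_def by (rule pr.extended_integrals_integrable(2)[OF ub that])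
  show "integral_of_limit f \<mu> = limit_of_integrals f \<mu>"
  proof (cases "integrable \<mu> (\<lambda>x. ln (f 1 x))")
    case True
    obtain L where L: "(\<lambda>n. (\<integral>x. ln (f n x) \<partial>\<mu>) / real n) \<longlonglongrightarrow> L"
      using pr.average_converges[OF True] .
    have "integral_of_limit f \<mu> = ereal L"
      unfolding integral_of_limit_def by (rule pr.extended_integrals_integrable(1)[OF ub True L])
    then show ?thesis using lim[OF True L] by simp
  next
    case False
    have "integral_of_limit f \<mu> = - \<infinity>"
      unfolding integral_of_limit_def by (rule pr.extended_integrals_nonintegrable(1)[OF ub False])
    moreover have "limit_of_integrals f \<mu> = - \<infinity>"
      unfolding limit_of_integrals_def by (rule pr.extended_integrals_nonintegrable(2)[OF ub False])
    ultimately show ?thesis by simp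
  qed
qed

abbreviation "variational_sup \<equiv> Sup {measure_entropy \<mu> shift_map + limit_of_integrals f \<mu> |\<mu>.
    \<mu> \<in> invariant_measures S t \<and> limit_of_integrals f \<mu> \<noteq> - \<infinity>}"

text \<open>If the lower growth rate were below some \<open>s\<close> less than entropy plus energy,
  the partition functions would be at most \<open>exp (real n * s)\<close> for arbitrarily large
  \<open>n\<close>, which the upper bound on entropy plus energy excludes.\<close>

lemma variational_sup_le_liminf:
  assumes a: "a \<in> S"
  shows "variational_sup \<le> liminf (\<lambda>n. ln_ennreal (partition_function S t f a n) / ereal (real n))"
    (is "_ \<le> liminf ?\<zeta>")
proof (rule Sup_least)
  fix v assume "v \<in> {measure_entropy \<mu> shift_map + limit_of_integrals f \<mu> |\<mu>.
    \<mu> \<in> invariant_measures S t \<and> limit_of_integrals f \<mu> \<noteq> - \<infinity>}"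
  then obtain \<mu> where v: "v = measure_entropy \<mu> shift_map + limit_of_integrals f \<mu>"
    and mu: "\<mu> \<in> invariant_measures S t" and fin: "limit_of_integrals f \<mu> \<noteq> - \<infinity>" by blast
  interpret pr: almost_additive_process \<mu> shift_map "\<lambda>n x. ln (f n x)" C by (rule invariant_process(1)[OF mu])
  have int: "integrable \<mu> (\<lambda>x. ln (f 1 x))" using integrals_agree(2)[OF mu] fin by blast
  obtain L where L: "(\<lambda>n. (\<integral>x. ln (f n x) \<partial>\<mu>) / real n) \<longlonglongrightarrow> L"
    using pr.average_converges[OF int] .
  have lim: "limit_of_integrals f \<mu> = ereal L" by (rule integrals_agree(3)[OF mu int L])
  have "ereal (entropy_wrt \<mu> shift_map P) \<le> liminf ?\<zeta> - ereal L"
    if P: "finite P" "P \<subseteq> sets \<mu>" "partition_on (space \<mu>) P" for P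
  proof -
    have "ereal (entropy_wrt \<mu> shift_map P + L) \<le> liminf ?\<zeta>"
    proof (rule ccontr)
      assume "\<not> ?thesis"
      then have "liminf ?\<zeta> < ereal (entropy_wrt \<mu> shift_map P + L)" by simp
      then obtain s where s: "liminf ?\<zeta> < ereal s" "s < entropy_wrt \<mu> shift_map P + L"
        using ereal_dense2 by force
      have "\<exists>n\<ge>N. partition_function S t f a n \<le> ennreal (exp (real n * s))" for N
      proof (rule ccontr)
        assume no: "\<not> ?thesis"
        have "ereal s \<le> ?\<zeta> n" if n: "max 1 N \<le> n" for n
        proof -
          let ?z = "partition_function S t f a n"
          have gt: "ennreal (exp (real n * s)) < ?z" using no n by (meson max.bounded_iff not_le)
          show ?thesis
          proof (cases "?z = \<infinity>")
            case True
            then show ?thesis using n by (simp add: ln_ennreal_def)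
          next
            case False
            then obtain z where z: "?z = ennreal z" "0 \<le> z" by (cases ?z) auto
            have "exp (real n * s) < z" using gt z by (simp add: ennreal_less_iff)
            moreover from this have "0 < z" by (meson exp_gt_zero order_less_trans)
            ultimately have "real n * s < ln z" by (subst ln_exp[symmetric], subst ln_less_cancel_iff) auto
            then have "s \<le> ln z / real n" using n by (simp add: field_simps)
            then show ?thesis using z \<open>0 < z\<close> n by (simp add: ln_ennreal_def)
          qed
        qed
        then have "\<forall>\<^sub>F n in sequentially. ereal s \<le> ?\<zeta> n"
          unfolding eventually_sequentially by (intro exI[of _ "max 1 N"]) blast
        then have "ereal s \<le> liminf ?\<zeta>" by (rule Liminf_bounded)
        then show False using s(1) by simp
      qed
      from entropy_energy_le[OF mu int L a P this] show False using s(2) by simp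
    qed
    then show ?thesis by (simp add: ereal_le_minus_iff)
  qed
  then have "measure_entropy \<mu> shift_map \<le> liminf ?\<zeta> - ereal L"
    unfolding measure_entropy_def by (intro Sup_least) blast
  then show "v \<le> liminf ?\<zeta>" unfolding v lim by (simp add: ereal_le_minus_iff)
qed

text \<open>For \<open>r\<close> above the supremum, a partition function exceeding
  \<open>exp (real n * r + V + C)\<close> would already do so on finitely many periodic points, and
  these would produce a measure with value at least \<open>r\<close>. The surplus
  \<open>V + C\<close> does not affect the growth rate.\<close>

lemma limsup_le_variational_sup:
  "limsup (\<lambda>n. ln_ennreal (partition_function S t f a n) / ereal (real n)) \<le> variational_sup"
  (is "limsup ?\<zeta> \<le> _")
proof (rule ccontr)
  assume "\<not> ?thesis"
  then have "variational_sup < limsup ?\<zeta>" by simp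
  then obtain r where r: "variational_sup < ereal r" "ereal r < limsup ?\<zeta>" using ereal_dense2 by blast
  have Z_le: "partition_function S t f a n \<le> ennreal (exp (real n * r + V + C))" if n: "1 \<le> n" for n
  proof (rule ccontr)
    assume "\<not> ?thesis"
    then obtain Y where Y: "finite Y" "Y \<subseteq> per a n" "exp (real n * r + V + C) < (\<Sum>x\<in>Y. f n x)"
      using partition_function_le_iff[OF n, of "exp (real n * r + V + C)" a] by (auto simp: not_le)
    have "0 < (\<Sum>x\<in>Y. f n x)" using Y(3) by (meson exp_gt_zero order_less_trans)
    then have "Y \<noteq> {}" by auto
    from exists_measure_ge[OF n Y(1) this Y(2)] obtain \<mu> P L where
      mu: "\<mu> \<in> invariant_measures S t" and int: "integrable \<mu> (\<lambda>x. ln (f 1 x))"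
      and L: "(\<lambda>m. (\<integral>x. ln (f m x) \<partial>\<mu>) / real m) \<longlonglongrightarrow> L"
      and P: "finite P" "P \<subseteq> sets \<mu>" "partition_on (space \<mu>) P"
      and ge: "(ln (\<Sum>y\<in>Y. f n y) - V - C) / real n \<le> entropy_wrt \<mu> shift_map P + L" by blast
    have lim: "limit_of_integrals f \<mu> = ereal L" by (rule integrals_agree(3)[OF mu int L])
    have "real n * r + V + C < ln (\<Sum>y\<in>Y. f n y)"
      using Y(3) \<open>0 < (\<Sum>x\<in>Y. f n x)\<close> by (subst ln_exp[symmetric], subst ln_less_cancel_iff) auto
    then have "r \<le> (ln (\<Sum>y\<in>Y. f n y) - V - C) / real n" using n by (simp add: field_simps)
    then have "ereal r \<le> ereal (entropy_wrt \<mu> shift_map P) + ereal L" using ge by simp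
    also have "\<dots> \<le> measure_entropy \<mu> shift_map + limit_of_integrals f \<mu>"
      unfolding lim measure_entropy_def using P by (intro add_right_mono Sup_upper) blast
    also have "\<dots> \<le> variational_sup" by (intro Sup_upper CollectI exI[of _ \<mu>]) (simp add: mu lim)
    finally show False using r(1) by simp
  qed
  have "\<forall>\<^sub>F n in sequentially. ?\<zeta> n \<le> ereal (r + (V + C) / real n)"
    unfolding eventually_sequentially
  proof (intro exI[of _ 1] allI impI)
    fix n :: nat assume n: "1 \<le> n"
    let ?z = "partition_function S t f a n"
    from Z_le[OF n] have "?z \<noteq> \<infinity>" by (auto simp: top_unique)
    then obtain z where z: "?z = ennreal z" "0 \<le> z" by (cases ?z) auto
    show "?\<zeta> n \<le> ereal (r + (V + C) / real n)"
    proof (cases "z = 0")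
      case True
      then show ?thesis using z n by (simp add: ln_ennreal_def)
    next
      case False
      then have "0 < z" using z by simp
      moreover have "z \<le> exp (real n * r + V + C)" using Z_le[OF n] z by (simp add: ennreal_le_iff)
      ultimately have "ln z \<le> real n * r + V + C" by (metis ln_exp ln_le_cancel_iff exp_gt_zero)
      then have "ln z / real n \<le> r + (V + C) / real n" using n by (simp add: field_simps)
      then show ?thesis using z \<open>0 < z\<close> n by (simp add: ln_ennreal_def)
    qed
  qed
  then have "limsup ?\<zeta> \<le> limsup (\<lambda>n. ereal (r + (V + C) / real n))" by (rule Limsup_mono)
  also have "\<dots> = ereal r"
  proof (rule lim_imp_Limsup)
    have "(\<lambda>n. r + (V + C) / real n) \<longlonglongrightarrow> r + 0" by (intro tendsto_intros lim_const_over_n)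
    then show "(\<lambda>n. ereal (r + (V + C) / real n)) \<longlonglongrightarrow> ereal r" by simp
  qed simp
  finally show False using r(2) by simp
qed

text \<open>The two bounds squeeze the limit for every letter. \<open>THE\<close> then picks this
  value, since one letter suffices to make it unique.\<close>

lemma gurevich_pressure_eq:
  assumes "S \<noteq> {}"
  shows "gurevich_pressure S t f = variational_sup"
proof -
  have lim: "(\<lambda>n. ln_ennreal (partition_function S t f a n) / ereal (real n)) \<longlonglongrightarrow> variational_sup"
    if a: "a \<in> S" for a
  proof -
    let ?\<zeta> = "\<lambda>n. ln_ennreal (partition_function S t f a n) / ereal (real n)"
    have "liminf ?\<zeta> \<le> limsup ?\<zeta>" by (rule Liminf_le_Limsup) simp
    then have "liminf ?\<zeta> = variational_sup" "limsup ?\<zeta> = variational_sup"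
      using variational_sup_le_liminf[OF a] limsup_le_variational_sup[of a] by auto
    then show ?thesis by (intro Liminf_eq_Limsup) auto
  qed
  show ?thesis
    unfolding gurevich_pressure_def
  proof (rule the_equality)
    show "\<forall>a\<in>S. (\<lambda>n. ln_ennreal (partition_function S t f a n) / ereal (real n)) \<longlonglongrightarrow> variational_sup"
      using lim by blast
    fix Q assume Q: "\<forall>a\<in>S. (\<lambda>n. ln_ennreal (partition_function S t f a n) / ereal (real n)) \<longlonglongrightarrow> Q"
    obtain a where "a \<in> S" using assms by blast
    then show "Q = variational_sup" using Q lim by (intro LIMSEQ_unique[OF _ lim]) auto
  qed
qed

end

lemma bowen_potentialI:
  assumes "countable S" and mix: "topologically_mixing S t"
    and pc: "positive_continuous_sequence S t f"
    and aa: "almost_additive S t f" and bo: "bowen_sequence S t f"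
    and bdd: "bdd_above (f 1 ` markov_shift S t)"
  obtains C V K where "bowen_potential S t f C V K"
proof -
  have pos: "0 < f n x" if "1 \<le> n" "x \<in> markov_shift S t" for n x
    using pc that by (auto simp: positive_continuous_sequence_def)
  from aa obtain C where C: "0 \<le> C" and
    aa': "\<And>n m x. 1 \<le> n \<Longrightarrow> 1 \<le> m \<Longrightarrow> x \<in> markov_shift S t \<Longrightarrow>
      f n x * f m ((shift_map ^^ n) x) * exp (- C) \<le> f (n + m) x \<and>
      f (n + m) x \<le> f n x * f m ((shift_map ^^ n) x) * exp C"
    unfolding almost_additive_def by blast
  from bo obtain M where M: "0 < M" "(SUP n\<in>{1..}. variation S t f n) \<le> ereal M"
    unfolding bowen_sequence_def by blast
  from bdd obtain b where b: "\<And>x. x \<in> markov_shift S t \<Longrightarrow> f 1 x \<le> b"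
    by (auto simp: bdd_above_def)
  \<comment> \<open>Absolute values make the constants nonnegative; the maximum with 1 keeps the
    argument of the logarithm positive whatever bound \<open>b\<close> is given.\<close>
  have "bowen_potential S t f C \<bar>ln M\<bar> \<bar>ln (max 1 b)\<bar>"
  proof
    fix n m :: nat and x assume nm: "1 \<le> n" "1 \<le> m" and x: "x \<in> markov_shift S t"
    let ?u = "f n x" and ?v = "f m ((shift_map ^^ n) x)"
    have p: "0 < ?u" "0 < ?v" "0 < f (n + m) x"
      using nm x by (auto intro!: pos shift_pow_mem)
    have l: "ln (?u * ?v * exp c) = ln ?u + ln ?v + c" for c using p by (simp add: ln_mult)
    have "ln (?u * ?v * exp (- C)) \<le> ln (f (n + m) x)"
      using aa'[OF nm x] p by (subst ln_le_cancel_iff) auto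
    then show "ln ?u + ln ?v - C \<le> ln (f (n + m) x)" unfolding l by simp
    have "ln (f (n + m) x) \<le> ln (?u * ?v * exp C)"
      using aa'[OF nm x] p by (subst ln_le_cancel_iff) auto
    then show "ln (f (n + m) x) \<le> ln ?u + ln ?v + C" unfolding l .
  next
    fix n :: nat and x y assume n: "1 \<le> n" and x: "x \<in> markov_shift S t" and y: "y \<in> markov_shift S t"
      and eq: "\<And>i. i < n \<Longrightarrow> x i = y i"
    have p: "0 < f n x" "0 < f n y" using n x y by (auto intro: pos)
    have "ereal (f n x / f n y) \<le> variation S t f n"
      unfolding variation_def using x y eq by (intro Sup_upper) blast
    also have "\<dots> \<le> (SUP n\<in>{1..}. variation S t f n)" using n by (intro SUP_upper) simp
    also have "\<dots> \<le> ereal M" by (rule M(2))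
    finally have "f n x \<le> M * f n y" using p by (simp add: field_simps)
    then have "ln (f n x) \<le> ln (M * f n y)" using p M(1) by (subst ln_le_cancel_iff) auto
    also have "\<dots> = ln M + ln (f n y)" using p M(1) by (simp add: ln_mult)
    finally show "ln (f n x) \<le> ln (f n y) + \<bar>ln M\<bar>" by linarith
  next
    fix x assume x: "x \<in> markov_shift S t"
    have "0 < f 1 x" using x by (intro pos) auto
    moreover have "f 1 x \<le> max 1 b" using b[OF x] by simp
    ultimately have "ln (f 1 x) \<le> ln (max 1 b)" by (subst ln_le_cancel_iff) auto
    then show "ln (f 1 x) \<le> \<bar>ln (max 1 b)\<bar>" by linarith
  next
    fix n :: nat assume "1 \<le> n"
    then show "continuous_map (shift_topology S t) euclideanreal (f n)"
      using pc by (auto simp: positive_continuous_sequence_def)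
  qed (use assms C pos in auto)
  then show ?thesis by (rule that)
qed

theorem theorem3p1:
  fixes S :: "'a set" and t :: "'a \<Rightarrow> 'a \<Rightarrow> nat" and f :: "nat \<Rightarrow> (nat \<Rightarrow> 'a) \<Rightarrow> real"
  assumes "countable S" and "S \<noteq> {}"
    and "transition_matrix S t"
    and "topologically_mixing S t"
    and "positive_continuous_sequence S t f"
    and "almost_additive S t f"
    and "bowen_sequence S t f"
    and "bdd_above (f 1 ` markov_shift S t)"
  shows "gurevich_pressure S t f =
           Sup {measure_entropy \<mu> shift_map + limit_of_integrals f \<mu> |\<mu>.
                  \<mu> \<in> invariant_measures S t \<and> limit_of_integrals f \<mu> \<noteq> - \<infinity>} \<and>
         Sup {measure_entropy \<mu> shift_map + limit_of_integrals f \<mu> |\<mu>.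
                  \<mu> \<in> invariant_measures S t \<and> limit_of_integrals f \<mu> \<noteq> - \<infinity>} =
           Sup {measure_entropy \<mu> shift_map + integral_of_limit f \<mu> |\<mu>.
                  \<mu> \<in> invariant_measures S t \<and> integral_of_limit f \<mu> \<noteq> - \<infinity>}"
proof -
  obtain C V K where "bowen_potential S t f C V K"
    by (rule bowen_potentialI[OF assms(1,4-8)])
  then interpret bowen_potential S t f C V K .
  have "{measure_entropy \<mu> shift_map + limit_of_integrals f \<mu> |\<mu>.
          \<mu> \<in> invariant_measures S t \<and> limit_of_integrals f \<mu> \<noteq> - \<infinity>} =
        {measure_entropy \<mu> shift_map + integral_of_limit f \<mu> |\<mu>.
          \<mu> \<in> invariant_measures S t \<and> integral_of_limit f \<mu> \<noteq> - \<infinity>}"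
    using integrals_agree(1) by (intro Collect_cong) (metis (no_types, lifting))
  then show ?thesis using gurevich_pressure_eq[OF assms(2)] by simp
qed

end
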